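(* Assume the Riemann hypothesis. Then, for each fixed constant $0<\beta<1$, there exists a constant $c>0$ such that, for all sufficiently large $T$, both $$\max_{T^\beta\leq t\leq T} S(t) \;\geq\; c\,\sqrt{\frac{\log T\,\log\log\log T}{\log\log T}}$$ and $$\max_{T^\beta\leq t\leq T} \big(-S(t)\big) \;\geq\; c\,\sqrt{\frac{\log T\,\log\log\log T}{\log\log T}}$$ hold.
   Context: $\zeta$ denotes the Riemann zeta-function. For $t>0$ not the ordinate of a non-trivial zero of $\zeta$, define $S(t)=\frac1\pi\arg\zeta\left(\frac12+it\right)$, where the argument is obtained by continuous variation of $\arg\zeta(s)$ along the polygonal path starting at $s=2$ (where $\arg\zeta(2)=0$), going first to $s=2+it$ and then to $s=\frac12+it$. If $t>0$ is the ordinate of a non-trivial zero of $\zeta$, define $S(t)=\lim_{\epsilon\to0}\frac12\big(S(t+\epsilon)+S(t-\epsilon)\big)$. Here $\max$ over an interval is understood as the supremum over that interval. *)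

theory Defs
  imports "HOL-Complex_Analysis.Complex_Analysis"
begin

(* The analytic continuation of the Dirichlet series to the plane without 1. It is unique by the
   identity theorem; the value 0 at the pole is a convention that makes THE determinate. *)
definition zeta :: "complex \<Rightarrow> complex" where
  "zeta = (THE f. f holomorphic_on (- {1}) \<and>
             (\<forall>s. Re s > 1 \<longrightarrow> f s = (\<Sum>n. 1 / of_nat (Suc n) powr s)) \<and>
             f 1 = 0)"

(* The condition \<rho> \<noteq> 1 discards the conventional value at the pole. *)
definition nontrivial_zeta_zero :: "complex \<Rightarrow> bool" where
  "nontrivial_zeta_zero \<rho> \<longleftrightarrow>
     zeta \<rho> = 0 \<and> \<rho> \<noteq> 1 \<and> (\<nexists>n::nat. \<rho> = - 2 * of_nat (Suc n))"

definition riemann_hypothesis :: bool where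
  "riemann_hypothesis \<longleftrightarrow> (\<forall>\<rho>. nontrivial_zeta_zero \<rho> \<longrightarrow> Re \<rho> = 1 / 2)"

definition zeta_zero_ordinate :: "real \<Rightarrow> bool" where
  "zeta_zero_ordinate t \<longleftrightarrow> (\<exists>\<rho>. nontrivial_zeta_zero \<rho> \<and> Im \<rho> = t)"

(* The final value of the continuous choice of arg f along the path p that starts with the
   value a. It is determinate when f is continuous and nonvanishing on the path and a is an
   argument of f at its starting point. *)
definition arg_along :: "(complex \<Rightarrow> complex) \<Rightarrow> (real \<Rightarrow> complex) \<Rightarrow> real \<Rightarrow> real" where
  "arg_along f p a = (THE \<theta>. \<exists>\<phi>. continuous_on {0..1} \<phi> \<and> \<phi> 0 = a \<and>
      (\<forall>x\<in>{0..1}. f (p x) = rcis (norm (f (p x))) (\<phi> x)) \<and> \<phi> 1 = \<theta>)"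

(* The value S(t) for t > 0 that is not the ordinate of a nontrivial zero. *)
definition zeta_S_regular :: "real \<Rightarrow> real" where
  "zeta_S_regular t =
     arg_along zeta (linepath 2 (Complex 2 t) +++ linepath (Complex 2 t) (Complex (1/2) t)) 0 / pi"

(* Ordinates of zeros are isolated, so for small \<epsilon> \<noteq> 0 the arguments t + \<epsilon> and t - \<epsilon> in the limit
   are not ordinates. Only t > 0 is meaningful. *)
definition zeta_S :: "real \<Rightarrow> real" where
  "zeta_S t =
     (if zeta_zero_ordinate t
      then Lim (at 0) (\<lambda>\<epsilon>. (zeta_S_regular (t + \<epsilon>) + zeta_S_regular (t - \<epsilon>)) / 2)
      else zeta_S_regular t)"

end

theory Submission
  imports Defs "HOL-Probability.Probability" "HOL-Number_Theory.Prime_Powers" "HOL-Real_Asymp.Real_Asymp"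
begin

text \<open>Let \<open>H = ln (ln T)\<close>. Under the Riemann hypothesis \<open>L = ln zeta\<close> is holomorphic for \<open>Re s > 1/2\<close>,
  \<open>Im s > 0\<close>, and a bound for \<open>\<plusminus> S\<close> on \<open>[T powr \<beta>, T]\<close> passes to \<open>\<plusminus> Im L / pi\<close> on the line
  \<open>Re s = 1/2 + 1/H\<close> by the maximum principle. There it is integrated against the positive kernel
  \<open>exp (- H * u\<^sup>2 / 2) * (1 \<mp> sin (H * u))\<close>. Moving the line of integration to \<open>Re s = 2\<close> shows that the
  result is, up to a small power of \<open>ln T\<close>, half of the real part of the Dirichlet series
  \<open>D(t) = (\<Sum>n. a n * n powr - (1/2 + 1/H + \<i> * t) * exp (- (ln n - H)\<^sup>2 / (2 * H)))\<close> with \<open>a n \<ge> 0\<close>: the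
  constant part of the kernel only sees small \<open>n\<close>, and the sine turns the imaginary part into the
  real part, whatever the sign.

  The values of \<open>Re D\<close> are bounded from below on average over \<open>t\<close> with the weight
  \<open>(norm (R t))\<^sup>2 * exp (- t\<^sup>2 / (2 * \<tau>\<^sup>2))\<close>. Since this weight is even with nonnegative cosine transform
  and \<open>Re D\<close> is even with nonnegative coefficients, only the contribution of suitable primes has to
  be kept. The resonator \<open>R\<close> is built from products of at most one prime from each of many groups of
  primes near \<open>ln T * ln (ln T)\<close>; groups at distance \<open>2 ^ k\<close> from this point each contribute about
  \<open>1/k\<close>, and the harmonic sum over \<open>k\<close> is the source of the factor \<open>ln (ln (ln T))\<close>.\<close>

section \<open>Analytic continuation and growth of zeta\<close>

text \<open>The hypothesis to be refuted bounds \<open>S\<close> from one side only, and this shapes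
  every step: the passage from the critical line to the right must use the maximum principle, and
  the kernel must be nonnegative. The sine has frequency exactly \<open>H\<close>, so its Gaussian
  lands on \<open>ln n = H\<close>, that is on primes near \<open>ln T\<close>. The standard
  deviation \<open>sqrt H\<close> on the scale of \<open>ln n\<close> leaves about
  \<open>sqrt H\<close> dyadic blocks of primes whose weight is comparable to
  \<open>p powr - (1/2)\<close>, and their harmonic sum has size \<open>ln H / 2\<close>; the factor
  \<open>p powr - (1/H)\<close> costs only a constant there. What the constant part of the kernel
  contributes is at most a multiple of \<open>exp (H / 4)\<close>, the fourth root of
  \<open>ln T\<close>, below the square root that is sought. The interval limits the resonator. Its
  Gaussian has width \<open>\<tau> = T powr ((1 + \<beta>) / 2)\<close>, the geometric mean of the
  two ends, and at most \<open>T powr \<kappa>\<close> bins with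
  \<open>\<kappa> = (1 - \<beta>) / 4\<close> are few enough for the trivial bound outside the
  interval to be harmless.\<close>

lemma norm_of_nat_powr: "norm (of_nat n powr s :: complex) = real n powr Re s"
  by (cases "n = 0") (auto simp: norm_powr_real_powr)

text \<open>Stated for arbitrary bounded coefficients so that it covers zeta and its logarithm at
  once. Half the distance to the line \<open>Re s = 1\<close> gives the local majorant
  \<open>n powr - (1 + d)\<close>. The index 0 is harmless, here and in all later series, because
  \<open>0 powr z = 0\<close>.\<close>

lemma dirichlet_series_deriv:
  fixes c :: "nat \<Rightarrow> complex"
  assumes c: "\<And>n. norm (c n) \<le> 1" and s: "Re s > 1"
  defines "D \<equiv> (\<lambda>s. \<Sum>n. c n * of_nat n powr - s)"
  shows "summable (\<lambda>n. norm (c n * of_nat n powr - s))"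
    and "(\<lambda>n. - (of_real (ln (real n)) * c n * of_nat n powr - s)) sums deriv D s"
    and "(D has_field_derivative deriv D s) (at s)"
proof -
  let ?S = "{s. Re s > 1}"
  have op: "open ?S" by (rule open_halfspace_Re_gt)
  have bound: "norm (c n * of_nat n powr - z) \<le> real n powr - a" if "Re z \<ge> a" for n z a
  proof -
    have "norm (c n * of_nat n powr - z) \<le> 1 * real n powr - Re z"
      unfolding norm_mult norm_of_nat_powr by (intro mult_mono) (use c in auto)
    also have "\<dots> \<le> real n powr - a"
      using that by (cases "n = 0") (auto intro!: powr_mono)
    finally show ?thesis .
  qed
  have "\<exists>g g'. \<forall>x\<in>?S. (\<lambda>n. c n * of_nat n powr - x) sums g x \<and>
          (\<lambda>n. - (of_real (ln (real n)) * c n * of_nat n powr - x)) sums g' x \<and>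
          (g has_field_derivative g' x) (at x)"
  proof (rule series_and_derivative_comparison_local[OF op])
    fix n x assume "x \<in> ?S"
    show "((\<lambda>x. c n * of_nat n powr - x) has_field_derivative
             - (of_real (ln (real n)) * c n * of_nat n powr - x)) (at x)"
    proof (cases "n = 0")
      case False
      then show ?thesis
        by (auto intro!: derivative_eq_intros simp: powr_def)
    qed auto
  next
    fix x assume x: "x \<in> ?S"
    define d where "d = (Re x - 1) / 2"
    have "d > 0" using x by (auto simp: d_def)
    moreover have "summable (\<lambda>n. real n powr - (1 + d))"
      using \<open>d > 0\<close> by (subst summable_real_powr_iff) auto
    moreover have "norm (c n * of_nat n powr - y) \<le> real n powr - (1 + d)" if "y \<in> ball x d \<inter> ?S" for n y
    proof (rule bound)
      have "\<bar>Re (x - y)\<bar> \<le> norm (x - y)" by (rule abs_Re_le_cmod)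
      then have "Re x - Re y < d" using that by (auto simp: dist_norm)
      then show "Re y \<ge> 1 + d" by (simp add: d_def field_simps)
    qed
    ultimately show "\<exists>d h. 0 < d \<and> summable h \<and>
        (\<forall>\<^sub>F n in sequentially. \<forall>y\<in>ball x d \<inter> ?S. norm (c n * of_nat n powr - y) \<le> h n)"
      by (intro exI[of _ d] exI[of _ "\<lambda>n. real n powr - (1 + d)"]) auto
  qed
  then obtain g g' where g: "\<And>x. x \<in> ?S \<Longrightarrow> (\<lambda>n. c n * of_nat n powr - x) sums g x"
     "\<And>x. x \<in> ?S \<Longrightarrow> (\<lambda>n. - (of_real (ln (real n)) * c n * of_nat n powr - x)) sums g' x"
     "\<And>x. x \<in> ?S \<Longrightarrow> (g has_field_derivative g' x) (at x)" by blast
  have Dg: "D x = g x" if "x \<in> ?S" for x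
    using sums_unique[OF g(1)[OF that]] by (simp add: D_def)
  have D': "(D has_field_derivative g' s) (at s)"
    by (rule has_field_derivative_transform_within_open[OF g(3) op]) (use s Dg in auto)
  then have eq: "deriv D s = g' s" by (rule DERIV_imp_deriv)
  show "(D has_field_derivative deriv D s) (at s)" using D' eq by simp
  show "(\<lambda>n. - (of_real (ln (real n)) * c n * of_nat n powr - s)) sums deriv D s"
    using g(2) s eq by simp
  show "summable (\<lambda>n. norm (c n * of_nat n powr - s))"
  proof (rule summable_comparison_test')
    show "summable (\<lambda>n. real n powr - Re s)"
      using s by (subst summable_real_powr_iff) auto
  qed (use bound[of "Re s" s] in auto)
qed

definition zeta_series :: "complex \<Rightarrow> complex" where
  "zeta_series s = (\<Sum>n. of_nat n powr - s)"

lemma zeta_series_sums: "Re s > 1 \<Longrightarrow> (\<lambda>n. of_nat n powr - s) sums zeta_series s"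
  using dirichlet_series_deriv(1)[of "\<lambda>_. 1" s] unfolding zeta_series_def
  by (auto dest: summable_norm_cancel summable_sums)

lemma zeta_series_Suc_sums: "Re s > 1 \<Longrightarrow> (\<lambda>n. of_nat (Suc n) powr - s) sums zeta_series s"
  using zeta_series_sums[of s] by (subst sums_Suc_iff) auto

lemma zeta_series_holomorphic: "zeta_series holomorphic_on {s. Re s > 1}"
proof -
  have "zeta_series field_differentiable (at s)" if "Re s > 1" for s
    using dirichlet_series_deriv(3)[of "\<lambda>_. 1" s] that unfolding zeta_series_def field_differentiable_def
    by auto
  then show ?thesis
    by (auto simp: holomorphic_on_def intro: field_differentiable_at_within)
qed

text \<open>Summed over \<open>n\<close>, the main term telescopes and the Taylor terms are values of zeta at \<open>s\<close>,
  \<open>s + 1\<close>, and so on, so each further term continues zeta one unit further to the left.\<close>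

definition taylor_rem :: "nat \<Rightarrow> nat \<Rightarrow> complex \<Rightarrow> complex" where
  "taylor_rem M n s = of_nat (Suc n) powr (1 - s) -
     (\<Sum>k\<le>M. ((1 - s) gchoose k) * of_nat n powr (1 - s - of_nat k))"

lemma norm_gbinomial_le: "norm ((a :: complex) gchoose k) \<le> pochhammer (norm a) k / fact k"
proof -
  have "norm (\<Prod>i = 0..<k. a - of_nat i) \<le> (\<Prod>i = 0..<k. norm a + of_nat i)"
    unfolding prod_norm[symmetric]
    by (intro prod_mono conjI norm_ge_zero) (metis norm_of_nat norm_triangle_ineq4)
  then show ?thesis
    unfolding gbinomial_prod_rev pochhammer_prod norm_divide by (simp add: divide_right_mono)
qed

text \<open>The binomial series of \<open>(1 - x) powr - A\<close> at \<open>x = 1/2\<close>. With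
  \<open>A = norm (1 - s)\<close> it dominates, up to a factor, the Taylor expansion of
  \<open>(n + 1) powr (1 - s)\<close> for \<open>n \<ge> 2\<close>.\<close>

lemma pochhammer_geometric_sums:
  "(\<lambda>k. pochhammer A k / fact k * (1/2) ^ k) sums (2 powr (A :: real))"
proof -
  have "(\<lambda>k. (- A gchoose k) * (-1/2) ^ k) sums (1 + (-1/2)) powr (-A)"
    by (rule gen_binomial_real) auto
  moreover have "(- A gchoose k) * (-1/2) ^ k = pochhammer A k / fact k * (1/2) ^ k" for k
    by (simp add: gbinomial_pochhammer power_mult_distrib [symmetric] mult_ac flip: power_mult_distrib)
  moreover have "(1 + (-1/2)) powr (-A) = 2 powr A"
    by (simp add: powr_minus powr_divide)
  ultimately show ?thesis by simp
qed

lemma taylor_rem_bound: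
  assumes n: "n \<ge> 2"
  shows "norm (taylor_rem M n s) \<le> 2 ^ Suc M * 2 powr norm (1 - s) * real n powr (- Re s - real M)"
proof -
  define A where "A = norm (1 - s)"
  define f where "f k = ((1 - s) gchoose k) * of_nat n powr (1 - s - of_nat k)" for k
  define p where "p k = pochhammer A k / fact k * (1/2) ^ k" for k
  have p: "p sums (2 powr A)" unfolding p_def by (rule pochhammer_geometric_sums)
  have pnn: "p k \<ge> 0" for k by (auto simp: p_def A_def pochhammer_prod intro!: mult_nonneg_nonneg divide_nonneg_nonneg prod_nonneg)
  have pn: "0 \<le> pochhammer A j / fact j" for j
    unfolding pochhammer_prod A_def by (intro divide_nonneg_nonneg prod_nonneg) auto
  have "f sums (of_real (real n + 1) powr (1 - s))"
    unfolding f_def using gen_binomial_complex''[of 1 "real n" "1 - s"] n by simp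
  then have "(\<lambda>k. f (k + Suc M)) sums (of_real (real n + 1) powr (1 - s) - (\<Sum>k<Suc M. f k))"
    by (rule sums_split_initial_segment)
  then have fs: "(\<lambda>k. f (k + Suc M)) sums taylor_rem M n s"
    by (simp add: taylor_rem_def f_def lessThan_Suc_atMost add_ac)
  let ?K = "2 ^ Suc M * real n powr (- Re s - real M)"
  have fb: "norm (f (k + Suc M)) \<le> ?K * p (k + Suc M)" for k
  proof -
    have "norm (f (k + Suc M)) \<le> pochhammer A (k + Suc M) / fact (k + Suc M) *
             real n powr (1 - Re s - real (k + Suc M))"
      unfolding f_def norm_mult norm_of_nat_powr A_def
      by (intro mult_mono norm_gbinomial_le) (use pn[unfolded A_def] in \<open>auto simp del: pochhammer_Suc fact_Suc\<close>)
    also have "real n powr (1 - Re s - real (k + Suc M)) = real n powr (- Re s - real M) * real n powr (- real k)"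
      by (subst powr_add[symmetric]) (simp add: algebra_simps)
    \<comment> \<open>Only the excess \<open>n powr - k\<close> over the first omitted term is
      traded for \<open>(1/2) ^ k\<close>, so the decay in \<open>n\<close> survives.\<close>
    also have "pochhammer A (k + Suc M) / fact (k + Suc M) * \<dots> \<le>
        pochhammer A (k + Suc M) / fact (k + Suc M) * (real n powr (- Re s - real M) * (1/2) ^ k)"
    proof (intro mult_left_mono)
      have "real n powr (- real k) \<le> 2 powr (- real k)"
        using n by (intro powr_mono2') auto
      also have "\<dots> = (1/2) ^ k"
        by (simp add: powr_minus powr_realpow power_divide inverse_eq_divide)
      finally show "real n powr (- real k) \<le> (1/2) ^ k" .
    qed (use pn in \<open>auto simp del: pochhammer_Suc fact_Suc\<close>)
    also have "real n powr (- Re s - real M) * (1/2) ^ k = ?K * (1/2) ^ (k + Suc M)"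
      by (simp add: power_add power_one_over)
    finally show ?thesis
      by (simp add: p_def mult_ac)
  qed
  have ps: "summable (\<lambda>k. p (k + Suc M))" using p summable_iff_shift[of p "Suc M"] by (simp add: sums_iff)
  have "norm (taylor_rem M n s) = norm (\<Sum>k. f (k + Suc M))" using fs by (simp add: sums_iff)
  also have "\<dots> \<le> (\<Sum>k. ?K * p (k + Suc M))"
    by (rule norm_suminf_le) (use fb ps in \<open>auto intro: summable_mult\<close>)
  also have "\<dots> = ?K * (\<Sum>k. p (k + Suc M))" using ps by (rule suminf_mult)
  also have "\<dots> \<le> ?K * 2 powr A"
  proof (rule mult_left_mono)
    have "(\<Sum>k. p (k + Suc M)) = 2 powr A - (\<Sum>k<Suc M. p k)"
      using suminf_minus_initial_segment[of p "Suc M"] p by (simp add: sums_iff)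
    then show "(\<Sum>k. p (k + Suc M)) \<le> 2 powr A" using sum_nonneg[of "{..<Suc M}" p] pnn by auto
  qed auto
  finally show ?thesis by (simp add: A_def mult_ac)
qed

lemma zeta_series_taylor:
  assumes s: "Re s > 1" and M: "M \<ge> 1"
  shows "(\<lambda>n. taylor_rem M (Suc n) s) sums
    ((s - 1) * zeta_series s - 1 - (\<Sum>k=2..M. ((1 - s) gchoose k) * zeta_series (s + of_nat k - 1)))"
proof -
  define f where "f n = of_nat (Suc n) powr (1 - s)" for n
  have "(\<lambda>n. norm (f n)) \<longlonglongrightarrow> 0"
  proof -
    have "(\<lambda>n. real (Suc n) powr (1 - Re s)) \<longlonglongrightarrow> 0"
      using s by (intro tendsto_neg_powr filterlim_compose[OF filterlim_real_sequentially filterlim_Suc]) auto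
    then show ?thesis unfolding f_def norm_of_nat_powr by simp
  qed
  then have "f \<longlonglongrightarrow> 0" by (rule tendsto_norm_zero_cancel)
  then have 1: "(\<lambda>n. f (Suc n) - f n) sums (0 - f 0)" by (rule telescope_sums)
  have 2: "(\<lambda>n. ((1 - s) gchoose k) * of_nat (Suc n) powr (1 - s - of_nat k)) sums
        (((1 - s) gchoose k) * zeta_series (s + of_nat k - 1))" if "k \<ge> 1" for k
  proof -
    have "Re (s + of_nat k - 1) > 1" using s that by simp
    from zeta_series_Suc_sums[OF this] show ?thesis
      by (intro sums_mult) (simp add: algebra_simps)
  qed
  have "(\<lambda>n. (f (Suc n) - f n) -
      (\<Sum>k=1..M. ((1 - s) gchoose k) * of_nat (Suc n) powr (1 - s - of_nat k))) sums
      ((0 - f 0) - (\<Sum>k=1..M. ((1 - s) gchoose k) * zeta_series (s + of_nat k - 1)))"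
    by (intro sums_diff 1 sums_sum 2) auto
  also have "(\<lambda>n. (f (Suc n) - f n) -
      (\<Sum>k=1..M. ((1 - s) gchoose k) * of_nat (Suc n) powr (1 - s - of_nat k))) =
      (\<lambda>n. taylor_rem M (Suc n) s)"
  proof
    fix n
    have "{..M} = insert 0 {1..M}" by auto
    then show "(f (Suc n) - f n) -
      (\<Sum>k=1..M. ((1 - s) gchoose k) * of_nat (Suc n) powr (1 - s - of_nat k)) = taylor_rem M (Suc n) s"
      by (simp add: taylor_rem_def f_def)
  qed
  also have "{1..M} = insert 1 {2..M}" using M by auto
  finally show ?thesis by (simp add: f_def algebra_simps)
qed

lemma taylor_rem_suminf_holomorphic:
  "(\<lambda>s. \<Sum>n. taylor_rem M (Suc n) s) holomorphic_on {s. Re s > 1 - real M}"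
proof -
  let ?S = "{s. Re s > 1 - real M}"
  have op: "open ?S" by (rule open_halfspace_Re_gt)
  have hol: "taylor_rem M (Suc n) holomorphic_on UNIV" for n
    unfolding taylor_rem_def gbinomial_prod_rev by (intro holomorphic_intros) auto
  have "\<exists>g g'. \<forall>x\<in>?S. (\<lambda>n. taylor_rem M (Suc n) x) sums g x \<and>
          (\<lambda>n. deriv (taylor_rem M (Suc n)) x) sums g' x \<and> (g has_field_derivative g' x) (at x)"
  proof (rule series_and_derivative_comparison_local[OF op])
    fix n x
    show "(taylor_rem M (Suc n) has_field_derivative deriv (taylor_rem M (Suc n)) x) (at x)"
      using hol by (intro holomorphic_derivI[of _ UNIV]) auto
  next
    fix x assume x: "x \<in> ?S"
    define d where "d = (Re x - (1 - real M)) / 2"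
    have d: "d > 0" using x by (auto simp: d_def)
    define h where "h n = 2 ^ Suc M * 2 powr (norm (1 - x) + d) * real (Suc n) powr - (1 + d)" for n
    have "summable (\<lambda>n. real n powr - (1 + d))"
      using d by (subst summable_real_powr_iff) auto
    then have "summable (\<lambda>n. real (Suc n) powr - (1 + d))"
      by (subst summable_Suc_iff)
    then have "summable h" unfolding h_def by (intro summable_mult)
    moreover have "norm (taylor_rem M (Suc n) y) \<le> h n" if "n \<ge> 1" "y \<in> ball x d" for n y
    proof -
      have "norm (taylor_rem M (Suc n) y) \<le>
          2 ^ Suc M * 2 powr norm (1 - y) * real (Suc n) powr (- Re y - real M)"
        using that by (intro taylor_rem_bound) auto
      also have "\<dots> \<le> h n" unfolding h_def
      proof (intro mult_mono powr_mono)
        have n1: "norm (x - y) < d" using that by (auto simp: dist_norm)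
        show "norm (1 - y) \<le> norm (1 - x) + d"
          using n1 norm_triangle_ineq[of "1 - x" "x - y"] by simp
        have "\<bar>Re (x - y)\<bar> < d" using abs_Re_le_cmod[of "x - y"] n1 by linarith
        then have "Re x - Re y < d" by simp
          then show "- Re y - real M \<le> - (1 + d)" by (simp add: d_def field_simps)
      qed auto
      finally show ?thesis .
    qed
    ultimately show "\<exists>d h. 0 < d \<and> summable h \<and>
        (\<forall>\<^sub>F n in sequentially. \<forall>y\<in>ball x d \<inter> ?S. norm (taylor_rem M (Suc n) y) \<le> h n)"
      using d by (intro exI[of _ d] exI[of _ h]) (auto intro!: eventually_sequentiallyI[of 1])
  qed
  then obtain g g' where g: "\<And>x. x \<in> ?S \<Longrightarrow> (\<lambda>n. taylor_rem M (Suc n) x) sums g x"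
     "\<And>x. x \<in> ?S \<Longrightarrow> (g has_field_derivative g' x) (at x)" by blast
  have "g holomorphic_on ?S"
    unfolding holomorphic_on_def using g(2) by (auto simp: field_differentiable_def intro: has_field_derivative_at_within)
  then show ?thesis
    by (rule holomorphic_transform) (use sums_unique[OF g(1)] in auto)
qed

text \<open>Multiplying by \<open>s - 1\<close> removes the pole, so that every induction step deals
  with holomorphic functions only.\<close>

lemma zeta_continuation_halfplane:
  "\<exists>Z. Z holomorphic_on {s. Re s > 1 - real m} \<and> (\<forall>s. Re s > 1 \<longrightarrow> Z s = (s - 1) * zeta_series s)"
proof (induction m)
  case 0
  show ?case
    by (intro exI[of _ "\<lambda>s. (s - 1) * zeta_series s"] conjI holomorphic_intros)
       (use zeta_series_holomorphic in auto)
next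
  case (Suc m)
  then obtain Z where Z: "Z holomorphic_on {s. Re s > 1 - real m}"
    "\<And>s. Re s > 1 \<Longrightarrow> Z s = (s - 1) * zeta_series s" by blast
  define M where "M = Suc m"
  \<comment> \<open>The binomial coefficient without its last factor \<open>1 - s - (k - 1)\<close>.
    That factor is minus \<open>s + k - 2\<close>, exactly what turns
    \<open>zeta_series (s + k - 1)\<close> into \<open>Z (s + k - 1)\<close>.\<close>
  define Q where "Q k s = (\<Prod>i<k-1. 1 - s - of_nat i) / fact k" for k and s :: complex
  define W where "W s = 1 - (\<Sum>k=2..M. Q k s * Z (s + of_nat k - 1)) + (\<Sum>n. taylor_rem M (Suc n) s)" for s
  have "W holomorphic_on {s. Re s > 1 - real M}"
  proof -
    have "(\<lambda>s. Z (s + of_nat k - 1)) holomorphic_on {s. Re s > 1 - real M}" if "k \<ge> 2" for k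
      by (rule holomorphic_on_compose_gen[OF _ Z(1), unfolded o_def])
         (use that in \<open>auto intro!: holomorphic_intros simp: M_def\<close>)
    then show ?thesis unfolding W_def Q_def
      by (intro holomorphic_intros taylor_rem_suminf_holomorphic) auto
  qed
  moreover have "W s = (s - 1) * zeta_series s" if s: "Re s > 1" for s
  proof -
    have Qk: "((1 - s) gchoose k) * zeta_series (s + of_nat k - 1) = - (Q k s * Z (s + of_nat k - 1))"
      if k: "k \<in> {2..M}" for k
    proof -
      obtain j where j: "k = Suc j" using k by (cases k) auto
      have "Z (s + of_nat k - 1) = (s + of_nat k - 1 - 1) * zeta_series (s + of_nat k - 1)"
        using s k by (intro Z(2)) auto
      then show ?thesis
        by (simp add: Q_def gbinomial_prod_rev j atLeast0LessThan divide_simps) (simp add: algebra_simps)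
    qed
    have "(\<lambda>n. taylor_rem M (Suc n) s) sums
      ((s - 1) * zeta_series s - 1 - (\<Sum>k=2..M. ((1 - s) gchoose k) * zeta_series (s + of_nat k - 1)))"
      using s by (intro zeta_series_taylor) (auto simp: M_def)
    also have "(\<Sum>k=2..M. ((1 - s) gchoose k) * zeta_series (s + of_nat k - 1)) =
        (\<Sum>k=2..M. - (Q k s * Z (s + of_nat k - 1)))"
      by (intro sum.cong Qk) auto
    finally have "(\<Sum>n. taylor_rem M (Suc n) s) =
        (s - 1) * zeta_series s - 1 - (\<Sum>k=2..M. - (Q k s * Z (s + of_nat k - 1)))"
      by (rule sums_unique[symmetric])
    then show ?thesis by (simp add: W_def sum_negf)
  qed
  ultimately show ?case by (intro exI[of _ W]) (auto simp: M_def)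
qed

lemma zeta_continuation:
  "\<exists>Z. Z holomorphic_on UNIV \<and> (\<forall>s. Re s > 1 \<longrightarrow> Z s = (s - 1) * zeta_series s)"
proof -
  obtain Z where Z: "\<And>m. Z m holomorphic_on {s. Re s > 1 - real m}"
    "\<And>m s. Re s > 1 \<Longrightarrow> Z m s = (s - 1) * zeta_series s"
    using zeta_continuation_halfplane by metis
  have eq: "Z m s = Z n s" if "Re s > 1 - real m" "m \<le> n" for m n s
  proof (rule analytic_continuation_open[where f = "Z m" and g = "Z n" and
        s = "{s. Re s > 1}" and s' = "{s. Re s > 1 - real m}"])
    have "(2::complex) \<in> {s. Re s > 1}" by simp
    then show "{s. Re s > 1} \<noteq> {}" by blast
    show "Z n holomorphic_on {s. Re s > 1 - real m}"
      using Z(1)[of n] by (rule holomorphic_on_subset) (use that in auto)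
  qed (use that Z in \<open>auto intro: open_halfspace_Re_gt convex_connected convex_halfspace_Re_gt\<close>)
  \<comment> \<open>The index depends on \<open>s\<close>, but any admissible one gives the same
    value; \<open>2 - Re s\<close> instead of \<open>1 - Re s\<close> makes the inequality
    \<open>Re s > 1 - m\<close> strict.\<close>
  define W where "W s = Z (nat \<lceil>2 - Re s\<rceil>) s" for s
  have W: "W s = Z m s" if "Re s > 1 - real m" for s m
  proof -
    have "Re s > 1 - real (nat \<lceil>2 - Re s\<rceil>)" by linarith
    then show ?thesis unfolding W_def
      using eq[of m s "nat \<lceil>2 - Re s\<rceil>"] eq[of "nat \<lceil>2 - Re s\<rceil>" s m] that
      by (cases "m \<le> nat \<lceil>2 - Re s\<rceil>") auto
  qed
  have "W field_differentiable (at s)" for s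
  proof -
    define m where "m = nat \<lceil>2 - Re s\<rceil>"
    have m: "Re s > 1 - real m" unfolding m_def by linarith
    have "W holomorphic_on {s. Re s > 1 - real m}"
      by (rule holomorphic_transform[OF Z(1)[of m]]) (use W in auto)
    then show ?thesis
      by (rule holomorphic_on_imp_differentiable_at) (use m in \<open>auto intro: open_halfspace_Re_gt\<close>)
  qed
  then have "W holomorphic_on UNIV" by (auto simp: holomorphic_on_def intro: field_differentiable_at_within)
  moreover have "W s = (s - 1) * zeta_series s" if "Re s > 1" for s
    using W[of 0 s] Z(2) that by simp
  ultimately show ?thesis by blast
qed

lemma zeta_spec:
  "zeta holomorphic_on (- {1}) \<and> (\<forall>s. Re s > 1 \<longrightarrow> zeta s = (\<Sum>n. 1 / of_nat (Suc n) powr s)) \<and> zeta 1 = 0"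
proof -
  have ser: "(\<Sum>n. 1 / of_nat (Suc n) powr s) = zeta_series s" if "Re s > 1" for s
    using sums_unique[OF zeta_series_Suc_sums[OF that]] by (simp add: powr_minus inverse_eq_divide)
  obtain Z where Z: "Z holomorphic_on UNIV" "\<And>s. Re s > 1 \<Longrightarrow> Z s = (s - 1) * zeta_series s"
    using zeta_continuation by blast
  define f where "f s = (if s = 1 then 0 else Z s / (s - 1))" for s
  have "(\<lambda>s. Z s / (s - 1)) holomorphic_on (- {1})"
    by (intro holomorphic_intros holomorphic_on_subset[OF Z(1)]) auto
  then have f1: "f holomorphic_on (- {1})"
    by (rule holomorphic_transform) (auto simp: f_def)
  have f2: "f s = (\<Sum>n. 1 / of_nat (Suc n) powr s)" if "Re s > 1" for s
    using that Z(2)[OF that] ser[OF that] by (auto simp: f_def)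
  have "\<exists>!f. f holomorphic_on (- {1}) \<and>
    (\<forall>s. Re s > 1 \<longrightarrow> f s = (\<Sum>n. 1 / of_nat (Suc n) powr s)) \<and> f 1 = 0"
  proof (rule ex1I[of _ f])
    show "f holomorphic_on (- {1}) \<and>
      (\<forall>s. Re s > 1 \<longrightarrow> f s = (\<Sum>n. 1 / of_nat (Suc n) powr s)) \<and> f 1 = 0"
      using f1 f2 by (auto simp: f_def)
  next
    fix g assume g: "g holomorphic_on (- {1}) \<and>
      (\<forall>s. Re s > 1 \<longrightarrow> g s = (\<Sum>n. 1 / of_nat (Suc n) powr s)) \<and> g 1 = 0"
    show "g = f"
    proof
      fix s
      show "g s = f s"
      proof (cases "s = 1")
        case False
        show ?thesis
        proof (rule analytic_continuation_open[where f = g and g = f and s = "{s. Re s > 1}" and s' = "- {1}"])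
          have "(2::complex) \<in> {s. Re s > 1}" by simp
          then show "{s. Re s > 1} \<noteq> {}" by blast
          show "connected (- {1 :: complex})" by (rule connected_punctured_universe) auto
        qed (use False g f1 f2 in \<open>auto intro: open_halfspace_Re_gt\<close>)
      qed (use g in \<open>auto simp: f_def\<close>)
    qed
  qed
  from theI'[OF this] show ?thesis unfolding zeta_def .
qed

lemma zeta_holomorphic: "zeta holomorphic_on (- {1})"
  and zeta_eq_series: "Re s > 1 \<Longrightarrow> zeta s = zeta_series s"
  using zeta_spec sums_unique[OF zeta_series_Suc_sums[of s]] by (simp_all add: powr_minus inverse_eq_divide)

text \<open>The constant in \<open>taylor_rem_bound\<close> is exponential in
  \<open>norm (1 - s)\<close>, too large for growth estimates. Two mean value estimates give a
  quadratic one: the first for \<open>z powr - s\<close>, the second for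
  \<open>z powr (1 - s)\<close> minus its linear part at \<open>n\<close>.\<close>

lemma taylor_rem_1_bound:
  assumes s: "Re s \<ge> 1/2" and n: "n \<ge> 1"
  shows "norm (taylor_rem 1 n s) \<le> norm (1 - s) * norm s * real n powr (- 3/2)"
proof -
  define S where "S = complex_of_real ` {real n..real n + 1}"
  have "convex S" unfolding S_def
    by (intro convex_linear_image bounded_linear.linear bounded_linear_of_real) auto
  have Sn: "of_nat n \<in> S" "of_nat n + 1 \<in> S"
    by (auto simp: S_def image_iff intro: bexI[of _ "real n"] bexI[of _ "real n + 1"])
  have mv: "norm (z powr - s - of_nat n powr - s) \<le> norm s * real n powr (- 3/2)" if z: "z \<in> S" for z
  proof -
    have "norm (z powr - s - of_nat n powr - s) \<le> norm s * real n powr (- 3/2) * norm (z - of_nat n)"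
    proof (rule field_differentiable_bound[OF \<open>convex S\<close>])
      fix w assume "w \<in> S"
      then obtain x where x: "w = of_real x" "x \<ge> real n" unfolding S_def by auto
      have "w \<notin> \<real>\<^sub>\<le>\<^sub>0" using x n by auto
      then show "((\<lambda>z. z powr - s) has_field_derivative (- s) * w powr (- s - 1)) (at w within S)"
        by (auto intro!: derivative_eq_intros)
      have "norm (w powr (- s - 1)) = x powr (- Re s - 1)"
        using x n by (subst x) (simp add: norm_powr_real_powr)
      also have "\<dots> \<le> x powr (- 3/2)" using x n s by (intro powr_mono) auto
      also have "\<dots> \<le> real n powr (- 3/2)" using x n by (intro powr_mono2') auto
      finally show "norm ((- s) * w powr (- s - 1)) \<le> norm s * real n powr (- 3/2)"
        by (simp add: norm_mult mult_left_mono)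
    qed (use z Sn in auto)
    also have "norm (z - of_nat n) \<le> 1"
    proof -
      obtain x where "z = of_real x" "real n \<le> x" "x \<le> real n + 1" using z unfolding S_def by auto
      then have "z - of_nat n = of_real (x - real n)" "\<bar>x - real n\<bar> \<le> 1" by auto
      then show ?thesis by (metis norm_of_real)
    qed
    finally show ?thesis by (simp add: mult_left_mono)
  qed
  have "norm ((of_nat n + 1) powr (1 - s) - (1 - s) * of_nat n powr - s * (of_nat n + 1) -
      (of_nat n powr (1 - s) - (1 - s) * of_nat n powr - s * of_nat n))
      \<le> norm (1 - s) * norm s * real n powr (- 3/2) * norm (of_nat n + 1 - of_nat n :: complex)"
  proof (rule field_differentiable_bound[OF \<open>convex S\<close>])
    fix w assume w: "w \<in> S"
    then obtain x where x: "w = of_real x" "x \<ge> real n" unfolding S_def by auto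
    have "w \<notin> \<real>\<^sub>\<le>\<^sub>0" using x n by auto
    then show "((\<lambda>z. z powr (1 - s) - (1 - s) * of_nat n powr - s * z) has_field_derivative
        (1 - s) * (w powr - s - of_nat n powr - s)) (at w within S)"
      by (auto intro!: derivative_eq_intros simp: algebra_simps)
    show "norm ((1 - s) * (w powr - s - of_nat n powr - s)) \<le> norm (1 - s) * norm s * real n powr (- 3/2)"
      unfolding norm_mult mult.assoc by (intro mult_left_mono mv w) auto
  qed (use Sn in auto)
  also have "(of_nat n + 1) powr (1 - s) - (1 - s) * of_nat n powr - s * (of_nat n + 1) -
      (of_nat n powr (1 - s) - (1 - s) * of_nat n powr - s * of_nat n) = taylor_rem 1 n s"
    by (simp add: taylor_rem_def algebra_simps)
  finally show ?thesis by simp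
qed

text \<open>Serves as an upper bound for \<open>Re (ln zeta)\<close> in the Borel-Caratheodory
  argument. It comes from \<open>(s - 1) * zeta s = 1 + (\<Sum>n. taylor_rem 1 (Suc n) s)\<close>,
  where the series is of size \<open>norm (s - 1) * norm s\<close>.\<close>

lemma zeta_growth: "\<exists>C>0. \<forall>s. Re s \<ge> 1/2 \<longrightarrow> Im s \<ge> 1 \<longrightarrow> norm (zeta s) \<le> C * norm s"
proof -
  define K where "K = (\<Sum>n. real (Suc n) powr (- 3/2))"
  have "summable (\<lambda>n. real n powr (- 3/2))" by (subst summable_real_powr_iff) auto
  then have sK: "summable (\<lambda>n. real (Suc n) powr (- 3/2))" by (subst summable_Suc_iff)
  have K0: "K \<ge> 0" unfolding K_def by (intro suminf_nonneg sK) auto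
  define W where "W s = 1 + (\<Sum>n. taylor_rem 1 (Suc n) s)" for s
  have eq: "(s - 1) * zeta s = W s" if s: "Re s > 0" "s \<noteq> 1" for s
  proof (rule analytic_continuation_open[where f = "\<lambda>s. (s - 1) * zeta s" and g = W and
        s = "{s. Re s > 1}" and s' = "{s. Re s > 0} - {1}"])
    show "open ({s. Re s > 0} - {1 :: complex})"
      by (intro open_delete open_halfspace_Re_gt)
    show "connected ({s. Re s > 0} - {1 :: complex})"
      by (intro connected_open_delete convex_connected convex_halfspace_Re_gt open_halfspace_Re_gt) auto
    have "(2::complex) \<in> {s. Re s > 1}" by simp
    then show "{s. Re s > 1} \<noteq> {}" by blast
    show "(\<lambda>s. (s - 1) * zeta s) holomorphic_on {s. Re s > 0} - {1}"
      by (intro holomorphic_intros holomorphic_on_subset[OF zeta_holomorphic]) auto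
    show "W holomorphic_on {s. Re s > 0} - {1}"
      unfolding W_def using taylor_rem_suminf_holomorphic[of 1]
      by (intro holomorphic_intros) (auto elim: holomorphic_on_subset)
    show "(z - 1) * zeta z = W z" if "z \<in> {s. Re s > 1}" for z
      using sums_unique[OF zeta_series_taylor[of z 1], symmetric] that by (simp add: W_def zeta_eq_series)
  qed (use s in \<open>auto intro: open_halfspace_Re_gt\<close>)
  have "norm (zeta s) \<le> (K + 1) * norm s" if s: "Re s \<ge> 1/2" "Im s \<ge> 1" for s
  proof -
    have s1: "norm (s - 1) \<ge> 1" "norm s \<ge> 1"
      using abs_Im_le_cmod[of "s - 1"] abs_Im_le_cmod[of s] s by auto
    then have "s \<noteq> 1" by auto
    have "norm (\<Sum>n. taylor_rem 1 (Suc n) s) \<le> (\<Sum>n. norm (s - 1) * norm s * real (Suc n) powr (- 3/2))"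
    proof (rule norm_suminf_le)
      show "norm (taylor_rem 1 (Suc n) s) \<le> norm (s - 1) * norm s * real (Suc n) powr (- 3/2)" for n
        using taylor_rem_1_bound[OF s(1), of "Suc n"] by (simp add: norm_minus_commute)
    qed (intro summable_mult sK)
    also have "\<dots> = norm (s - 1) * norm s * K" unfolding K_def by (intro suminf_mult sK)
    finally have "norm (W s) \<le> 1 + norm (s - 1) * norm s * K"
      unfolding W_def by (intro order.trans[OF norm_triangle_ineq]) simp
    also have "\<dots> \<le> norm (s - 1) * norm s * 1 + norm (s - 1) * norm s * K"
      using mult_mono[OF s1] by simp
    finally have "norm (s - 1) * norm (zeta s) \<le> norm (s - 1) * ((K + 1) * norm s)"
      using eq[of s] s \<open>s \<noteq> 1\<close> by (simp add: norm_mult[symmetric] algebra_simps)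
    then show ?thesis using s1 by (subst (asm) mult_le_cancel_left_pos) auto
  qed
  then show ?thesis using K0 by (intro exI[of _ "K + 1"]) auto
qed

section \<open>The logarithm of zeta as a Dirichlet series\<close>

text \<open>Absolute convergence permits regrouping the pairs \<open>(d, m)\<close> by their
  product. The work is done on positive indices because every number divides 0.\<close>

lemma has_sum_dirichlet_convolution:
  fixes f g :: "nat \<Rightarrow> complex"
  assumes f: "summable (\<lambda>n. norm (f n))" and g: "summable (\<lambda>n. norm (g n))"
    and h: "\<And>n. n > 0 \<Longrightarrow> h n = (\<Sum>d | d dvd n. f d * g (n div d))"
    and [simp]: "f 0 = 0" "g 0 = 0" "h 0 = 0"
  shows "(h has_sum ((\<Sum>n. f n) * (\<Sum>n. g n))) UNIV"
proof -
  have "(f has_sum suminf f) UNIV" "(g has_sum suminf g) UNIV"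
    using f g by (auto intro!: norm_summable_imp_has_sum summable_sums dest: summable_norm_cancel)
  moreover have pos: "(k has_sum S) {0<..} \<longleftrightarrow> (k has_sum S) UNIV" if "k 0 = 0"
    for k :: "nat \<Rightarrow> complex" and S
    by (rule has_sum_cong_neutral) (use that in \<open>auto intro: Suc_leI intro!: gr0I\<close>)
  ultimately have fs: "(f has_sum suminf f) {0<..}" and gs: "(g has_sum suminf g) {0<..}"
    by simp_all
  have "(\<lambda>n. norm (f n)) summable_on UNIV" "(\<lambda>n. norm (g n)) summable_on UNIV"
    using f g by (auto intro!: norm_summable_imp_summable_on)
  then have fa: "(\<lambda>n. norm (f n)) summable_on {0<..}" and ga: "(\<lambda>n. norm (g n)) summable_on {0<..}"
    by (auto intro: summable_on_subset_banach)
  have "(\<lambda>x. norm (case x of (d, m) \<Rightarrow> f d * g m)) summable_on ({0<..} \<times> {0<..})"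
    unfolding Infinite_Sum.abs_summable_on_Sigma_iff
  proof (intro conjI ballI)
    fix d :: nat
    show "(\<lambda>m. norm (case (d, m) of (d, m) \<Rightarrow> f d * g m)) summable_on {0<..}"
      using ga by (auto simp: norm_mult intro!: summable_on_cmult_right)
  next
    have "(\<Sum>\<^sub>\<infinity>m\<in>{0<..}. norm (f d * g m)) = norm (f d) * (\<Sum>\<^sub>\<infinity>m\<in>{0<..}. norm (g m))" for d
      by (simp add: norm_mult infsum_cmult_right')
    then show "(\<lambda>d. norm (\<Sum>\<^sub>\<infinity>m\<in>{0<..}. norm (case (d, m) of (d, m) \<Rightarrow> f d * g m))) summable_on {0<..}"
      using fa by (auto simp: abs_mult infsum_nonneg intro!: summable_on_cmult_left)
  qed
  then have "(\<lambda>(d, m). f d * g m) summable_on ({0<..} \<times> {0<..})"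
    by (rule Infinite_Sum.abs_summable_summable)
  then have "((\<lambda>(d, m). f d * g m) has_sum (suminf f * suminf g)) ({0<..} \<times> {0<..})"
    by (intro has_sum_SigmaI[where g = "\<lambda>d. f d * suminf g"])
       (auto intro!: has_sum_cmult_right has_sum_cmult_left fs gs)
  also have "?this \<longleftrightarrow> ((\<lambda>(n, d). f d * g (n div d)) has_sum (suminf f * suminf g))
                (SIGMA n:{0<..}. {d. d dvd n})"
    by (rule has_sum_reindex_bij_witness[of _ "\<lambda>(n, d). (d, n div d)" "\<lambda>(d, m). (d * m, d)"])
       (auto elim!: dvdE)
  finally have "(h has_sum (suminf f * suminf g)) {0<..}"
    by (rule has_sum_SigmaD) (auto simp: h intro!: has_sum_finite)
  then show ?thesis by (simp add: pos)
qed

text \<open>These are the coefficients of the logarithm of zeta: \<open>1/k\<close> at the prime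
  power \<open>p ^ k\<close>. At \<open>n = 1\<close> the quotient is \<open>0 / 0 = 0\<close>, so
  the series has no constant term.\<close>

definition log_coeff :: "nat \<Rightarrow> real" where
  "log_coeff n = mangoldt n / ln (real n)"

lemma log_coeff_nonneg: "log_coeff n \<ge> 0"
  by (cases "n = 0") (auto simp: log_coeff_def mangoldt_nonneg)

lemma log_coeff_le_1: "log_coeff n \<le> 1"
proof (cases "n \<ge> 2")
  case True
  then show ?thesis using mangoldt_le[of n] by (simp add: log_coeff_def field_simps)
next
  case False
  then have "n = 0 \<or> n = 1" by auto
  then show ?thesis by (auto simp: log_coeff_def)
qed

lemma ln_times_log_coeff: "ln (real n) * log_coeff n = mangoldt n"
proof (cases "n \<ge> 2")
  case False
  then have "n = 0 \<or> n = 1" by auto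
  then show ?thesis by (auto simp: log_coeff_def)
qed (auto simp: log_coeff_def)

lemma log_coeff_prime: "prime p \<Longrightarrow> log_coeff p = 1"
  using prime_gt_1_nat[of p] by (simp add: log_coeff_def)

definition log_series :: "complex \<Rightarrow> complex" where
  "log_series s = (\<Sum>n. of_real (log_coeff n) * of_nat n powr - s)"

lemma norm_log_coeff_le_1: "norm (of_real (log_coeff n) :: complex) \<le> 1"
  using log_coeff_nonneg[of n] log_coeff_le_1[of n] by simp

lemma log_series_abs_summable:
  "Re s > 1 \<Longrightarrow> summable (\<lambda>n. norm (of_real (log_coeff n) * of_nat n powr - s :: complex))"
  by (rule dirichlet_series_deriv(1)[OF norm_log_coeff_le_1])

lemma log_series_DERIV: "Re s > 1 \<Longrightarrow> (log_series has_field_derivative deriv log_series s) (at s)"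
  unfolding log_series_def[abs_def] by (rule dirichlet_series_deriv(3)[OF norm_log_coeff_le_1])

lemma zeta_series_DERIV: "Re s > 1 \<Longrightarrow> (zeta_series has_field_derivative deriv zeta_series s) (at s)"
  using dirichlet_series_deriv(3)[of "\<lambda>_. 1" s] unfolding zeta_series_def[abs_def] by simp

lemma log_series_holomorphic: "log_series holomorphic_on {s. Re s > 1}"
  unfolding holomorphic_on_def field_differentiable_def
  using log_series_DERIV by (blast intro: has_field_derivative_at_within)

text \<open>The von Mangoldt function summed over the divisors of \<open>n\<close> is
  \<open>ln n\<close>; this is that identity, read as a product of Dirichlet series.\<close>

lemma deriv_zeta_series:
  assumes s: "Re s > 1"
  shows "deriv zeta_series s = zeta_series s * deriv log_series s"
proof -
  let ?f = "\<lambda>n. - (of_real (ln (real n)) * of_real (log_coeff n) * of_nat n powr - s) :: complex"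
  have f1: "?f n = - (mangoldt n * of_nat n powr - s)" for n
    by (simp only: of_real_mult[symmetric] ln_times_log_coeff of_real_mangoldt)
  have fs: "?f sums deriv log_series s"
    using dirichlet_series_deriv(2)[of "\<lambda>n. of_real (log_coeff n)", OF norm_log_coeff_le_1 s]
    unfolding log_series_def[abs_def] .
  \<comment> \<open>\<open>dirichlet_series_deriv\<close> yields absolute convergence of the series
    but not of its derivative. The latter is read off at the real point \<open>Re s\<close>, where
    all terms have the same sign.\<close>
  have fabs: "summable (\<lambda>n. norm (?f n))"
  proof -
    have "(\<lambda>n. - (of_real (ln (real n)) * of_real (log_coeff n) * of_nat n powr - of_real (Re s))) sums
       deriv log_series (of_real (Re s) :: complex)"
      using dirichlet_series_deriv(2)[of "\<lambda>n. of_real (log_coeff n)" "of_real (Re s)", OF norm_log_coeff_le_1] s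
      unfolding log_series_def[abs_def] by simp
    then have "summable (\<lambda>n. Re (- (of_real (ln (real n)) * of_real (log_coeff n) * of_nat n powr - of_real (Re s))))"
      by (intro summable_Re) (auto simp: sums_iff)
    also have "(\<lambda>n. Re (- (of_real (ln (real n)) * of_real (log_coeff n) * of_nat n powr - of_real (Re s)))) =
        (\<lambda>n. - (mangoldt n * real n powr - Re s))"
    proof
      fix n
      have "(of_nat n powr - of_real (Re s) :: complex) = of_real (real n powr - Re s)"
        using powr_of_real[of "real n" "- Re s"] by simp
      then have "of_real (ln (real n)) * of_real (log_coeff n) * (of_nat n powr - of_real (Re s) :: complex) =
          of_real (ln (real n) * log_coeff n * real n powr - Re s)"
        by (simp only: of_real_mult)
      then show "Re (- (of_real (ln (real n)) * of_real (log_coeff n) * of_nat n powr - of_real (Re s))) =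
          - (mangoldt n * real n powr - Re s)"
        by (simp only: ln_times_log_coeff uminus_complex.sel Re_complex_of_real)
    qed
    finally have "summable (\<lambda>n. mangoldt n * real n powr - Re s)"
      by (simp only: summable_minus_iff)
    then show ?thesis
      unfolding f1 by (simp add: norm_mult norm_of_nat_powr)
  qed
  have gabs: "summable (\<lambda>n. norm (of_nat n powr - s :: complex))"
    using dirichlet_series_deriv(1)[of "\<lambda>_. 1" s] s by simp
  let ?h = "\<lambda>n. - (of_real (ln (real n)) * of_nat n powr - s) :: complex"
  have "(?h has_sum (suminf ?f * zeta_series s)) UNIV"
    unfolding zeta_series_def
  proof (rule has_sum_dirichlet_convolution[OF fabs gabs])
    fix n :: nat assume n: "n > 0"
    have "(\<Sum>d | d dvd n. ?f d * of_nat (n div d) powr - s) =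
          (\<Sum>d | d dvd n. - (mangoldt d * of_nat n powr - s))"
    proof (rule sum.cong)
      fix d assume "d \<in> {d. d dvd n}"
      then obtain m where "n = d * m" "d > 0" "m > 0" using n by (auto elim!: dvdE)
      then show "?f d * of_nat (n div d) powr - s = - (mangoldt d * of_nat n powr - s)"
        unfolding f1 using powr_times_real[of "of_nat d" "of_nat m" "- s"] by simp
    qed auto
    also have "\<dots> = - ((\<Sum>d | d dvd n. mangoldt d) * of_nat n powr - s)"
      by (simp add: sum_negf sum_distrib_right)
    also have "\<dots> = ?h n" using n by (simp add: mangoldt_sum)
    finally show "?h n = (\<Sum>d | d dvd n. ?f d * of_nat (n div d) powr - s)" ..
  qed auto
  then have "?h sums (suminf ?f * zeta_series s)" by (rule has_sum_imp_sums)
  moreover have "?h sums deriv zeta_series s"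
    using dirichlet_series_deriv(2)[of "\<lambda>_. 1" s] s unfolding zeta_series_def[abs_def] by simp
  ultimately have "deriv zeta_series s = suminf ?f * zeta_series s" by (rule sums_unique2[rotated])
  also have "suminf ?f = deriv log_series s" by (rule sums_unique[OF fs, symmetric])
  finally show ?thesis by simp
qed

text \<open>Fixes the constant of integration in \<open>exp_log_series\<close>. For
  \<open>n \<ge> 2\<close> and \<open>x \<ge> 2\<close> the factor \<open>n powr (2 - x)\<close> is
  at most \<open>2 powr (2 - x)\<close>, which tends to 0 and leaves a convergent series.\<close>

lemma dirichlet_series_tendsto:
  fixes c :: "nat \<Rightarrow> complex"
  assumes c: "\<And>n. norm (c n) \<le> 1"
  shows "((\<lambda>x. \<Sum>n. c n * of_nat n powr - of_real x) \<longlongrightarrow> c 1) at_top"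
proof -
  define K where "K = (\<Sum>n. real n powr - 2)"
  have sK: "summable (\<lambda>n. real n powr - 2)" by (subst summable_real_powr_iff) auto
  have "norm ((\<Sum>n. c n * of_nat n powr - of_real x) - c 1) \<le> K * 2 powr (2 - x)" if x: "x \<ge> 2" for x :: real
  proof -
    let ?t = "\<lambda>n. c n * of_nat n powr - of_real x"
    have "summable ?t"
      using dirichlet_series_deriv(1)[of c "of_real x", OF c] x by (auto dest: summable_norm_cancel)
    then have "?t sums suminf ?t" by auto
    moreover have "(\<lambda>n. if n = 1 then c n else 0) sums (c 1)" by (rule sums_single)
    ultimately have d: "(\<lambda>n. ?t n - (if n = 1 then c n else 0)) sums (suminf ?t - c 1)"
      by (rule sums_diff)
    have "norm (\<Sum>n. ?t n - (if n = 1 then c n else 0)) \<le> (\<Sum>n. 2 powr (2 - x) * real n powr - 2)"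
    proof (rule norm_suminf_le)
      fix n :: nat
      show "norm (?t n - (if n = 1 then c n else 0)) \<le> 2 powr (2 - x) * real n powr - 2"
      proof (cases "n \<ge> 2")
        case True
        have "norm (?t n) \<le> 1 * real n powr - x"
          unfolding norm_mult norm_of_nat_powr by (intro mult_mono) (use c in auto)
        also have "real n powr - x = real n powr (2 - x) * real n powr - 2"
          by (simp flip: powr_add)
        also have "real n powr (2 - x) \<le> 2 powr (2 - x)"
          using True x by (intro powr_mono2') auto
        finally show ?thesis using True by (simp add: mult_right_mono)
      next
        case False
        then have "n = 0 \<or> n = 1" by auto
        then show ?thesis by auto
      qed
    qed (intro summable_mult sK)
    also have "\<dots> = 2 powr (2 - x) * K" unfolding K_def by (rule suminf_mult[OF sK])
    finally show ?thesis using d by (simp add: sums_iff mult.commute)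
  qed
  then have ev: "eventually (\<lambda>x. norm ((\<Sum>n. c n * of_nat n powr - of_real x) - c 1) \<le> K * 2 powr (2 - x)) at_top"
    by (intro eventually_at_top_linorderI[of 2])
  have "((\<lambda>x::real. K * 2 powr (2 - x)) \<longlongrightarrow> 0) at_top" by real_asymp
  then have "((\<lambda>x. (\<Sum>n. c n * of_nat n powr - of_real x) - c 1) \<longlongrightarrow> 0) at_top"
    by (rule Lim_null_comparison[OF ev])
  then show ?thesis by (rule Lim_null[THEN iffD2])
qed

text \<open>The product \<open>zeta_series s * exp (- log_series s)\<close> has derivative 0 and
  tends to 1 along the real axis.\<close>

lemma exp_log_series:
  assumes s: "Re s > 1"
  shows "exp (log_series s) = zeta_series s"
proof -
  let ?S = "{s. Re s > 1}"
  let ?g = "\<lambda>s. zeta_series s * exp (- log_series s)"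
  have "(?g has_field_derivative 0) (at z within ?S)" if "z \<in> ?S" for z
  proof -
    have "(?g has_field_derivative
        (deriv zeta_series z - zeta_series z * deriv log_series z) * exp (- log_series z)) (at z)"
      using that by (auto intro!: derivative_eq_intros zeta_series_DERIV log_series_DERIV simp: algebra_simps)
    then show ?thesis using deriv_zeta_series[of z] that by (simp add: has_field_derivative_at_within)
  qed
  then obtain c where c: "\<And>z. z \<in> ?S \<Longrightarrow> ?g z = c"
    using has_field_derivative_zero_constant[of ?S ?g] convex_halfspace_Re_gt[of 1] by metis
  have "((\<lambda>x. ?g (of_real x)) \<longlongrightarrow> 1 * exp (- of_real (log_coeff 1))) at_top"
    using dirichlet_series_tendsto[of "\<lambda>_. 1"] dirichlet_series_tendsto[of "\<lambda>n. of_real (log_coeff n)", OF norm_log_coeff_le_1]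
    unfolding zeta_series_def log_series_def by (intro tendsto_intros) auto
  moreover have "eventually (\<lambda>x. ?g (of_real x) = c) at_top"
    using c by (intro eventually_at_top_linorderI[of 2]) auto
  ultimately have "((\<lambda>x::real. c) \<longlongrightarrow> 1) at_top"
    by (simp add: log_coeff_def tendsto_cong)
  then have "c = 1" by (auto simp: tendsto_const_iff)
  then show ?thesis using c[of s] s by (simp add: exp_minus field_simps)
qed

lemma norm_log_series_le: "\<exists>C>0. \<forall>s. Re s \<ge> 3/2 \<longrightarrow> norm (log_series s) \<le> C"
proof -
  define K where "K = (\<Sum>n. real n powr (- 3/2))"
  have sK: "summable (\<lambda>n. real n powr (- 3/2))" by (subst summable_real_powr_iff) auto
  have "norm (log_series s) \<le> K + 1" if s: "Re s \<ge> 3/2" for s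
  proof -
    have "norm (log_series s) \<le> K"
      unfolding log_series_def K_def
    proof (rule norm_suminf_le[OF _ sK])
      fix n
      have "norm (of_real (log_coeff n) * of_nat n powr - s :: complex) \<le> 1 * real n powr - Re s"
        unfolding norm_mult norm_of_nat_powr using norm_log_coeff_le_1[of n] by (intro mult_mono) auto
      also have "\<dots> \<le> real n powr (- 3/2)" using s by (cases "n = 0") (auto intro!: powr_mono)
      finally show "norm (of_real (log_coeff n) * of_nat n powr - s :: complex) \<le> real n powr (- 3/2)" .
    qed
    then show ?thesis by simp
  qed
  moreover have "K \<ge> 0" unfolding K_def by (intro suminf_nonneg sK) auto
  ultimately show ?thesis by (intro exI[of _ "K + 1"]) auto
qed

section \<open>The logarithm of zeta under the Riemann hypothesis\<close>

text \<open>The values of \<open>d\<close> lie in the discrete set of multiples of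
  \<open>2 * pi * \<i>\<close>. Every later comparison of two branches of a logarithm or of an
  argument rests on this.\<close>

lemma exp_eq_1_imp_constant:
  fixes d :: "'a::topological_space \<Rightarrow> complex"
  assumes "connected S" "continuous_on S d" "\<And>x. x \<in> S \<Longrightarrow> exp (d x) = 1"
  obtains k where "\<And>x. x \<in> S \<Longrightarrow> d x = k"
proof -
  have "d constant_on S"
  proof (rule continuous_discrete_range_constant[OF assms(1,2)])
    fix x assume x: "x \<in> S"
    show "\<exists>e>0. \<forall>y. y \<in> S \<and> d y \<noteq> d x \<longrightarrow> e \<le> norm (d y - d x)"
    proof (intro exI[of _ "2 * pi"] conjI allI impI)
      fix y assume y: "y \<in> S \<and> d y \<noteq> d x"
      have "exp (d y - d x) = 1" using assms(3) x y by (simp add: exp_diff)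
      then obtain n :: int where n: "Re (d y - d x) = 0" "Im (d y - d x) = of_int (2 * n) * pi"
        unfolding exp_eq_1 by auto
      have "n \<noteq> 0" using n y by (auto simp: complex_eq_iff)
      then have "\<bar>real_of_int n\<bar> \<ge> 1" by linarith
      then have "2 * pi * 1 \<le> 2 * pi * \<bar>real_of_int n\<bar>" by (intro mult_left_mono) auto
      also have "\<dots> = \<bar>Im (d y - d x)\<bar>" unfolding n by (simp add: abs_mult)
      also have "\<dots> \<le> norm (d y - d x)" by (rule abs_Im_le_cmod)
      finally show "2 * pi \<le> norm (d y - d x)" by simp
    qed auto
  qed
  then show ?thesis using that unfolding constant_on_def by blast
qed

text \<open>The quotient \<open>f / (2 * A - f)\<close> maps into the unit disc because
  \<open>Re f < A\<close>, and it vanishes at 0, so the Schwarz lemma applies to it.\<close>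

lemma borel_caratheodory_unit_ball:
  assumes f: "f holomorphic_on ball 0 1" "f 0 = 0" and A: "A > 0"
    and Re: "\<And>z. norm z < 1 \<Longrightarrow> Re (f z) < A" and z: "norm z < 1"
  shows "norm (f z) \<le> 2 * A * norm z / (1 - norm z)"
proof -
  define w where "w z = f z / (2 * A - f z)" for z
  have nz: "2 * A - f z \<noteq> 0" if "norm z < 1" for z
  proof
    assume "2 * A - f z = 0"
    then have "Re (2 * of_real A - f z) = 0" by simp
    then show False using Re[OF that] A by simp
  qed
  have "norm (w z) \<le> norm z"
  proof (rule Schwarz_Lemma(1)[OF _ _ _ z])
    show "w holomorphic_on ball 0 1" unfolding w_def
      using nz by (intro holomorphic_intros f) auto
    show "w 0 = 0" by (simp add: w_def f)
    fix x :: complex assume x: "norm x < 1"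
    have "(Re (f x))\<^sup>2 < (2 * A - Re (f x))\<^sup>2"
    proof -
      have "(2 * A - Re (f x))\<^sup>2 - (Re (f x))\<^sup>2 = 4 * A * (A - Re (f x))"
        by (simp add: power2_eq_square algebra_simps)
      also have "\<dots> > 0" using Re[OF x] A by simp
      finally show ?thesis by simp
    qed
    then have "norm (f x) < norm (2 * A - f x)"
      by (simp add: cmod_def)
    then show "norm (w x) < 1" using nz[OF x] by (simp add: w_def norm_divide)
  qed
  moreover have "f z = 2 * A * w z / (1 + w z)" and "1 + w z \<noteq> 0"
  proof -
    have "1 + w z = 2 * A / (2 * A - f z)" using nz[OF z] by (simp add: w_def field_simps)
    then show "1 + w z \<noteq> 0" using nz[OF z] A by simp
    then show "f z = 2 * A * w z / (1 + w z)"
      using nz[OF z] A by (simp add: w_def field_simps)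
  qed
  moreover have "norm (1 + w z) \<ge> 1 - norm (w z)"
    using norm_triangle_ineq2[of 1 "- w z"] by simp
  ultimately have "norm (f z) \<le> 2 * A * norm z / (1 - norm z)"
    using A z by (auto simp: norm_divide norm_mult intro!: frac_le mult_mono)
  then show ?thesis .
qed

text \<open>The half plane contains the start 2 of the path that defines \<open>S\<close>, where the
  branch is normalised. The quarter plane reaches up to the critical line and avoids the real
  segment from \<open>1/2\<close> to the pole.\<close>

definition log_domain :: "complex set" where
  "log_domain = {s. Re s > 1/2 \<and> Im s > 0} \<union> {s. Re s > 1}"

lemma convex_quarter: "convex {s. Re s > 1/2 \<and> Im s > 0}"
  unfolding Collect_conj_eq by (intro convex_Int convex_halfspace_Re_gt convex_halfspace_Im_gt)

lemma open_quarter: "open {s. Re s > 1/2 \<and> Im s > 0}"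
  unfolding Collect_conj_eq by (intro open_Int open_halfspace_Re_gt open_halfspace_Im_gt)

lemma zeta_nonzero:
  assumes RH: riemann_hypothesis and s: "Re s > 1/2" "s \<noteq> 1"
  shows "zeta s \<noteq> 0"
proof
  assume "zeta s = 0"
  have "\<nexists>n::nat. s = - 2 * of_nat (Suc n)"
  proof
    assume "\<exists>n::nat. s = - 2 * of_nat (Suc n)"
    then obtain n :: nat where "s = - 2 * of_nat (Suc n)" by blast
    then have "Re s = - 2 * real (Suc n)" by simp
    then show False using s by simp
  qed
  then have "nontrivial_zeta_zero s"
    using \<open>zeta s = 0\<close> s by (simp add: nontrivial_zeta_zero_def)
  then show False using RH s unfolding riemann_hypothesis_def by auto
qed

lemma convex_holomorphic_log:
  assumes A: "convex A" "open A" "z \<in> A" and f: "f holomorphic_on A" "\<forall>x\<in>A. f x \<noteq> 0"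
  shows "\<exists>g. g holomorphic_on A \<and> (\<forall>x\<in>A. exp (g x) = f x)"
proof (rule holomorphic_logarithm_exists[OF A(1,2) f(1) _ A(3)])
  show "f x \<noteq> 0" if "x \<in> A" for x using f(2) that by blast
qed blast

text \<open>The branch is pinned down by \<open>log_series\<close>, which is real on the real axis
  beyond 1; hence \<open>Im L\<close> is the argument that occurs in the definition of
  \<open>S\<close>.\<close>

locale zeta_log =
  fixes L :: "complex \<Rightarrow> complex"
  assumes RH: riemann_hypothesis
    and L_holomorphic: "L holomorphic_on log_domain"
    and exp_L: "s \<in> log_domain \<Longrightarrow> exp (L s) = zeta s"
    and L_eq_series: "Re s > 1 \<Longrightarrow> L s = log_series s"

text \<open>On the convex quarter plane some branch \<open>g\<close> exists. On the overlap with
  \<open>Re s > 1\<close> it differs from \<open>log_series\<close> by a constant \<open>k\<close>,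
  so \<open>g + k\<close> and the series glue.\<close>

lemma zeta_log_exists:
  assumes RH: riemann_hypothesis
  obtains L where "zeta_log L"
proof -
  let ?Q = "{s. Re s > 1/2 \<and> Im s > 0}"
  have iQ: "(1 + \<i>) \<in> ?Q" by simp
  have hQ: "zeta holomorphic_on ?Q"
    by (rule holomorphic_on_subset[OF zeta_holomorphic]) auto
  have nQ: "zeta z \<noteq> 0" if "z \<in> ?Q" for z
    using zeta_nonzero[OF RH, of z] that by (auto simp: complex_eq_iff)
  have nQ': "\<forall>z\<in>?Q. zeta z \<noteq> 0" using nQ by blast
  from convex_holomorphic_log[OF convex_quarter open_quarter iQ hQ nQ']
  obtain g where g1: "g holomorphic_on ?Q" and g2: "\<forall>z\<in>?Q. exp (g z) = zeta z"
    by (elim exE conjE) (rule that)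
  note g = g1 g2[THEN bspec]
  have P: "exp (log_series z) = zeta z" if "Re z > 1" for z
    using that by (simp add: exp_log_series zeta_eq_series)
  obtain k where k: "\<And>x. x \<in> ?Q \<inter> {s. Re s > 1} \<Longrightarrow> log_series x - g x = k"
  proof (rule exp_eq_1_imp_constant[of "?Q \<inter> {s. Re s > 1}" "\<lambda>x. log_series x - g x"])
    show "connected (?Q \<inter> {s. Re s > 1})"
      by (intro convex_connected convex_Int convex_quarter convex_halfspace_Re_gt)
    show "continuous_on (?Q \<inter> {s. Re s > 1}) (\<lambda>x. log_series x - g x)"
      by (intro continuous_on_diff
            continuous_on_subset[OF holomorphic_on_imp_continuous_on[OF g(1)]]
            continuous_on_subset[OF holomorphic_on_imp_continuous_on[OF log_series_holomorphic]]) auto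
    show "exp (log_series x - g x) = 1" if "x \<in> ?Q \<inter> {s. Re s > 1}" for x
      using that P[of x] g(2)[of x] nQ[of x] by (simp add: exp_diff)
  qed (rule that)
  define L where "L s = (if Re s > 1 then log_series s else g s + k)" for s
  \<comment> \<open>A sample point of the overlap shows \<open>exp k = 1\<close>, so the shifted
    branch is still a logarithm of zeta.\<close>
  have "(2 + \<i>) \<in> ?Q \<inter> {s. Re s > 1}" by simp
  from k[OF this] have "exp k = exp (log_series (2 + \<i>)) / exp (g (2 + \<i>))"
    by (metis exp_diff)
  also have "\<dots> = 1"
    using P[of "2 + \<i>"] g(2)[of "2 + \<i>"] nQ[of "2 + \<i>"] by simp
  finally have ek: "exp k = 1" .
  have L2: "L s = g s + k" if "s \<in> ?Q" for s
    using k[of s] that by (auto simp: L_def)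
  have "zeta_log L"
  proof
    show riemann_hypothesis by (rule RH)
    have "L holomorphic_on ?Q"
      by (rule holomorphic_transform[OF holomorphic_on_add[OF g1 holomorphic_on_const[of k]]]) (simp only: L2)
    moreover have "L holomorphic_on {s. Re s > 1}"
      by (rule holomorphic_transform[OF log_series_holomorphic]) (auto simp: L_def)
    ultimately show "L holomorphic_on log_domain"
      unfolding log_domain_def by (intro holomorphic_on_Un open_quarter open_halfspace_Re_gt)
    show "exp (L s) = zeta s" if "s \<in> log_domain" for s
    proof (cases "Re s > 1")
      case False
      then show ?thesis using that g(2)[of s] ek by (auto simp: L_def log_domain_def exp_add)
    qed (auto simp: L_def P)
    show "L s = log_series s" if "Re s > 1" for s using that by (simp add: L_def)
  qed
  then show ?thesis using that by blast
qed

text \<open>Borel-Caratheodory on the disc about \<open>2 + \<i> * Im s\<close> of radius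
  \<open>3/2\<close>, which touches the critical line: the denominator \<open>1 - norm z\<close>
  becomes a multiple of \<open>Re s - 1/2\<close>. From \<open>Im s \<ge> 4\<close> on, the disc
  stays above height 1, as \<open>zeta_growth\<close> requires.\<close>

lemma (in zeta_log) L_bound: "\<exists>C>0. \<forall>s. Re s > 1/2 \<longrightarrow> Re s \<le> 2 \<longrightarrow> Im s \<ge> 4 \<longrightarrow> norm (L s) \<le> C * ln (Im s) / (Re s - 1/2)"
proof -
  obtain C1 where C1: "C1 > 0" "\<And>s. Re s \<ge> 1/2 \<Longrightarrow> Im s \<ge> 1 \<Longrightarrow> norm (zeta s) \<le> C1 * norm s"
    using zeta_growth by blast
  obtain C2 where C2: "C2 > 0" "\<And>s. Re s \<ge> 3/2 \<Longrightarrow> norm (log_series s) \<le> C2"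
    using norm_log_series_le by blast
  define C where "C = 3 * (\<bar>ln C1\<bar> + C2 + 3) + 2 * C2"
  have "C > 0" using C2 by (auto simp: C_def)
  have "norm (L s) \<le> C * ln (Im s) / (Re s - 1/2)" if s: "Re s > 1/2" "Re s \<le> 2" "Im s \<ge> 4" for s
  proof -
    define t where "t = Im s"
    have lt: "ln t \<ge> 1"
    proof -
      have "exp 1 \<le> (4::real)" using exp_le by linarith
      then have "exp 1 \<le> t" using s by (simp add: t_def)
      then show ?thesis by (subst ln_ge_iff) (use s in \<open>auto simp: t_def\<close>)
    qed
    define z0 where "z0 = Complex 2 t"
    define f where "f z = L (z0 + (3/2) * z) - L z0" for z
    define A where "A = \<bar>ln C1\<bar> + 2 * ln t + C2 + 1"
    have z0: "L z0 = log_series z0" "norm (L z0) \<le> C2"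
      using C2(2)[of z0] L_eq_series[of z0] by (auto simp: z0_def)
    have dom: "Re (z0 + (3/2) * z) > 1/2 \<and> Im (z0 + (3/2) * z) > 1 \<and> norm (z0 + (3/2) * z) \<le> t + 4"
      if z: "norm z < 1" for z
    proof (intro conjI)
      have "\<bar>Re z\<bar> < 1" "\<bar>Im z\<bar> < 1" using z abs_Re_le_cmod[of z] abs_Im_le_cmod[of z] by linarith+
      then show "Re (z0 + (3/2) * z) > 1/2" "Im (z0 + (3/2) * z) > 1"
        using s by (auto simp: z0_def t_def)
      have "norm z0 \<le> 2 + t" using cmod_le[of z0] s by (simp add: z0_def t_def)
      moreover have "norm ((3/2) * z) \<le> 3/2" using z by (simp add: norm_mult)
      ultimately show "norm (z0 + (3/2) * z) \<le> t + 4"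
        using norm_triangle_ineq[of z0 "(3/2) * z"] by linarith
    qed
    have "norm (f z) \<le> 2 * A * norm z / (1 - norm z)" if z: "norm z < 1" for z
    proof (rule borel_caratheodory_unit_ball[OF _ _ _ _ z])
      have "(\<lambda>z. L (z0 + (3/2) * z)) holomorphic_on ball 0 1"
        by (rule holomorphic_on_compose_gen[OF _ L_holomorphic, unfolded o_def])
           (auto intro!: holomorphic_intros simp: log_domain_def dest!: dom)
      then show "f holomorphic_on ball 0 1" unfolding f_def by (intro holomorphic_intros)
      show "f 0 = 0" by (simp add: f_def)
      show "A > 0" using lt C2 by (auto simp: A_def)
      fix z :: complex assume z: "norm z < 1"
      let ?w = "z0 + (3/2) * z"
      have w: "?w \<in> log_domain" using dom[OF z] by (auto simp: log_domain_def)
      have "exp (Re (L ?w)) = norm (zeta ?w)" using exp_L[OF w] by (metis norm_exp_eq_Re)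
      also have "\<dots> \<le> C1 * norm ?w" using dom[OF z] by (intro C1) auto
      also have "\<dots> \<le> C1 * (t + 4)" using dom[OF z] C1 by (intro mult_left_mono) auto
      finally have "ln (exp (Re (L ?w))) \<le> ln (C1 * (t + 4))" by (subst ln_le_cancel_iff) (use C1 s in \<open>auto simp: t_def\<close>)
      then have "Re (L ?w) \<le> ln C1 + ln (t + 4)" using C1 s by (simp add: ln_mult t_def)
      also have "ln (t + 4) \<le> ln (t\<^sup>2)"
      proof (subst ln_le_cancel_iff)
        have "t + 4 \<le> 4 * t" using s by (simp add: t_def)
        also have "4 * t \<le> t * t" using s by (intro mult_right_mono) (auto simp: t_def)
        finally show "t + 4 \<le> t\<^sup>2" by (simp add: power2_eq_square)
      qed (use s in \<open>auto simp: t_def\<close>)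
      also have "ln (t\<^sup>2) = 2 * ln t" using s by (simp add: ln_realpow t_def)
      finally have "Re (L ?w) \<le> \<bar>ln C1\<bar> + 2 * ln t" by linarith
      moreover have "Re (L z0) \<ge> - C2" using z0 abs_Re_le_cmod[of "L z0"] by linarith
      ultimately show "Re (f z) < A" by (simp add: f_def A_def)
    qed
    moreover define z where "z = (s - z0) / (3/2)"
    have zr: "z = of_real ((Re s - 2) / (3/2))" by (simp add: z_def z0_def t_def complex_eq_iff)
    have nz: "norm z = (2 - Re s) / (3/2)" unfolding zr norm_of_real using s by (simp add: abs_if field_simps)
    moreover have "norm z < 1" using s unfolding nz by (simp add: field_simps)
    ultimately have "norm (f z) \<le> 2 * A * norm z / (1 - norm z)" by blast
    also have "\<dots> \<le> 2 * A * 1 / (1 - norm z)"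
      using \<open>norm z < 1\<close> lt C2 by (intro divide_right_mono mult_left_mono) (auto simp: A_def)
    also have "1 - norm z = (Re s - 1/2) / (3/2)" unfolding nz by (simp add: field_simps)
    also have "2 * A * 1 / ((Re s - 1/2) / (3/2)) = 3 * A / (Re s - 1/2)"
      using s by (simp add: divide_simps)
    finally have 1: "norm (f z) \<le> 3 * A / (Re s - 1/2)" .
    have "z0 + (3/2) * z = s" by (simp add: z_def field_simps)
    then have "L s = f z + L z0" by (simp add: f_def)
    then have "norm (L s) \<le> 3 * A / (Re s - 1/2) + C2"
      using 1 z0 norm_triangle_ineq[of "f z" "L z0"] by simp
    also have "C2 \<le> 2 * C2 / (Re s - 1/2)" using s C2 by (simp add: field_simps)
    also have "3 * A / (Re s - 1/2) + 2 * C2 / (Re s - 1/2) = (3 * A + 2 * C2) / (Re s - 1/2)"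
      by (simp add: add_divide_distrib)
    also have "\<dots> \<le> C * ln t / (Re s - 1/2)"
    proof (rule divide_right_mono)
      have "\<bar>ln C1\<bar> * 1 \<le> \<bar>ln C1\<bar> * ln t" "C2 * 1 \<le> C2 * ln t"
        using lt C2 by (intro mult_left_mono; simp)+
      then show "3 * A + 2 * C2 \<le> C * ln t" using lt by (simp add: A_def C_def algebra_simps)
    qed (use s in auto)
    finally show ?thesis by (simp add: t_def)
  qed
  then show ?thesis using \<open>C > 0\<close> by blast
qed

section \<open>The argument of zeta on the critical line\<close>

lemma exp_eq_rcis: "exp z = rcis (norm (exp z)) (Im z)"
  unfolding rcis_def norm_exp_eq_Re by (rule exp_eq_polar)

text \<open>Two continuous arguments along the path differ by a constant, which is 0 at the start.
  Hence any one of them computes the definite description.\<close>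

lemma arg_along_eqI:
  assumes nz: "\<And>x. x \<in> {0..1} \<Longrightarrow> f (p x) \<noteq> 0"
    and \<phi>: "continuous_on {0..1} \<phi>" "\<phi> 0 = a" "\<phi> 1 = \<theta>"
    and f\<phi>: "\<And>x. x \<in> {0..1} \<Longrightarrow> f (p x) = rcis (norm (f (p x))) (\<phi> x)"
  shows "arg_along f p a = \<theta>"
  unfolding arg_along_def
proof (rule the_equality)
  show "\<exists>\<phi>. continuous_on {0..1} \<phi> \<and> \<phi> 0 = a \<and> (\<forall>x\<in>{0..1}. f (p x) = rcis (norm (f (p x))) (\<phi> x)) \<and> \<phi> 1 = \<theta>"
    using \<phi> f\<phi> by blast
next
  fix \<theta>' assume "\<exists>\<phi>. continuous_on {0..1} \<phi> \<and> \<phi> 0 = a \<and> (\<forall>x\<in>{0..1}. f (p x) = rcis (norm (f (p x))) (\<phi> x)) \<and> \<phi> 1 = \<theta>'"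
  then obtain \<psi> where \<psi>: "continuous_on {0..1} \<psi>" "\<psi> 0 = a" "\<psi> 1 = \<theta>'"
    "\<And>x. x \<in> {0..1} \<Longrightarrow> f (p x) = rcis (norm (f (p x))) (\<psi> x)" by blast
  obtain k where k: "\<And>x. x \<in> {0..1::real} \<Longrightarrow> \<i> * of_real (\<phi> x) - \<i> * of_real (\<psi> x) = k"
  proof (rule exp_eq_1_imp_constant[of "{0..1::real}" "\<lambda>x. \<i> * of_real (\<phi> x) - \<i> * of_real (\<psi> x)"])
    show "continuous_on {0..1} (\<lambda>x. \<i> * complex_of_real (\<phi> x) - \<i> * complex_of_real (\<psi> x))"
      by (intro continuous_intros \<phi> \<psi>)
    fix x :: real assume x: "x \<in> {0..1}"
    have "rcis (norm (f (p x))) (\<phi> x) = rcis (norm (f (p x))) (\<psi> x)"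
      using f\<phi>[OF x] \<psi>(4)[OF x] by simp
    then have "cis (\<phi> x) = cis (\<psi> x)" using nz[OF x] by (simp add: rcis_def)
    then show "exp (\<i> * complex_of_real (\<phi> x) - \<i> * complex_of_real (\<psi> x)) = 1"
      by (simp add: exp_diff cis_conv_exp)
  qed auto
  from k[of 0] k[of 1] show "\<theta>' = \<theta>" using \<phi> \<psi> by (auto simp: complex_eq_iff)
qed

lemma Im_log_series_of_real: "x > 1 \<Longrightarrow> Im (log_series (of_real x)) = 0"
proof -
  assume x: "x > 1"
  have "(\<lambda>n. of_real (log_coeff n) * of_nat n powr - of_real x) sums log_series (of_real x)"
    unfolding log_series_def using log_series_abs_summable[of "of_real x"] x
    by (intro summable_sums) (auto dest: summable_norm_cancel)
  then have "(\<lambda>n. Im (of_real (log_coeff n) * of_nat n powr - of_real x)) sums Im (log_series (of_real x))"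
    by (rule sums_Im)
  moreover have "Im (of_real (log_coeff n) * of_nat n powr - of_real x) = 0" for n
    using powr_of_real[of "real n" "- x"] by simp
  ultimately have "(\<lambda>n::nat. 0) sums Im (log_series (of_real x))" by (simp only:)
  then show ?thesis by (simp add: sums_iff)
qed

context zeta_log
begin

lemma ordinate_iff: "t > 0 \<Longrightarrow> zeta_zero_ordinate t \<longleftrightarrow> zeta (Complex (1/2) t) = 0"
proof
  assume "zeta_zero_ordinate t"
  then obtain \<rho> where "nontrivial_zeta_zero \<rho>" "Im \<rho> = t" unfolding zeta_zero_ordinate_def by blast
  moreover from this have "Re \<rho> = 1/2" using RH unfolding riemann_hypothesis_def by blast
  ultimately show "zeta (Complex (1/2) t) = 0"
    by (metis complex.exhaust_sel nontrivial_zeta_zero_def)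
next
  assume "t > 0" "zeta (Complex (1/2) t) = 0"
  then show "zeta_zero_ordinate t" unfolding zeta_zero_ordinate_def nontrivial_zeta_zero_def
    by (intro exI[of _ "Complex (1/2) t"]) (auto simp: complex_eq_iff)
qed

text \<open>\<open>Im L\<close> is the continuous argument along the path. Only the end point lies
  outside \<open>log_domain\<close>, and there the limit \<open>l\<close> stands in.\<close>

lemma zeta_S_eq:
  assumes t: "t > 0" and nz: "zeta (Complex (1/2) t) \<noteq> 0"
    and lim: "((\<lambda>\<sigma>. L (Complex \<sigma> t)) \<longlongrightarrow> l) (at_right (1/2))"
  shows "zeta_S t = Im l / pi"
proof -
  define p where "p = linepath 2 (Complex 2 t) +++ linepath (Complex 2 t) (Complex (1/2) t)"
  define \<Psi> where "\<Psi> x = (if x < 1 then L (p x) else l)" for x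
  have pl: "p x = Complex 2 (2 * x * t)" if "x \<le> 1/2" for x
    using that by (simp add: p_def joinpaths_def linepath_def complex_eq_iff field_simps)
  have pr: "p x = Complex (2 - (2 * x - 1) * (3/2)) t" if "x > 1/2" for x
    using that by (simp add: p_def joinpaths_def linepath_def complex_eq_iff field_simps)
  have dom: "p x \<in> log_domain" if "x \<in> {0..<1}" for x
    using that t by (cases "x \<le> 1/2") (auto simp: pl pr log_domain_def algebra_simps)
  have p1: "p 1 = Complex (1/2) t" by (simp add: pr)
  have z: "((\<lambda>\<sigma>. zeta (Complex \<sigma> t)) \<longlongrightarrow> zeta (Complex (1/2) t)) (at_right (1/2))"
  proof -
    have "isCont zeta (Complex (1/2) t)"
      using holomorphic_on_imp_continuous_on[OF zeta_holomorphic] t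
      by (subst (asm) continuous_on_eq_continuous_at) (auto simp: open_Compl complex_eq_iff)
    moreover have "((\<lambda>\<sigma>. Complex \<sigma> t) \<longlongrightarrow> Complex (1/2) t) (at_right (1/2))"
      by (intro tendsto_intros)
    ultimately show ?thesis by (rule isCont_tendsto_compose)
  qed
  have el: "exp l = zeta (Complex (1/2) t)"
  proof (rule tendsto_unique[OF _ _ z])
    have "((\<lambda>\<sigma>. exp (L (Complex \<sigma> t))) \<longlongrightarrow> exp l) (at_right (1/2))"
      by (intro tendsto_intros lim)
    moreover have "\<forall>\<^sub>F \<sigma> in at_right (1/2). exp (L (Complex \<sigma> t)) = zeta (Complex \<sigma> t)"
      using t by (intro eventually_at_right_less[THEN eventually_mono] exp_L) (auto simp: log_domain_def)
    ultimately show "((\<lambda>\<sigma>. zeta (Complex \<sigma> t)) \<longlongrightarrow> exp l) (at_right (1/2))"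
      by (rule Lim_transform_eventually)
  qed auto
  have e\<Psi>: "exp (\<Psi> x) = zeta (p x)" if "x \<in> {0..1}" for x
    using that el exp_L[OF dom[of x]] by (cases "x = 1") (auto simp: \<Psi>_def p1)
  have cont: "continuous_on {0..1} \<Psi>"
    unfolding continuous_on_eq_continuous_within
  proof
    fix x :: real assume x: "x \<in> {0..1}"
    show "continuous (at x within {0..1}) \<Psi>"
    proof (cases "x = 1")
      case False
      have "path p" unfolding p_def by (intro path_join_imp) auto
      then have pc: "continuous_on {0..1} p" by (simp add: path_def)
      have "continuous_on {0..<1} (\<lambda>x. L (p x))"
        by (rule continuous_on_compose2[OF holomorphic_on_imp_continuous_on[OF L_holomorphic]])
           (use dom in \<open>auto intro: continuous_on_subset[OF pc]\<close>)
      moreover have "continuous_on {0..<1} \<Psi> \<longleftrightarrow> continuous_on {0..<1} (\<lambda>x. L (p x))"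
        by (rule continuous_on_cong) (simp_all add: \<Psi>_def)
      ultimately have "continuous_on {0..<1} \<Psi>" by blast
      then have "continuous (at x within {0..<1}) \<Psi>" using x False
        by (auto simp: continuous_on_eq_continuous_within)
      moreover have "at x within {0..<1} = at x within {0..1}"
        by (rule at_within_nhd[of _ "{..<1}"]) (use x False in auto)
      ultimately show ?thesis by (simp add: continuous_within)
    next
      case True
      have "((\<lambda>x. L (p x)) \<longlongrightarrow> l) (at_left 1)"
      proof -
        have "filterlim (\<lambda>x::real. 2 - (2 * x - 1) * (3/2)) (at_right (1/2)) (at_left 1)"
          unfolding filterlim_at
        proof
          show "\<forall>\<^sub>F x in at_left 1. 2 - (2 * x - 1) * (3/2) \<in> {1/2<..} \<and> 2 - (2 * x - 1) * (3/2) \<noteq> (1/2::real)"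
            by (rule eventually_mono[OF eventually_at_left_real[of "1/2" 1]]) (auto simp: field_simps)
          have "((\<lambda>x::real. 2 - (2 * x - 1) * (3/2)) \<longlongrightarrow> 2 - (2 * 1 - 1) * (3/2)) (at_left 1)"
            by (intro tendsto_intros)
          then show "((\<lambda>x::real. 2 - (2 * x - 1) * (3/2)) \<longlongrightarrow> 1/2) (at_left 1)" by simp
        qed
        from filterlim_compose[OF lim this]
        have "((\<lambda>x. L (Complex (2 - (2 * x - 1) * (3/2)) t)) \<longlongrightarrow> l) (at_left 1)" .
        moreover have "\<forall>\<^sub>F x in at_left 1. L (Complex (2 - (2 * x - 1) * (3/2)) t) = L (p x)"
          by (rule eventually_mono[OF eventually_at_left_real[of "1/2" 1]]) (auto simp: pr)
        ultimately show ?thesis by (rule Lim_transform_eventually)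
      qed
      moreover have "\<forall>\<^sub>F x in at_left 1. L (p x) = \<Psi> x"
        by (auto simp: eventually_at_filter \<Psi>_def)
      ultimately have "(\<Psi> \<longlongrightarrow> l) (at_left 1)" by (rule Lim_transform_eventually)
      moreover have "at (1::real) within {0..1} = at_left 1"
        by (rule at_within_nhd[of _ "{0<..}"]) auto
      ultimately show ?thesis using True by (simp add: continuous_within \<Psi>_def)
    qed
  qed
  have "arg_along zeta p 0 = Im l"
  proof (rule arg_along_eqI[where \<phi> = "\<lambda>x. Im (\<Psi> x)"])
    show "zeta (p x) \<noteq> 0" if "x \<in> {0..1}" for x using e\<Psi>[OF that] by (metis exp_not_eq_zero)
    show "continuous_on {0..1} (\<lambda>x. Im (\<Psi> x))" by (intro continuous_intros cont)
    show "Im (\<Psi> 0) = 0"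
    proof -
      have "p 0 = of_real 2" by (simp add: pl complex_eq_iff)
      then show ?thesis using Im_log_series_of_real[of 2] L_eq_series[of "of_real 2"] by (simp add: \<Psi>_def)
    qed
    show "Im (\<Psi> 1) = Im l" by (simp add: \<Psi>_def)
    show "zeta (p x) = rcis (norm (zeta (p x))) (Im (\<Psi> x))" if "x \<in> {0..1}" for x
      using exp_eq_rcis[of "\<Psi> x"] e\<Psi>[OF that] by simp
  qed
  then show ?thesis
    using ordinate_iff[OF t] nz by (simp add: zeta_S_def zeta_S_regular_def p_def)
qed

text \<open>Factoring out \<open>(s - \<rho>) ^ m\<close>, with \<open>m = 0\<close> if zeta does
  not vanish at \<open>\<rho>\<close>, treats zeros and other points alike; to the right of the line
  the principal \<open>Ln (s - \<rho>)\<close> is continuous. The bound \<open>r \<le> t0\<close>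
  keeps the disc off the real axis and thus off the pole.\<close>

lemma L_near_critical_line:
  assumes t0: "t0 > 0"
  defines "\<rho> \<equiv> Complex (1/2) t0"
  shows "\<exists>(m::nat) r g. 0 < r \<and> r \<le> t0 \<and> g holomorphic_on ball \<rho> r \<and>
    (\<forall>s\<in>ball \<rho> r. Re s > 1/2 \<longrightarrow> L s = of_nat m * Ln (s - \<rho>) + g s) \<and>
    (\<forall>s\<in>ball \<rho> r. s \<noteq> \<rho> \<longrightarrow> zeta s \<noteq> 0)"
proof -
  let ?B = "ball \<rho> t0"
  have B1: "?B \<subseteq> - {1}"
  proof
    fix s assume "s \<in> ?B"
    then have "\<bar>Im (\<rho> - s)\<bar> < t0" using abs_Im_le_cmod[of "\<rho> - s"] by (simp add: dist_norm)
    then have "Im s \<noteq> 0" by (auto simp: \<rho>_def)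
    then show "s \<in> - {1}" by auto
  qed
  have hB: "zeta holomorphic_on ?B" by (rule holomorphic_on_subset[OF zeta_holomorphic B1])
  have "\<exists>m r h. 0 < r \<and> r \<le> t0 \<and> h holomorphic_on ball \<rho> r \<and>
      (\<forall>s\<in>ball \<rho> r. zeta s = (s - \<rho>) ^ m * h s \<and> h s \<noteq> 0)"
  proof (cases "zeta \<rho> = 0")
    case True
    \<comment> \<open>The disc contains points to the right of the critical line, where the Riemann
      hypothesis excludes zeros.\<close>
    have "\<not> zeta constant_on ?B"
    proof
      assume "zeta constant_on ?B"
      then have 0: "zeta s = 0" if "s \<in> ?B" for s
        using True t0 that unfolding constant_on_def by (metis centre_in_ball)
      define s where "s = \<rho> + of_real (t0 / 2)"
      have "s \<in> ?B" using t0 by (simp add: s_def dist_norm)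
      moreover have "Re s > 1/2" "s \<noteq> 1" using t0 by (auto simp: s_def \<rho>_def complex_eq_iff)
      ultimately show False using 0 zeta_nonzero[OF RH] by blast
    qed
    from holomorphic_factor_zero_nonconstant[OF hB open_ball connected_ball _ True this]
    obtain h r n where h: "0 < r" "ball \<rho> r \<subseteq> ?B" "h holomorphic_on ball \<rho> r"
      "\<And>w. w \<in> ball \<rho> r \<Longrightarrow> zeta w = (w - \<rho>) ^ n * h w" "\<And>w. w \<in> ball \<rho> r \<Longrightarrow> h w \<noteq> 0"
      using t0 by (metis centre_in_ball)
    moreover have "r \<le> t0" using h(1,2) by (simp add: ball_subset_ball_iff)
    ultimately show ?thesis by blast
  next
    case False
    have "continuous_on ?B zeta" using hB by (rule holomorphic_on_imp_continuous_on)
    then have "isCont zeta \<rho>" using t0 by (auto simp: continuous_on_eq_continuous_at)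
    then obtain e where e: "e > 0" "\<And>s. dist \<rho> s < e \<Longrightarrow> zeta s \<noteq> 0"
      using continuous_at_avoid[of \<rho> zeta 0] False by blast
    have "zeta holomorphic_on ball \<rho> (min e t0)"
      by (rule holomorphic_on_subset[OF hB]) auto
    moreover have "zeta s = (s - \<rho>) ^ 0 * zeta s \<and> zeta s \<noteq> 0" if "s \<in> ball \<rho> (min e t0)" for s
    proof -
      have "dist \<rho> s < e" using that by simp
      from e(2)[OF this] show ?thesis by simp
    qed
    moreover have "0 < min e t0" "min e t0 \<le> t0" using e(1) t0 by auto
    ultimately show ?thesis
      by (intro exI[of _ "0::nat"] exI[of _ "min e t0"] exI[of _ zeta]) blast
  qed
  then obtain m r h where r: "0 < r" "r \<le> t0" and h1: "h holomorphic_on ball \<rho> r"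
    and h23: "\<forall>s\<in>ball \<rho> r. zeta s = (s - \<rho>) ^ m * h s \<and> h s \<noteq> 0"
    by (elim exE conjE) (rule that)
  note h2 = h23[THEN bspec, THEN conjunct1] and h3 = h23[THEN bspec, THEN conjunct2]
  have "\<rho> \<in> ball \<rho> r" using r by simp
  from convex_holomorphic_log[OF convex_ball open_ball this h1 ballI[OF h3]]
  obtain k where k: "k holomorphic_on ball \<rho> r" "\<And>s. s \<in> ball \<rho> r \<Longrightarrow> exp (k s) = h s"
    by blast
  let ?H = "ball \<rho> r \<inter> {s. Re s > 1/2}"
  have H1: "?H \<subseteq> log_domain"
  proof
    fix s assume s: "s \<in> ?H"
    have "\<bar>Im (\<rho> - s)\<bar> \<le> norm (\<rho> - s)" by (rule abs_Im_le_cmod)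
    also have "\<dots> < t0" using s r by (simp add: dist_norm)
    finally have "\<bar>Im \<rho> - Im s\<bar> < t0" unfolding minus_complex.sel .
    moreover have "Im \<rho> = t0" unfolding \<rho>_def by (rule complex.sel)
    ultimately have "Im s > 0" by linarith
    then show "s \<in> log_domain" using s by (simp add: log_domain_def)
  qed
  have H2: "s - \<rho> \<notin> \<real>\<^sub>\<le>\<^sub>0" if "s \<in> ?H" for s
    using that by (simp add: complex_nonpos_Reals_iff \<rho>_def)
  obtain c where c: "\<And>s. s \<in> ?H \<Longrightarrow> L s - of_nat m * Ln (s - \<rho>) - k s = c"
  proof (rule exp_eq_1_imp_constant[of ?H "\<lambda>s. L s - of_nat m * Ln (s - \<rho>) - k s"])
    show "connected ?H" by (intro convex_connected convex_Int convex_ball convex_halfspace_Re_gt)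
    have "continuous_on ?H L"
      by (rule holomorphic_on_imp_continuous_on[OF holomorphic_on_subset[OF L_holomorphic H1]])
    moreover have "continuous_on ?H k"
      by (rule continuous_on_subset[OF holomorphic_on_imp_continuous_on[OF k(1)]]) simp
    ultimately show "continuous_on ?H (\<lambda>s. L s - of_nat m * Ln (s - \<rho>) - k s)"
      by (intro continuous_intros) (simp_all only: H2 not_False_eq_True)
    fix s assume s: "s \<in> ?H"
    have "Re s \<noteq> Re \<rho>" using s by (simp add: \<rho>_def)
    then have "s \<noteq> \<rho>" by blast
    then have "exp (of_nat m * Ln (s - \<rho>)) = (s - \<rho>) ^ m" by (simp add: exp_of_nat_mult)
    then have "exp (L s) = exp (of_nat m * Ln (s - \<rho>)) * exp (k s)"
      using s subsetD[OF H1 s] h2[of s] k(2)[of s] exp_L[of s] by simp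
    then show "exp (L s - of_nat m * Ln (s - \<rho>) - k s) = 1" by (simp add: exp_diff)
  qed (rule that)
  have "\<forall>s\<in>ball \<rho> r. Re s > 1/2 \<longrightarrow> L s = of_nat m * Ln (s - \<rho>) + (k s + c)"
  proof (intro ballI impI)
    fix s assume "s \<in> ball \<rho> r" "Re s > 1/2"
    then have "s \<in> ?H" by simp
    from c[OF this] have "c + k s + of_nat m * Ln (s - \<rho>) = L s" by (metis diff_add_cancel)
    then show "L s = of_nat m * Ln (s - \<rho>) + (k s + c)" by (metis add.commute add.left_commute)
  qed
  moreover have "(\<lambda>s. k s + c) holomorphic_on ball \<rho> r" by (rule holomorphic_on_add[OF k(1) holomorphic_on_const])
  moreover have "\<forall>s\<in>ball \<rho> r. s \<noteq> \<rho> \<longrightarrow> zeta s \<noteq> 0"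
  proof (intro ballI impI)
    fix s assume s: "s \<in> ball \<rho> r" "s \<noteq> \<rho>"
    then have "(s - \<rho>) ^ m * h s \<noteq> 0" using h3[OF s(1)] by simp
    then show "zeta s \<noteq> 0" using h2[OF s(1)] by metis
  qed
  ultimately show ?thesis using r
    by (intro exI[of _ m] exI[of _ r] exI[of _ "\<lambda>s. k s + c"]) blast
qed

text \<open>Near \<open>\<rho>\<close> the argument is \<open>m\<close> times that of
  \<open>s - \<rho>\<close> plus a continuous function, and on the right of the line the argument of
  \<open>s - \<rho>\<close> lies between \<open>- pi / 2\<close> and \<open>pi / 2\<close>. These
  extremes occur in \<open>S\<close> itself just above and just below the ordinate, so the one-sided
  bound survives at zeros.\<close>

lemma Im_L_local_bound:
  assumes \<eta>: "\<eta> = 1 \<or> \<eta> = -1" and S: "\<And>t. t \<in> {A..B} \<Longrightarrow> \<eta> * zeta_S t \<le> M"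
    and A: "0 \<le> A" and t0: "A < t0" "t0 < B" and e: "e > 0"
  shows "\<exists>d>0. \<forall>s. Re s > 1/2 \<longrightarrow> dist s (Complex (1/2) t0) < d \<longrightarrow> \<eta> * Im (L s) \<le> pi * M + e"
proof -
  define \<rho> where "\<rho> = Complex (1/2) t0"
  have "t0 > 0" using A t0 by simp
  from L_near_critical_line[OF this, folded \<rho>_def] obtain m r g where
    r: "0 < r" "r \<le> t0" and g: "g holomorphic_on ball \<rho> r"
    and L: "\<And>s. s \<in> ball \<rho> r \<Longrightarrow> Re s > 1/2 \<Longrightarrow> L s = of_nat m * Ln (s - \<rho>) + g s"
    and nz: "\<And>s. s \<in> ball \<rho> r \<Longrightarrow> s \<noteq> \<rho> \<Longrightarrow> zeta s \<noteq> 0" by blast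
  have gc: "isCont g s" if "s \<in> ball \<rho> r" for s
    using holomorphic_on_imp_continuous_on[OF g] that by (simp add: continuous_on_eq_continuous_at)
  then have "isCont g \<rho>" using r by simp
  then obtain d0 where d0: "d0 > 0" "\<And>s. dist s \<rho> < d0 \<Longrightarrow> dist (g s) (g \<rho>) < e / 2"
    unfolding continuous_at_eps_delta using e by (metis half_gt_zero)
  define d where "d = min d0 (min r (min (t0 - A) (B - t0)))"
  have d: "d > 0" "d \<le> d0" "d \<le> r" "d \<le> t0 - A" "d \<le> B - t0" using d0 r t0 by (auto simp: d_def)
  have gd: "\<bar>\<eta> * Im (g s) - \<eta> * Im (g \<rho>)\<bar> < e / 2" if "dist s \<rho> < d" for s
  proof -
    have "\<bar>Im (g s - g \<rho>)\<bar> \<le> norm (g s - g \<rho>)" by (rule abs_Im_le_cmod)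
    also have "\<dots> < e / 2" using d0(2)[of s] that d by (simp add: dist_norm)
    finally show ?thesis using \<eta> abs_minus_commute[of "Im (g s)" "Im (g \<rho>)"] by auto
  qed
  \<comment> \<open>The side of \<open>t0\<close> on which
    \<open>\<eta> * Im (Ln (s - \<rho>))\<close> takes its largest value
    \<open>pi / 2\<close>.\<close>
  define t where "t = t0 + \<eta> * d / 2"
  define s1 where "s1 = Complex (1/2) t"
  have ds: "dist s1 \<rho> < d"
    using \<eta> d by (auto simp: s1_def t_def \<rho>_def dist_norm complex_norm complex_diff)
  have s1: "s1 \<in> ball \<rho> r" using ds d by (simp add: dist_commute)
  have tAB: "t \<in> {A..B}" and tpos: "t > 0" using \<eta> d A by (auto simp: t_def field_simps)
  have s1d: "s1 - \<rho> = \<i> * of_real (\<eta> * d / 2)" by (simp add: s1_def \<rho>_def t_def complex_eq_iff)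
  have "zeta_S t = Im (of_nat m * Ln (s1 - \<rho>) + g s1) / pi"
  proof (rule zeta_S_eq[OF tpos])
    have "s1 \<noteq> \<rho>" using \<eta> d by (auto simp: s1_def t_def \<rho>_def)
    then show "zeta (Complex (1/2) t) \<noteq> 0" using nz[OF s1] by (simp add: s1_def)
    have nn: "s1 - \<rho> \<notin> \<real>\<^sub>\<le>\<^sub>0" unfolding s1d using \<eta> d by (auto simp: complex_nonpos_Reals_iff)
    have c: "((\<lambda>\<sigma>. Complex \<sigma> t) \<longlongrightarrow> s1) (at_right (1/2))"
      unfolding s1_def by (intro tendsto_intros)
    have "((\<lambda>\<sigma>. of_nat m * Ln (Complex \<sigma> t - \<rho>) + g (Complex \<sigma> t)) \<longlongrightarrow>
        of_nat m * Ln (s1 - \<rho>) + g s1) (at_right (1/2))"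
      by (intro tendsto_intros isCont_tendsto_compose[OF gc[OF s1]] c nn)
    moreover have "\<forall>\<^sub>F \<sigma> in at_right (1/2). of_nat m * Ln (Complex \<sigma> t - \<rho>) + g (Complex \<sigma> t) = L (Complex \<sigma> t)"
    proof -
      have "\<forall>\<^sub>F \<sigma> in at_right (1/2). Complex \<sigma> t \<in> ball \<rho> r"
        using s1 by (intro topological_tendstoD[OF c]) auto
      moreover have "\<forall>\<^sub>F \<sigma> in at_right (1/2). \<sigma> > (1/2::real)" by (rule eventually_at_right_less)
      ultimately show ?thesis by eventually_elim (simp add: L)
    qed
    ultimately show "((\<lambda>\<sigma>. L (Complex \<sigma> t)) \<longlongrightarrow> of_nat m * Ln (s1 - \<rho>) + g s1) (at_right (1/2))"
      by (rule Lim_transform_eventually)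
  qed
  moreover have "Im (Ln (s1 - \<rho>)) = \<eta> * pi / 2"
  proof -
    have "Ln (s1 - \<rho>) = Ln (of_real (d / 2) * (of_real \<eta> * \<i>))" by (simp add: s1d mult_ac)
    also have "\<dots> = Ln (of_real (d / 2)) + Ln (of_real \<eta> * \<i>)"
      using Ln_times_of_real[of "d / 2" "of_real \<eta> * \<i>"] d(1) \<eta> by (auto simp: Ln_of_real)
    also have "Ln (of_real (d / 2)) = of_real (ln (d / 2))" using d(1) by (intro Ln_of_real) simp
    finally show ?thesis using \<eta> by auto
  qed
  ultimately have "\<eta> * zeta_S t = (real m * (\<eta> * \<eta>) * pi / 2 + \<eta> * Im (g s1)) / pi"
    by (simp add: algebra_simps)
  also have "\<eta> * \<eta> = 1" using \<eta> by auto
  finally have "pi * (\<eta> * zeta_S t) = real m * pi / 2 + \<eta> * Im (g s1)" by simp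
  then have 1: "real m * pi / 2 + \<eta> * Im (g s1) \<le> pi * M"
    using mult_left_mono[OF S[OF tAB], of pi] by simp
  have "\<eta> * Im (L s) \<le> pi * M + e" if s: "Re s > 1/2" "dist s \<rho> < d" for s
  proof -
    have "\<bar>Im (Ln (s - \<rho>))\<bar> \<le> pi / 2"
    proof -
      have "Re (s - \<rho>) > 0" using s by (simp add: \<rho>_def)
      moreover from this have "s - \<rho> \<noteq> 0" by (metis less_irrefl zero_complex.sel(1))
      ultimately show ?thesis using Re_Ln_pos_le[of "s - \<rho>"] by simp
    qed
    then have "\<eta> * Im (Ln (s - \<rho>)) \<le> pi / 2" using \<eta> by auto
    then have "real m * (\<eta> * Im (Ln (s - \<rho>))) \<le> real m * (pi / 2)" by (intro mult_left_mono) auto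
    moreover have "\<eta> * Im (L s) = real m * (\<eta> * Im (Ln (s - \<rho>))) + \<eta> * Im (g s)"
      using L[of s] s d by (simp add: dist_commute algebra_simps)
    ultimately show ?thesis using 1 gd[OF ds] gd[OF s(2)] by (simp add: abs_if split: if_splits)
  qed
  then show ?thesis using d(1) unfolding \<rho>_def by blast
qed

end

section \<open>From the critical line to its right\<close>

context zeta_log
begin

text \<open>Compactness: balls with half of each local radius cover the segment, and the other half
  is left for the displacement \<open>x\<close>.\<close>

lemma Im_L_uniform_bound:
  assumes \<eta>: "\<eta> = 1 \<or> \<eta> = -1" and S: "\<And>t. t \<in> {A..B} \<Longrightarrow> \<eta> * zeta_S t \<le> M"
    and A: "0 \<le> A" and ab: "A < a" "b < B" and e: "e > 0"
  shows "\<exists>x0>0. \<forall>x t. 0 < x \<longrightarrow> x < x0 \<longrightarrow> t \<in> {a..b} \<longrightarrow> \<eta> * Im (L (Complex (1/2 + x) t)) \<le> pi * M + e"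
proof -
  have "\<exists>d>0. \<forall>s. Re s > 1/2 \<longrightarrow> dist s (Complex (1/2) t0) < d \<longrightarrow> \<eta> * Im (L s) \<le> pi * M + e"
    if "t0 \<in> {a..b}" for t0
    using that ab by (intro Im_L_local_bound[OF \<eta> S A _ _ e]) auto
  then obtain d where d: "\<And>t0. t0 \<in> {a..b} \<Longrightarrow> d t0 > 0"
    "\<And>t0 s. t0 \<in> {a..b} \<Longrightarrow> Re s > 1/2 \<Longrightarrow> dist s (Complex (1/2) t0) < d t0 \<Longrightarrow> \<eta> * Im (L s) \<le> pi * M + e"
    by metis
  have "{a..b} \<subseteq> (\<Union>t0\<in>{a..b}. ball t0 (d t0 / 2))" using d(1) by force
  then obtain F where F: "F \<subseteq> {a..b}" "finite F" "{a..b} \<subseteq> (\<Union>t0\<in>F. ball t0 (d t0 / 2))"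
    by (rule compactE_image[OF compact_Icc open_ball])
  define x0 where "x0 = Min (insert 1 ((\<lambda>t0. d t0 / 2) ` F))"
  have x0: "x0 > 0" unfolding x0_def using F d(1) by (auto simp: Min_gr_iff subset_iff)
  have x0F: "x0 \<le> d t0 / 2" if "t0 \<in> F" for t0
    unfolding x0_def by (rule Min_le) (use F(2) that in auto)
  have "\<eta> * Im (L (Complex (1/2 + x) t)) \<le> pi * M + e" if x: "0 < x" "x < x0" "t \<in> {a..b}" for x t
  proof -
    obtain t0 where t0: "t0 \<in> F" "dist t0 t < d t0 / 2" using F(3) x(3) by auto
    have "dist (Complex (1/2 + x) t) (Complex (1/2) t0) \<le> \<bar>x\<bar> + \<bar>t - t0\<bar>"
      using cmod_le[of "Complex (1/2 + x) t - Complex (1/2) t0"] by (simp add: dist_norm)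
    also have "\<dots> < d t0" using x t0 x0F[of t0] by (simp add: dist_real_def abs_minus_commute)
    finally show ?thesis using d(2)[of t0] t0(1) F(1) x(1) by auto
  qed
  then show ?thesis using x0 by blast
qed

text \<open>Close to the horizontal sides of the rectangle the only available bound for \<open>Im L\<close> is
  \<open>O(ln B / (Re w - 1/2))\<close>. It is dominated there by multiples of the positive harmonic functions
  \<open>Re (1 / (w - s))\<close> with \<open>s\<close> the corners, which are small away from the corners.\<close>

lemma Im_L_bound:
  obtains C where "C > 0"
    "\<And>\<eta> A B M s. \<eta> = 1 \<or> \<eta> = -1 \<Longrightarrow> 4 \<le> A \<Longrightarrow> 4 \<le> B \<Longrightarrow> 0 \<le> M \<Longrightarrow> \<forall>t\<in>{A..B}. \<eta> * zeta_S t \<le> M \<Longrightarrow>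
       1/2 < Re s \<Longrightarrow> Re s \<le> 3/2 \<Longrightarrow> A + 1 + ln B \<le> Im s \<Longrightarrow> Im s \<le> B - 1 - ln B \<Longrightarrow>
       \<eta> * Im (L s) \<le> pi * M + C"
proof -
  obtain C1 where C1: "C1 > 0" "\<And>s. Re s > 1/2 \<Longrightarrow> Re s \<le> 2 \<Longrightarrow> Im s \<ge> 4 \<Longrightarrow> norm (L s) \<le> C1 * ln (Im s) / (Re s - 1/2)"
    using L_bound by blast
  obtain C2 where C2: "C2 > 0" "\<And>s. Re s \<ge> 3/2 \<Longrightarrow> norm (log_series s) \<le> C2"
    using norm_log_series_le by blast
  have main: "\<eta> * Im (L s) \<le> pi * M + (1 + C2 + 2 * C1)"
    if \<eta>: "\<eta> = 1 \<or> \<eta> = -1" and A: "4 \<le> A" and B: "4 \<le> B" and M: "0 \<le> M" and S: "\<forall>t\<in>{A..B}. \<eta> * zeta_S t \<le> M"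
      and s: "1/2 < Re s" "Re s \<le> 3/2" "A + 1 + ln B \<le> Im s" "Im s \<le> B - 1 - ln B" for \<eta> A B M s
  proof -
    define a b where "a = A + 1" and "b = B - 1"
    have lnB: "ln B \<ge> 1"
    proof -
      have "exp 1 \<le> B" using exp_le B by linarith
      then show ?thesis by (subst ln_ge_iff) (use B in auto)
    qed
    have ab: "A < a" "b < B" "a < Im s" "Im s < b" using s lnB by (auto simp: a_def b_def)
    obtain x0 where x0: "x0 > 0"
      "\<And>x t. 0 < x \<Longrightarrow> x < x0 \<Longrightarrow> t \<in> {a..b} \<Longrightarrow> \<eta> * Im (L (Complex (1/2 + x) t)) \<le> pi * M + 1"
      using Im_L_uniform_bound[OF \<eta> _ _ ab(1,2), of M 1] S A by force
    \<comment> \<open>The left side of the rectangle is put at \<open>1/2 + d\<close>, within reach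
      of \<open>x0\<close> and to the left of \<open>s\<close>.\<close>
    define d where "d = min (x0 / 2) ((Re s - 1/2) / 2)"
    have d: "0 < d" "d < x0" using x0(1) s by (auto simp: d_def)
    have "d \<le> (Re s - 1/2) / 2" unfolding d_def by (rule min.cobounded2)
    also have "(Re s - 1/2) / 2 < Re s - 1/2" using s(1) by simp
    finally have ds: "1/2 + d < Re s" by simp
    define R where "R = cbox (Complex (1/2 + d) a) (Complex 2 b)"
    have R: "w \<in> R \<longleftrightarrow> 1/2 + d \<le> Re w \<and> Re w \<le> 2 \<and> a \<le> Im w \<and> Im w \<le> b" for w
      by (auto simp: R_def in_cbox_complex_iff)
    have dom: "w \<in> log_domain" "w - Complex (1/2) a \<noteq> 0" "w - Complex (1/2) b \<noteq> 0" if "w \<in> R" for w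
      using that d A unfolding R by (auto simp: log_domain_def a_def complex_eq_iff)
    define h where "h c w = Re (inverse (w - Complex (1/2) c))" for c w
    have h: "h c w = (Re w - 1/2) / ((Re w - 1/2)\<^sup>2 + (Im w - c)\<^sup>2)" for c w
      by (simp add: h_def)
    have h0: "h c w \<ge> 0" if "w \<in> R" for c w
      using that d(1) unfolding h R by (intro divide_nonneg_nonneg) auto
    \<comment> \<open>Chosen such that \<open>Re F\<close> is \<open>\<eta> * Im L\<close> minus a
      multiple of the two harmonic functions; only upper bounds are then needed on the
      boundary.\<close>
    define F where "F w = - (\<i> * of_real \<eta> * L w) -
        of_real (C1 * ln B) * (inverse (w - Complex (1/2) a) + inverse (w - Complex (1/2) b))" for w
    have ReF: "Re (F w) = \<eta> * Im (L w) - C1 * ln B * (h a w + h b w)" for w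
      by (simp add: F_def h_def)
    have "Re (F s) \<le> pi * M + 1 + C2"
    proof (rule maximum_real_frontier[of F R])
      have FR: "F holomorphic_on R"
        unfolding F_def using dom
        by (intro holomorphic_intros holomorphic_on_subset[OF L_holomorphic]) auto
      then show "F holomorphic_on interior R" by (rule holomorphic_on_subset) (rule interior_subset)
      show "continuous_on (closure R) F"
        using holomorphic_on_imp_continuous_on[OF FR] by (simp add: R_def)
      show "bounded R" by (simp add: R_def bounded_cbox)
      show "s \<in> R" using s ds ab by (simp add: R)
      fix w assume "w \<in> frontier R"
      then have w: "w \<in> R" and "w \<notin> box (Complex (1/2 + d) a) (Complex 2 b)"
        by (auto simp: R_def frontier_cbox)
      then have "Re w = 1/2 + d \<or> Re w = 2 \<or> Im w = a \<or> Im w = b"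
        unfolding R by (auto simp: in_box_complex_iff)
      then consider "Re w = 1/2 + d" | "Re w = 2" | c where "Im w = c" "c = a \<or> c = b" by blast
      then show "Re (F w) \<le> pi * M + 1 + C2"
      proof cases
        case 1
        then have "w = Complex (1/2 + d) (Im w)" by (simp add: complex_eq_iff)
        then have "\<eta> * Im (L w) \<le> pi * M + 1"
          using x0(2)[of d "Im w"] d w unfolding R by (metis atLeastAtMost_iff)
        moreover have "0 \<le> C1 * ln B * (h a w + h b w)"
          using h0[OF w] C1 lnB by (intro mult_nonneg_nonneg add_nonneg_nonneg) auto
        ultimately show ?thesis unfolding ReF using C2 by linarith
      next
        case 2
        have "norm (L w) \<le> C2" using C2(2)[of w] L_eq_series[of w] 2 by simp
        then have "\<eta> * Im (L w) \<le> C2" using abs_Im_le_cmod[of "L w"] \<eta> by auto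
        moreover have "0 \<le> C1 * ln B * (h a w + h b w)"
          using h0[OF w] C1 lnB by (intro mult_nonneg_nonneg add_nonneg_nonneg) auto
        moreover have "pi * M \<ge> 0" using M by simp
        ultimately show ?thesis unfolding ReF by linarith
      next
        case 3
        let ?x = "Re w - 1/2"
        have x: "?x > 0" using w d unfolding R by linarith
        have "norm (L w) \<le> C1 * ln (Im w) / ?x"
          using w d A unfolding R by (intro C1) (auto simp: a_def)
        also have "\<dots> \<le> C1 * ln B / ?x"
        proof (intro divide_right_mono mult_left_mono)
          show "ln (Im w) \<le> ln B"
            using w A B unfolding R by (subst ln_le_cancel_iff) (auto simp: a_def b_def)
        qed (use x C1 in auto)
        \<comment> \<open>On the side \<open>Im w = c\<close> the function \<open>h c\<close> is
          exactly \<open>1 / (Re w - 1/2)\<close>, the growth that \<open>L_bound\<close>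
          allows.\<close>
        also have "\<dots> = C1 * ln B * h c w" using x 3 unfolding h by (simp add: power2_eq_square)
        also have "\<dots> \<le> C1 * ln B * (h a w + h b w)"
          using h0[OF w] C1 lnB 3(2) by (intro mult_left_mono) auto
        finally have "\<eta> * Im (L w) \<le> C1 * ln B * (h a w + h b w)"
          using abs_Im_le_cmod[of "L w"] \<eta> by auto
        moreover have "pi * M \<ge> 0" using M by simp
        ultimately show ?thesis unfolding ReF using C2 by linarith
      qed
    qed
    \<comment> \<open>The margin \<open>ln B\<close> in the assumption on \<open>Im s\<close> pays
      for the factor \<open>ln B\<close> in \<open>F\<close>; what remains is the constant
      \<open>2 * C1\<close>.\<close>
    moreover have "h c s \<le> 1 / ln B" if "ln B \<le> \<bar>Im s - c\<bar>" for c
    proof -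
      have "(ln B)\<^sup>2 \<le> \<bar>Im s - c\<bar>\<^sup>2" using that lnB by (intro power_mono) auto
      then have "(ln B)\<^sup>2 \<le> (Re s - 1/2)\<^sup>2 + (Im s - c)\<^sup>2" by (simp add: add_increasing)
      then have "h c s \<le> 1 / (ln B)\<^sup>2"
        unfolding h using s lnB by (intro frac_le) auto
      also have "\<dots> \<le> 1 / ln B" using lnB by (intro divide_left_mono) (auto simp: power2_eq_square)
      finally show ?thesis .
    qed
    from this[of a] this[of b] have "h a s + h b s \<le> 2 / ln B"
      using s lnB by (simp add: a_def b_def)
    then have "C1 * ln B * (h a s + h b s) \<le> C1 * ln B * (2 / ln B)"
      using C1 lnB by (intro mult_left_mono) auto
    ultimately show ?thesis unfolding ReF using lnB by simp
  qed
  show ?thesis by (rule that[of "1 + C2 + 2 * C1"]) (use C1(1) C2(1) in linarith, rule main)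
qed

end

section \<open>The resonator\<close>

text \<open>Each term is at most \<open>(2/3) ^ nat \<bar>j - k\<bar>\<close>, and either side of
  \<open>j\<close> is a geometric series with sum at most 3. That the bound does not depend on
  \<open>J\<close> expresses that the bins of the resonator are nearly orthogonal.\<close>

lemma sum_exp_neg_square_le:
  fixes J :: "int set"
  assumes "finite J"
  shows "(\<Sum>k\<in>J. exp (- (of_int (j - k))\<^sup>2 / 2 :: real)) \<le> 6"
proof -
  have geo: "(\<Sum>d\<in>A. (2/3 :: real) ^ d) \<le> 3" if "finite A" for A :: "nat set"
    using sum_le_suminf[of "\<lambda>d. (2/3 :: real) ^ d" A] that by (simp add: suminf_geometric)
  have half: "(\<Sum>k\<in>A. (2/3 :: real) ^ nat \<bar>j - k\<bar>) \<le> 3"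
    if A: "finite A" and inj: "inj_on (\<lambda>k. nat \<bar>j - k\<bar>) A" for A
    using geo[of "(\<lambda>k. nat \<bar>j - k\<bar>) ` A"] A by (simp add: sum.reindex[OF inj])
  have gterm: "exp (- (of_int d)\<^sup>2 / 2 :: real) \<le> (2/3) ^ nat \<bar>d\<bar>" for d :: int
  proof -
    have e: "exp (- 1 / 2 :: real) \<le> 2/3"
    proof -
      have "(3/2 :: real) \<le> exp (1/2)" using exp_ge_add_one_self[of "1/2"] by simp
      then show ?thesis by (simp add: exp_minus field_simps)
    qed
    have "\<bar>d\<bar> * 1 \<le> \<bar>d\<bar> * \<bar>d\<bar>" using mult_left_mono[of 1 "\<bar>d\<bar>" "\<bar>d\<bar>"] by (cases "d = 0") auto
    then have "\<bar>d\<bar> \<le> d\<^sup>2" by (simp add: power2_eq_square)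
    then have "real_of_int \<bar>d\<bar> \<le> (of_int d)\<^sup>2" by (metis of_int_le_iff of_int_power)
    then have "exp (- (of_int d)\<^sup>2 / 2 :: real) \<le> exp (real (nat \<bar>d\<bar>) * (- 1 / 2))" by simp
    also have "\<dots> = exp (- 1 / 2) ^ nat \<bar>d\<bar>" by (rule exp_of_nat_mult)
    also have "\<dots> \<le> (2/3) ^ nat \<bar>d\<bar>" by (intro power_mono e) auto
    finally show ?thesis .
  qed
  have "(\<Sum>k\<in>J. exp (- (of_int (j - k))\<^sup>2 / 2 :: real)) \<le> (\<Sum>k\<in>J. (2/3) ^ nat \<bar>j - k\<bar>)"
    by (intro sum_mono gterm)
  also have "(\<Sum>k\<in>J. (2/3 :: real) ^ nat \<bar>j - k\<bar>) =
      (\<Sum>k\<in>{k\<in>J. k \<le> j}. (2/3) ^ nat \<bar>j - k\<bar>) + (\<Sum>k\<in>{k\<in>J. k > j}. (2/3) ^ nat \<bar>j - k\<bar>)"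
  proof -
    have "{k\<in>J. k \<le> j} \<union> {k\<in>J. k > j} = J" by auto
    moreover have "{k\<in>J. k \<le> j} \<inter> {k\<in>J. k > j} = {}" by auto
    ultimately show ?thesis
      using sum.union_disjoint[of "{k\<in>J. k \<le> j}" "{k\<in>J. k > j}" "\<lambda>k. (2/3 :: real) ^ nat \<bar>j - k\<bar>"] assms
      by (metis (no_types, lifting) finite_Un)
  qed
  also have "\<dots> \<le> 3 + 3"
    using assms by (intro add_mono half) (auto simp: inj_on_def)
  finally show ?thesis by simp
qed

text \<open>The elements of \<open>\<Omega>\<close> stand for the products of at most one prime from each group, with \<open>1\<close>
  meaning that no prime of the group is chosen. Their logarithms are not separated, so they are
  collected into bins of width \<open>1 / \<tau>\<close>.\<close>

lemma resonator_exists: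
  fixes G :: "'i \<Rightarrow> nat set" and \<tau> :: real
  assumes I: "finite I" and G: "\<And>i. i \<in> I \<Longrightarrow> finite (G i) \<and> G i \<noteq> {} \<and> (\<forall>p\<in>G i. p > 1)"
  shows "\<exists>(J::int set) r. finite J \<and> card J \<le> (\<Prod>i\<in>I. card (G i) + 1) \<and> (\<forall>j. r j \<ge> 0) \<and>
    (\<Sum>j\<in>J. (r j)\<^sup>2) = 1 \<and>
    (\<forall>i\<in>I. \<forall>p\<in>G i. exp (- 1 / 2) / (2 * sqrt (real (card (G i)))) \<le>
       (\<Sum>j\<in>J. \<Sum>k\<in>J. r j * r k * exp (- (\<tau> * ln (real p) + of_int (j - k))\<^sup>2 / 2)))"
proof -
  define B where "B i = insert 1 (G i)" for i
  define \<Omega> where "\<Omega> = PiE I B"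
  \<comment> \<open>\<open>(v i x)\<^sup>2\<close> is a probability: one half for no prime of the
    group, the other half spread evenly over its primes. Thus \<open>(f \<omega>)\<^sup>2\<close> is
    a product measure of mass 1.\<close>
  define v where "v i x = (if x = 1 then 1 / sqrt 2 else 1 / sqrt (2 * real (card (G i))))" for i and x :: nat
  define f where "f \<omega> = (\<Prod>i\<in>I. v i (\<omega> i))" for \<omega>
  define \<theta> where "\<theta> \<omega> = (\<Sum>i\<in>I. ln (real (\<omega> i)))" for \<omega>
  define b where "b \<omega> = \<lfloor>\<tau> * \<theta> \<omega>\<rfloor>" for \<omega>
  \<comment> \<open>The \<open>L2\<close> norm over the bin rather than the sum, so that the
    normalisation carries over from \<open>f\<close>.\<close>
  define r where "r j = L2_set f {\<omega>\<in>\<Omega>. b \<omega> = j}" for j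
  define J where "J = b ` \<Omega>"
  have g0: "real (card (G i)) > 0" if "i \<in> I" for i using G[OF that] by (simp add: card_gt_0_iff)
  have n1: "1 \<notin> G i" if "i \<in> I" for i using G[OF that] by auto
  have finB: "finite (B i)" if "i \<in> I" for i using G[OF that] by (simp add: B_def)
  have fin\<Omega>: "finite \<Omega>" unfolding \<Omega>_def by (intro finite_PiE I finB)
  have v0: "v i x > 0" if "i \<in> I" for i x using g0[OF that] by (auto simp: v_def)
  have f0: "f \<omega> \<ge> 0" for \<omega> unfolding f_def using v0 by (intro prod_nonneg) (auto intro: less_imp_le)
  have vsum: "(\<Sum>x\<in>B i. (v i x)\<^sup>2) = 1" if "i \<in> I" for i
  proof -
    have "(\<Sum>x\<in>B i. (v i x)\<^sup>2) = 1/2 + (\<Sum>x\<in>G i. (v i x)\<^sup>2)"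
      using G[OF that] n1[OF that] by (simp add: B_def v_def power_divide)
    also have "(\<Sum>x\<in>G i. (v i x)\<^sup>2) = (\<Sum>x\<in>G i. 1 / (2 * real (card (G i))))"
      using n1[OF that] by (intro sum.cong) (auto simp: v_def power_divide)
    also have "\<dots> = 1/2" using g0[OF that] by simp
    finally show ?thesis by simp
  qed
  have f2: "(\<Sum>\<omega>\<in>\<Omega>. (f \<omega>)\<^sup>2) = 1"
  proof -
    have "(\<Sum>\<omega>\<in>\<Omega>. (f \<omega>)\<^sup>2) = (\<Sum>\<omega>\<in>\<Omega>. \<Prod>i\<in>I. (v i (\<omega> i))\<^sup>2)"
      by (simp add: f_def prod_power_distrib)
    also have "\<dots> = (\<Prod>i\<in>I. \<Sum>x\<in>B i. (v i x)\<^sup>2)"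
      unfolding \<Omega>_def by (rule prod_sum_PiE[symmetric]) (use I finB in auto)
    also have "\<dots> = 1" using vsum by simp
    finally show ?thesis .
  qed
  have r2: "(r j)\<^sup>2 = (\<Sum>\<omega>\<in>{\<omega>\<in>\<Omega>. b \<omega> = j}. (f \<omega>)\<^sup>2)" for j
    unfolding r_def L2_set_def by (intro real_sqrt_pow2 sum_nonneg) auto
  have rsum: "(\<Sum>j\<in>J. (r j)\<^sup>2) = 1"
    unfolding r2 using sum.group[OF fin\<Omega>, of J b "\<lambda>\<omega>. (f \<omega>)\<^sup>2"] f2 fin\<Omega> by (simp add: J_def)
  have cardJ: "card J \<le> (\<Prod>i\<in>I. card (G i) + 1)"
  proof -
    have "card J \<le> card \<Omega>" unfolding J_def by (rule card_image_le[OF fin\<Omega>])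
    also have "\<dots> = (\<Prod>i\<in>I. card (B i))" unfolding \<Omega>_def by (rule card_PiE[OF I])
    also have "\<dots> = (\<Prod>i\<in>I. card (G i) + 1)"
      by (intro prod.cong) (use G n1 in \<open>auto simp: B_def\<close>)
    finally show ?thesis .
  qed
  have gain: "exp (- 1 / 2) / (2 * sqrt (real (card (G i)))) \<le>
       (\<Sum>j\<in>J. \<Sum>k\<in>J. r j * r k * exp (- (\<tau> * ln (real p) + of_int (j - k))\<^sup>2 / 2))"
    if i: "i \<in> I" and p: "p \<in> G i" for i p
  proof -
    \<comment> \<open>Inserting \<open>p\<close> where no prime of its group is present costs a
      factor \<open>1 / sqrt (card (G i))\<close> in \<open>f\<close>, and such
      \<open>\<omega>\<close> carry half of the mass. This is the source of the lower bound.\<close>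
    define \<phi> where "\<phi> \<omega> = fun_upd \<omega> i p" for \<omega> :: "'i \<Rightarrow> nat"
    define A where "A = {\<omega>\<in>\<Omega>. \<omega> i = 1}"
    have finA: "finite A" using fin\<Omega> by (simp add: A_def)
    have p1: "p > 1" using G[OF i] p by auto
    have \<phi>\<Omega>: "\<phi> \<omega> \<in> \<Omega>" if "\<omega> \<in> A" for \<omega>
      using that i p by (auto simp: \<phi>_def A_def \<Omega>_def B_def PiE_iff extensional_def)
    have inj\<phi>: "inj_on \<phi> A"
    proof (rule inj_onI)
      fix x y assume xy: "x \<in> A" "y \<in> A" "\<phi> x = \<phi> y"
      show "x = y"
      proof
        fix j
        have "\<phi> x j = \<phi> y j" using xy(3) by (rule fun_cong)
        then show "x j = y j" using xy(1,2) by (cases "j = i") (simp_all add: A_def \<phi>_def)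
      qed
    qed
    have prodi: "(\<Prod>j\<in>I. h j) = h i * (\<Prod>j\<in>I - {i}. h j)" for h :: "'i \<Rightarrow> real"
      by (rule prod.remove[OF I i])
    have f\<phi>: "f (\<phi> \<omega>) = f \<omega> / sqrt (real (card (G i)))" if "\<omega> \<in> A" for \<omega>
    proof -
      have "(\<Prod>j\<in>I - {i}. v j (\<phi> \<omega> j)) = (\<Prod>j\<in>I - {i}. v j (\<omega> j))"
        by (intro prod.cong) (auto simp: \<phi>_def)
      moreover have "v i (\<phi> \<omega> i) = v i (\<omega> i) / sqrt (real (card (G i)))"
        using that p1 by (simp add: \<phi>_def A_def v_def real_sqrt_mult)
      ultimately show ?thesis unfolding f_def by (simp add: prodi)
    qed
    have A2: "(\<Sum>\<omega>\<in>A. (f \<omega>)\<^sup>2) = 1/2"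
    proof -
      define u where "u j x = (if j = i \<and> x \<noteq> 1 then 0 else (v j x)\<^sup>2)" for j x
      have "(\<Sum>\<omega>\<in>A. (f \<omega>)\<^sup>2) = (\<Sum>\<omega>\<in>A. \<Prod>j\<in>I. u j (\<omega> j))"
      proof (intro sum.cong refl)
        fix \<omega> assume "\<omega> \<in> A"
        then show "(f \<omega>)\<^sup>2 = (\<Prod>j\<in>I. u j (\<omega> j))"
          unfolding f_def prod_power_distrib by (intro prod.cong) (auto simp: u_def A_def)
      qed
      also have "\<dots> = (\<Sum>\<omega>\<in>\<Omega>. \<Prod>j\<in>I. u j (\<omega> j))"
      proof (rule sum.mono_neutral_left[OF fin\<Omega>])
        show "\<forall>\<omega>\<in>\<Omega> - A. (\<Prod>j\<in>I. u j (\<omega> j)) = 0"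
          using i I by (auto simp: A_def u_def intro!: bexI[of _ i])
      qed (auto simp: A_def)
      also have "\<dots> = (\<Prod>j\<in>I. \<Sum>x\<in>B j. u j x)"
        unfolding \<Omega>_def by (rule prod_sum_PiE[symmetric]) (use I finB in auto)
      also have "\<dots> = (\<Sum>x\<in>B i. u i x) * (\<Prod>j\<in>I - {i}. \<Sum>x\<in>B j. u j x)" by (rule prodi)
      also have "(\<Prod>j\<in>I - {i}. \<Sum>x\<in>B j. u j x) = (\<Prod>j\<in>I - {i}. \<Sum>x\<in>B j. (v j x)\<^sup>2)"
        by (intro prod.cong sum.cong) (auto simp: u_def)
      also have "\<dots> = 1" using vsum by (intro prod.neutral) auto
      also have "(\<Sum>x\<in>B i. u i x) = (\<Sum>x\<in>{1}. u i x)"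
        using finB[OF i] by (intro sum.mono_neutral_right) (auto simp: u_def B_def)
      also have "\<dots> = 1/2" by (simp add: u_def v_def power_divide)
      finally show ?thesis by simp
    qed
    have \<theta>\<phi>: "\<theta> (\<phi> \<omega>) = \<theta> \<omega> + ln (real p)" if "\<omega> \<in> A" for \<omega>
    proof -
      have "(\<Sum>j\<in>I - {i}. ln (real (\<phi> \<omega> j))) = (\<Sum>j\<in>I - {i}. ln (real (\<omega> j)))"
        by (intro sum.cong) (auto simp: \<phi>_def)
      then show ?thesis using that unfolding \<theta>_def by (simp add: sum.remove[OF I i] A_def \<phi>_def)
    qed
    \<comment> \<open>Either rounding loses less than 1, so the two bins are
      \<open>\<tau> * ln p\<close> apart up to an error of at most 1; hence the factor
      \<open>exp (- 1 / 2)\<close>.\<close>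
    have close: "exp (- 1 / 2) \<le> exp (- (\<tau> * ln (real p) + of_int (b \<omega> - b (\<phi> \<omega>)))\<^sup>2 / 2)"
      if "\<omega> \<in> A" for \<omega>
    proof -
      define x where "x = \<tau> * \<theta> \<omega>"
      have "\<tau> * ln (real p) + of_int (b \<omega> - b (\<phi> \<omega>)) = of_int \<lfloor>x\<rfloor> - x - (of_int \<lfloor>\<tau> * \<theta> (\<phi> \<omega>)\<rfloor> - \<tau> * \<theta> (\<phi> \<omega>))"
        by (simp add: b_def x_def \<theta>\<phi>[OF that] algebra_simps)
      then have "\<bar>\<tau> * ln (real p) + of_int (b \<omega> - b (\<phi> \<omega>))\<bar> \<le> 1" by linarith
      then have "(\<tau> * ln (real p) + of_int (b \<omega> - b (\<phi> \<omega>)))\<^sup>2 \<le> 1" by (simp add: abs_square_le_1)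
      then show ?thesis by simp
    qed
    define Ajk where "Ajk j k = {\<omega>\<in>A. b \<omega> = j \<and> b (\<phi> \<omega>) = k}" for j k
    \<comment> \<open>Cauchy-Schwarz for a pair of bins. Injectivity of \<open>\<phi>\<close> bounds
      the second factor by the norm of the whole bin \<open>k\<close>.\<close>
    have cs: "(\<Sum>\<omega>\<in>Ajk j k. f \<omega> * f (\<phi> \<omega>)) \<le> r j * r k" for j k
    proof -
      have finjk: "finite (Ajk j k)" using finA by (simp add: Ajk_def)
      have "(\<Sum>\<omega>\<in>Ajk j k. f \<omega> * f (\<phi> \<omega>)) \<le> (\<Sum>\<omega>\<in>Ajk j k. \<bar>f \<omega>\<bar> * \<bar>f (\<phi> \<omega>)\<bar>)"
        by (intro sum_mono) (simp add: f0)
      also have "\<dots> \<le> L2_set f (Ajk j k) * L2_set (\<lambda>\<omega>. f (\<phi> \<omega>)) (Ajk j k)" by (rule L2_set_mult_ineq)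
      also have "\<dots> \<le> r j * r k"
      proof (intro mult_mono)
        show "L2_set f (Ajk j k) \<le> r j" unfolding r_def L2_set_def
          using fin\<Omega> by (intro real_sqrt_le_mono sum_mono2) (auto simp: Ajk_def A_def)
        have "(\<Sum>\<omega>\<in>Ajk j k. (f (\<phi> \<omega>))\<^sup>2) = (\<Sum>\<omega>\<in>\<phi> ` Ajk j k. (f \<omega>)\<^sup>2)"
          by (subst sum.reindex) (auto intro: inj_on_subset[OF inj\<phi>] simp: Ajk_def)
        also have "\<dots> \<le> (\<Sum>\<omega>\<in>{\<omega>\<in>\<Omega>. b \<omega> = k}. (f \<omega>)\<^sup>2)"
          using fin\<Omega> \<phi>\<Omega> by (intro sum_mono2) (auto simp: Ajk_def)
        finally show "L2_set (\<lambda>\<omega>. f (\<phi> \<omega>)) (Ajk j k) \<le> r k" unfolding r_def L2_set_def by simp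
      qed (auto simp: r_def)
      finally show ?thesis .
    qed
    have "exp (- 1 / 2) / (2 * sqrt (real (card (G i)))) = (\<Sum>\<omega>\<in>A. f \<omega> * f (\<phi> \<omega>) * exp (- 1 / 2))"
    proof -
      have "(\<Sum>\<omega>\<in>A. f \<omega> * f (\<phi> \<omega>) * exp (- 1 / 2)) = (\<Sum>\<omega>\<in>A. (f \<omega>)\<^sup>2 * (exp (- 1 / 2) / sqrt (real (card (G i)))))"
        by (intro sum.cong) (auto simp: f\<phi> power2_eq_square)
      also have "\<dots> = (\<Sum>\<omega>\<in>A. (f \<omega>)\<^sup>2) * (exp (- 1 / 2) / sqrt (real (card (G i))))"
        by (rule sum_distrib_right[symmetric])
      finally show ?thesis by (simp add: A2)
    qed
    also have "\<dots> \<le> (\<Sum>\<omega>\<in>A. f \<omega> * f (\<phi> \<omega>) * exp (- (\<tau> * ln (real p) + of_int (b \<omega> - b (\<phi> \<omega>)))\<^sup>2 / 2))"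
      by (intro sum_mono mult_left_mono close mult_nonneg_nonneg f0)
    also have "\<dots> = (\<Sum>(j, k)\<in>J \<times> J. \<Sum>\<omega>\<in>{\<omega>\<in>A. (b \<omega>, b (\<phi> \<omega>)) = (j, k)}.
        f \<omega> * f (\<phi> \<omega>) * exp (- (\<tau> * ln (real p) + of_int (b \<omega> - b (\<phi> \<omega>)))\<^sup>2 / 2))"
      unfolding case_prod_beta prod.collapse
      by (rule sum.group[symmetric]) (use finA fin\<Omega> \<phi>\<Omega> in \<open>auto simp: J_def A_def\<close>)
    also have "\<dots> = (\<Sum>(j, k)\<in>J \<times> J. (\<Sum>\<omega>\<in>Ajk j k. f \<omega> * f (\<phi> \<omega>)) * exp (- (\<tau> * ln (real p) + of_int (j - k))\<^sup>2 / 2))"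
      unfolding sum_distrib_right by (intro sum.cong) (auto simp: Ajk_def)
    also have "\<dots> \<le> (\<Sum>(j, k)\<in>J \<times> J. r j * r k * exp (- (\<tau> * ln (real p) + of_int (j - k))\<^sup>2 / 2))"
      by (intro sum_mono) (auto intro!: mult_right_mono cs)
    also have "\<dots> = (\<Sum>j\<in>J. \<Sum>k\<in>J. r j * r k * exp (- (\<tau> * ln (real p) + of_int (j - k))\<^sup>2 / 2))"
      by (rule sum.cartesian_product[symmetric])
    finally show ?thesis .
  qed
  show ?thesis
    using fin\<Omega> cardJ rsum gain by (intro exI[of _ J] exI[of _ r]) (auto simp: J_def r_def)
qed

section \<open>Gaussian integrals and the resonance inequality\<close>

lemma gauss_fourier:
  fixes H \<kappa> :: real
  assumes H: "H > 0"
  shows "has_bochner_integral lborel (\<lambda>u. exp (- (H * u\<^sup>2 / 2)) *\<^sub>R cis (\<kappa> * u))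
    (of_real (sqrt (2 * pi / H) * exp (- (\<kappa>\<^sup>2 / (2 * H)))))"
proof -
  define t where "t = \<kappa> / sqrt H"
  let ?g = "\<lambda>x. std_normal_density x *\<^sub>R cis (t * x)"
  interpret real_distribution std_normal_distribution by (rule real_dist_normal_dist)
  have cm: "(\<lambda>x. cis (t * x)) \<in> borel_measurable borel"
    by (intro borel_measurable_continuous_onI continuous_intros)
  have int1: "integrable std_normal_distribution (\<lambda>x. cis (t * x))"
    using cm by (intro integrable_const_bound[where B = 1]) auto
  have int2: "integrable lborel ?g"
    using int1 cm by (subst (asm) integrable_density) auto
  have "complex_of_real (exp (- (t\<^sup>2) / 2)) = (\<integral>x. cis (t * x) \<partial>std_normal_distribution)"
    using fun_cong[OF char_std_normal_distribution, of t] by (simp add: char_def cis_conv_exp mult_ac)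
  also have "\<dots> = (\<integral>x. ?g x \<partial>lborel)" by (rule integral_density) (use cm in auto)
  finally have hb: "has_bochner_integral lborel ?g (of_real (exp (- (t\<^sup>2) / 2)))"
    using int2 by (simp add: has_bochner_integral_iff)
  have sH: "sqrt H \<noteq> 0" using H by simp
  have "has_bochner_integral lborel (\<lambda>u. ?g (0 + sqrt H * u)) (of_real (exp (- (t\<^sup>2) / 2)) /\<^sub>R \<bar>sqrt H\<bar>)"
    by (rule lborel_has_bochner_integral_real_affine_iff[THEN iffD1, OF sH hb])
  from has_bochner_integral_scaleR_right[OF this, of "sqrt (2 * pi)"]
  have "has_bochner_integral lborel (\<lambda>u. sqrt (2 * pi) *\<^sub>R ?g (0 + sqrt H * u))
     (sqrt (2 * pi) *\<^sub>R (of_real (exp (- (t\<^sup>2) / 2)) /\<^sub>R \<bar>sqrt H\<bar>))" by simp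
  also have "(\<lambda>u. sqrt (2 * pi) *\<^sub>R ?g (0 + sqrt H * u)) = (\<lambda>u. exp (- (H * u\<^sup>2 / 2)) *\<^sub>R cis (\<kappa> * u))"
    using H by (auto simp: std_normal_density_def t_def power_mult_distrib fun_eq_iff)
  also have "sqrt (2 * pi) *\<^sub>R (of_real (exp (- (t\<^sup>2) / 2)) /\<^sub>R \<bar>sqrt H\<bar>) =
      (of_real (sqrt (2 * pi / H) * exp (- (\<kappa>\<^sup>2 / (2 * H)))) :: complex)"
    using H by (simp add: t_def power_divide real_sqrt_divide scaleR_conv_of_real divide_simps)
  finally show ?thesis .
qed

text \<open>The value does not depend on \<open>y\<close>. No contour is moved: the imaginary shift
  becomes a real factor and a new frequency, and the exponents recombine after
  \<open>gauss_fourier\<close> is applied.\<close>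

lemma gauss_shift:
  fixes H y \<mu> :: real
  assumes H: "H > 0"
  shows "has_bochner_integral lborel
    (\<lambda>u. exp (- (of_real H * (of_real u - \<i> * of_real y)\<^sup>2 / 2) + \<i> * of_real \<mu> * (of_real u - \<i> * of_real y)))
    (of_real (sqrt (2 * pi / H) * exp (- (\<mu>\<^sup>2 / (2 * H)))))"
proof -
  let ?c = "exp (H * y\<^sup>2 / 2 + \<mu> * y)"
  have eq1: "exp (- (of_real H * (of_real u - \<i> * of_real y)\<^sup>2 / 2) + \<i> * of_real \<mu> * (of_real u - \<i> * of_real y)) =
      of_real ?c * (exp (- (H * u\<^sup>2 / 2)) *\<^sub>R cis ((H * y + \<mu>) * u))" for u
  proof -
    have "- (of_real H * (of_real u - \<i> * of_real y)\<^sup>2 / 2) + \<i> * of_real \<mu> * (of_real u - \<i> * of_real y) =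
      of_real (H * y\<^sup>2 / 2 + \<mu> * y) + (of_real (- (H * u\<^sup>2 / 2)) + \<i> * of_real ((H * y + \<mu>) * u) :: complex)"
      by (simp add: field_simps power2_eq_square)
    then show ?thesis
      by (simp only: exp_add exp_of_real cis_conv_exp scaleR_conv_of_real mult.assoc)
  qed
  have eq2: "of_real ?c * of_real (sqrt (2 * pi / H) * exp (- ((H * y + \<mu>)\<^sup>2 / (2 * H)))) =
      (of_real (sqrt (2 * pi / H) * exp (- (\<mu>\<^sup>2 / (2 * H)))) :: complex)"
  proof -
    have "(H * y\<^sup>2 / 2 + \<mu> * y) + - ((H * y + \<mu>)\<^sup>2 / (2 * H)) = - (\<mu>\<^sup>2 / (2 * H))"
      using H by (simp add: field_simps power2_eq_square)
    then have "?c * exp (- ((H * y + \<mu>)\<^sup>2 / (2 * H))) = exp (- (\<mu>\<^sup>2 / (2 * H)))"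
      by (simp only: exp_add[symmetric])
    then have "?c * (sqrt (2 * pi / H) * exp (- ((H * y + \<mu>)\<^sup>2 / (2 * H)))) =
        sqrt (2 * pi / H) * exp (- (\<mu>\<^sup>2 / (2 * H)))" by (metis mult.left_commute)
    then show ?thesis by (simp only: of_real_mult[symmetric])
  qed
  show ?thesis
    unfolding eq1 eq2[symmetric]
    by (intro has_bochner_integral_mult_right gauss_fourier H)
qed

lemma gauss_cos:
  fixes \<tau> \<kappa> :: real
  assumes "\<tau> > 0"
  shows "has_bochner_integral lborel (\<lambda>t. exp (- (t\<^sup>2 / (2 * \<tau>\<^sup>2))) * cos (\<kappa> * t))
    (sqrt (2 * pi) * \<tau> * exp (- ((\<tau> * \<kappa>)\<^sup>2 / 2)))"
proof -
  have "has_bochner_integral lborel (\<lambda>u. Re (exp (- (1 / \<tau>\<^sup>2 * u\<^sup>2 / 2)) *\<^sub>R cis (\<kappa> * u)))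
    (Re (of_real (sqrt (2 * pi / (1 / \<tau>\<^sup>2)) * exp (- (\<kappa>\<^sup>2 / (2 * (1 / \<tau>\<^sup>2)))))))"
    using assms by (intro has_bochner_integral_Re gauss_fourier) simp
  then show ?thesis using assms by (simp add: real_sqrt_mult power_mult_distrib mult_ac)
qed

text \<open>The weight is even in \<open>t\<close>, so that the integral over the whole line, where all terms are
  nonnegative, is twice the integral over the positive half line. Partial sums are used in place of
  the series to avoid exchanging the sum with the integral.\<close>

lemma resonance_inequality:
  fixes J :: "int set" and r :: "int \<Rightarrow> real" and b :: "nat \<Rightarrow> real"
  assumes J: "finite J" "real (card J) \<le> N" and r: "(\<Sum>j\<in>J. (r j)\<^sup>2) = 1" "\<And>j. r j \<ge> 0"
    and \<tau>: "\<tau> > 0" and b: "\<And>n. b n \<ge> 0" "summable b" and F: "finite F" and V: "V \<ge> 0"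
    and T: "0 \<le> T1" "0 \<le> T2"
    and D: "\<And>t. T1 \<le> t \<Longrightarrow> t \<le> T2 \<Longrightarrow> (\<Sum>n. b n * cos (t * ln (real n))) \<le> V"
  shows "(\<Sum>n\<in>F. b n * (\<Sum>j\<in>J. \<Sum>k\<in>J. r j * r k * exp (- (\<tau> * ln (real n) + of_int (j - k))\<^sup>2 / 2)))
    \<le> 6 * V + suminf b * N * (T1 / \<tau> + 2 * exp (- (T2\<^sup>2 / (4 * \<tau>\<^sup>2))))"
proof -
  define a where "a j k = of_int (j - k) / \<tau>" for j k :: int
  \<comment> \<open>The squared modulus of
    \<open>\<Sum>j\<in>J. r j * exp (\<i> * j * t / \<tau>)\<close>, expanded into a real double
    sum.\<close>
  define R where "R t = (\<Sum>j\<in>J. \<Sum>k\<in>J. r j * r k * cos (a j k * t))" for t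
  define w where "w t = R t * exp (- (t\<^sup>2 / (2 * \<tau>\<^sup>2)))" for t
  \<comment> \<open>Up to the factor \<open>sqrt (2 * pi) * \<tau>\<close> this is the cosine
    transform of \<open>w\<close> at \<open>\<nu>\<close>.\<close>
  define C where "C \<nu> = (\<Sum>j\<in>J. \<Sum>k\<in>J. r j * r k * exp (- (\<tau> * \<nu> + of_int (j - k))\<^sup>2 / 2))" for \<nu>
  have Rsq: "R t = (\<Sum>j\<in>J. r j * cos (of_int j / \<tau> * t))\<^sup>2 + (\<Sum>j\<in>J. r j * sin (of_int j / \<tau> * t))\<^sup>2" for t
    unfolding R_def power2_eq_square sum_product sum.distrib[symmetric]
    by (intro sum.cong) (auto simp: a_def cos_diff diff_divide_distrib left_diff_distrib algebra_simps)
  have R0: "R t \<ge> 0" for t unfolding Rsq by simp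
  have RN: "R t \<le> N" for t
  proof -
    have "R t \<le> (\<Sum>j\<in>J. \<Sum>k\<in>J. r j * r k * 1)" unfolding R_def
      by (intro sum_mono mult_left_mono mult_nonneg_nonneg r) auto
    also have "\<dots> = (\<Sum>j\<in>J. r j)\<^sup>2" by (simp add: power2_eq_square sum_product)
    also have "\<dots> \<le> (\<Sum>j\<in>J. (r j)\<^sup>2) * card J" by (rule sum_squared_le_sum_of_squares)
    finally show ?thesis using r J by simp
  qed
  have C0: "C \<nu> \<ge> 0" for \<nu> unfolding C_def by (intro sum_nonneg mult_nonneg_nonneg r) auto
  \<comment> \<open>Antisymmetry in \<open>j\<close> and \<open>k\<close>; it removes the sine part
    when \<open>cos (\<nu> * t)\<close> is multiplied out.\<close>
  have odd: "(\<Sum>j\<in>J. \<Sum>k\<in>J. r j * r k * sin (a j k * t)) = 0" for t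
  proof -
    have "(\<Sum>j\<in>J. \<Sum>k\<in>J. r j * r k * sin (a j k * t)) = (\<Sum>k\<in>J. \<Sum>j\<in>J. r j * r k * sin (a j k * t))"
      by (rule sum.swap)
    also have "\<dots> = (\<Sum>k\<in>J. \<Sum>j\<in>J. - (r k * r j * sin (a k j * t)))"
    proof (intro sum.cong refl)
      fix j k :: int
      have "a j k = - a k j" unfolding a_def minus_divide_left by simp
      then have "a j k * t = - (a k j * t)" by simp
      then show "r j * r k * sin (a j k * t) = - (r k * r j * sin (a k j * t))" by simp
    qed
    also have "\<dots> = - (\<Sum>j\<in>J. \<Sum>k\<in>J. r j * r k * sin (a j k * t))" by (simp add: sum_negf)
    finally show ?thesis by simp
  qed
  have hw: "has_bochner_integral lborel (\<lambda>t. cos (\<nu> * t) * w t) (sqrt (2 * pi) * \<tau> * C \<nu>)" for \<nu>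
  proof -
    have "cos (\<nu> * t) * w t = (\<Sum>j\<in>J. \<Sum>k\<in>J. r j * r k * (exp (- (t\<^sup>2 / (2 * \<tau>\<^sup>2))) * cos ((\<nu> + a j k) * t)))" for t
    proof -
      have "(\<Sum>j\<in>J. \<Sum>k\<in>J. r j * r k * cos ((\<nu> + a j k) * t)) =
          cos (\<nu> * t) * R t - sin (\<nu> * t) * (\<Sum>j\<in>J. \<Sum>k\<in>J. r j * r k * sin (a j k * t))"
        unfolding R_def sum_distrib_left sum_subtractf[symmetric]
        by (intro sum.cong) (auto simp: cos_add distrib_right algebra_simps)
      then have "cos (\<nu> * t) * w t = (\<Sum>j\<in>J. \<Sum>k\<in>J. r j * r k * cos ((\<nu> + a j k) * t)) * exp (- (t\<^sup>2 / (2 * \<tau>\<^sup>2)))"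
        unfolding odd w_def by simp
      also have "\<dots> = (\<Sum>j\<in>J. \<Sum>k\<in>J. r j * r k * (exp (- (t\<^sup>2 / (2 * \<tau>\<^sup>2))) * cos ((\<nu> + a j k) * t)))"
        unfolding sum_distrib_right by (intro sum.cong refl) (simp only: mult_ac)
      finally show ?thesis .
    qed
    moreover have "has_bochner_integral lborel
       (\<lambda>t. \<Sum>j\<in>J. \<Sum>k\<in>J. r j * r k * (exp (- (t\<^sup>2 / (2 * \<tau>\<^sup>2))) * cos ((\<nu> + a j k) * t)))
       (\<Sum>j\<in>J. \<Sum>k\<in>J. r j * r k * (sqrt (2 * pi) * \<tau> * exp (- ((\<tau> * (\<nu> + a j k))\<^sup>2 / 2))))"
      by (intro has_bochner_integral_sum has_bochner_integral_mult_right gauss_cos \<tau>)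
    moreover have "(\<Sum>j\<in>J. \<Sum>k\<in>J. r j * r k * (sqrt (2 * pi) * \<tau> * exp (- ((\<tau> * (\<nu> + a j k))\<^sup>2 / 2)))) =
        sqrt (2 * pi) * \<tau> * C \<nu>"
      unfolding C_def sum_distrib_left using \<tau> by (intro sum.cong) (auto simp: a_def distrib_left)
    ultimately show ?thesis by simp
  qed
  \<comment> \<open>The total mass of the weight: \<open>r j * r k\<close> is split by the
    arithmetic-geometric mean inequality, and near orthogonality of the bins is applied to both
    halves.\<close>
  have C1: "C 0 \<le> 6"
  proof -
    have "C 0 \<le> (\<Sum>j\<in>J. \<Sum>k\<in>J. ((r j)\<^sup>2 / 2 + (r k)\<^sup>2 / 2) * exp (- (of_int (j - k))\<^sup>2 / 2))"
      unfolding C_def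
    proof (intro sum_mono)
      fix j k
      have "r j * r k \<le> (r j)\<^sup>2 / 2 + (r k)\<^sup>2 / 2" using sum_squares_bound[of "r j" "r k"] by simp
      then show "r j * r k * exp (- (\<tau> * 0 + of_int (j - k))\<^sup>2 / 2) \<le>
          ((r j)\<^sup>2 / 2 + (r k)\<^sup>2 / 2) * exp (- (of_int (j - k))\<^sup>2 / 2)"
        by (simp add: mult_right_mono)
    qed
    also have "\<dots> = (\<Sum>j\<in>J. \<Sum>k\<in>J. (r j)\<^sup>2 / 2 * exp (- (of_int (j - k))\<^sup>2 / 2)) +
        (\<Sum>j\<in>J. \<Sum>k\<in>J. (r k)\<^sup>2 / 2 * exp (- (of_int (j - k))\<^sup>2 / 2))"
      by (simp add: distrib_right sum.distrib)
    also have "(\<Sum>j\<in>J. \<Sum>k\<in>J. (r k)\<^sup>2 / 2 * exp (- (of_int (j - k))\<^sup>2 / 2)) =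
        (\<Sum>k\<in>J. \<Sum>j\<in>J. (r k)\<^sup>2 / 2 * exp (- (of_int (k - j))\<^sup>2 / 2))"
      by (subst sum.swap) (simp add: power2_commute)
    also have "(\<Sum>j\<in>J. \<Sum>k\<in>J. (r j)\<^sup>2 / 2 * exp (- (of_int (j - k))\<^sup>2 / 2)) + \<dots> =
        (\<Sum>j\<in>J. (r j)\<^sup>2 * (\<Sum>k\<in>J. exp (- (of_int (j - k))\<^sup>2 / 2)))"
      by (simp add: sum.distrib[symmetric] sum_distrib_left)
    also have "\<dots> \<le> (\<Sum>j\<in>J. (r j)\<^sup>2 * 6)"
      by (intro sum_mono mult_left_mono sum_exp_neg_square_le J) auto
    also have "\<dots> = 6" using r by (simp add: sum_distrib_right[symmetric])
    finally show ?thesis .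
  qed
  define Bs where "Bs = suminf b"
  have Bs: "Bs \<ge> 0" unfolding Bs_def using b by (intro suminf_nonneg)
  define Er where "Er = Bs * N * (T1 / \<tau> + 2 * exp (- (T2\<^sup>2 / (4 * \<tau>\<^sup>2))))"
  have N: "N \<ge> 0" using R0[of 0] RN[of 0] by linarith
  have sums: "summable (\<lambda>n. b n * cos (t * ln (real n)))" for t
    by (rule summable_comparison_test'[OF b(2)]) (use b in \<open>auto simp: abs_mult mult_left_le\<close>)
  have main: "(\<Sum>n\<in>F. b n * C (ln (real n))) \<le> 6 * (V + e) + Er" if e: "e > 0" for e
  proof -
    obtain M0 where M0: "\<And>M. M \<ge> M0 \<Longrightarrow> norm (\<Sum>n. b (n + M)) < e"
      using suminf_exist_split[OF e b(2)] by auto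
    obtain M1 where M1: "F \<subseteq> {..<M1}" using F by (metis finite_nat_bounded)
    define M where "M = max M0 M1"
    have FM: "F \<subseteq> {..<M}" using M1 by (auto simp: M_def)
    define DM where "DM t = (\<Sum>n<M. b n * cos (ln (real n) * t))" for t
    have DMBs: "DM t \<le> Bs" for t
    proof -
      have "DM t \<le> (\<Sum>n<M. b n * 1)" unfolding DM_def by (intro sum_mono mult_left_mono b) auto
      also have "\<dots> \<le> Bs" unfolding Bs_def using b by (simp add: sum_le_suminf)
      finally show ?thesis .
    qed
    have DMV: "DM t \<le> V + e" if t: "T1 \<le> t" "t \<le> T2" for t
    proof -
      let ?f = "\<lambda>n. b n * cos (t * ln (real n))"
      have "suminf ?f = (\<Sum>n. ?f (n + M)) + (\<Sum>n<M. ?f n)" by (rule suminf_split_initial_segment[OF sums])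
      moreover have "norm (\<Sum>n. ?f (n + M)) \<le> (\<Sum>n. b (n + M))"
        by (rule norm_suminf_le) (use b in \<open>auto simp: abs_mult mult_left_le summable_iff_shift\<close>)
      moreover have "norm (\<Sum>n. b (n + M)) < e" by (rule M0) (simp add: M_def)
      ultimately show ?thesis using D[OF t] by (simp add: DM_def mult.commute abs_less_iff abs_le_iff)
    qed
    \<comment> \<open>A majorant in three ranges: the hypothesis for
      \<open>T1 \<le> \<bar>t\<bar> \<le> T2\<close>, the trivial bounds \<open>Bs\<close> and
      \<open>N\<close> elsewhere. Beyond \<open>T2\<close> half of the Gaussian exponent is spent on
      the small constant, while the other half keeps the integral finite.\<close>
    define W where "W t = (V + e) * w t + Bs * N * (indicator {- T1..T1} t + exp (- (T2\<^sup>2 / (4 * \<tau>\<^sup>2))) * exp (- (t\<^sup>2 / (4 * \<tau>\<^sup>2))))" for t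
    have DW: "DM t * w t \<le> W t" for t
    proof -
      have w0: "w t \<ge> 0" and wN: "w t \<le> N * exp (- (t\<^sup>2 / (2 * \<tau>\<^sup>2)))"
        unfolding w_def using R0 RN by (auto intro!: mult_nonneg_nonneg mult_right_mono)
      have Ve: "(V + e) * w t \<ge> 0" using V e w0 by (intro mult_nonneg_nonneg) auto
      have BN: "Bs * N \<ge> 0" using Bs N by (rule mult_nonneg_nonneg)
      have P: "Bs * N * x \<ge> 0" if "x \<ge> 0" for x using BN that by (rule mult_nonneg_nonneg)
      have DB: "DM t * w t \<le> Bs * w t" by (intro mult_right_mono DMBs w0)
      consider "\<bar>t\<bar> \<le> T1" | "T1 \<le> \<bar>t\<bar>" "\<bar>t\<bar> \<le> T2" | "T2 < \<bar>t\<bar>" by linarith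
      then show ?thesis
      proof cases
        case 1
        have "N * exp (- (t\<^sup>2 / (2 * \<tau>\<^sup>2))) \<le> N * 1" using N by (intro mult_left_mono) auto
        then have "Bs * w t \<le> Bs * N" using Bs wN by (intro mult_left_mono) auto
        moreover have "indicator {- T1..T1} t = (1::real)" using 1 by (simp add: indicator_def abs_le_iff)
        ultimately show ?thesis using DB Ve P[of "exp (- (T2\<^sup>2 / (4 * \<tau>\<^sup>2))) * exp (- (t\<^sup>2 / (4 * \<tau>\<^sup>2)))"]
          unfolding W_def by (simp add: distrib_left)
      next
        case 2
        have "DM t = DM \<bar>t\<bar>" by (simp add: DM_def abs_if)
        then have "DM t * w t \<le> (V + e) * w t" using DMV[OF 2] w0 by (intro mult_right_mono) auto
        then show ?thesis unfolding W_def
          using P[of "indicator {- T1..T1} t + exp (- (T2\<^sup>2 / (4 * \<tau>\<^sup>2))) * exp (- (t\<^sup>2 / (4 * \<tau>\<^sup>2)))"]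
          by (simp add: indicator_def)
      next
        case 3
        have "T2\<^sup>2 \<le> \<bar>t\<bar>\<^sup>2" using 3 T by (intro power_mono) auto
        then have "T2\<^sup>2 / (4 * \<tau>\<^sup>2) \<le> t\<^sup>2 / (4 * \<tau>\<^sup>2)" by (intro divide_right_mono) auto
        moreover have "t\<^sup>2 / (2 * \<tau>\<^sup>2) = t\<^sup>2 / (4 * \<tau>\<^sup>2) + t\<^sup>2 / (4 * \<tau>\<^sup>2)" by simp
        ultimately have "exp (- (t\<^sup>2 / (2 * \<tau>\<^sup>2))) \<le> exp (- (T2\<^sup>2 / (4 * \<tau>\<^sup>2))) * exp (- (t\<^sup>2 / (4 * \<tau>\<^sup>2)))"
          unfolding exp_add[symmetric] by simp
        then have "w t \<le> N * (exp (- (T2\<^sup>2 / (4 * \<tau>\<^sup>2))) * exp (- (t\<^sup>2 / (4 * \<tau>\<^sup>2))))"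
          using wN N by (meson mult_left_mono order_trans)
        then have "Bs * w t \<le> Bs * (N * (exp (- (T2\<^sup>2 / (4 * \<tau>\<^sup>2))) * exp (- (t\<^sup>2 / (4 * \<tau>\<^sup>2)))))"
          using Bs by (rule mult_left_mono)
        moreover have "Bs * N * indicator {- T1..T1} t \<ge> 0" by (rule P) simp
        ultimately show ?thesis using DB Ve unfolding W_def by (simp add: distrib_left mult.assoc)
      qed
    qed
    have hD: "has_bochner_integral lborel (\<lambda>t. DM t * w t) (\<Sum>n<M. b n * (sqrt (2 * pi) * \<tau> * C (ln (real n))))"
    proof -
      have "(\<lambda>t. DM t * w t) = (\<lambda>t. \<Sum>n<M. b n * (cos (ln (real n) * t) * w t))"
        by (simp add: DM_def sum_distrib_right mult.assoc)
      then show ?thesis by (simp only:) (intro has_bochner_integral_sum has_bochner_integral_mult_right hw)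
    qed
    have g4: "has_bochner_integral lborel (\<lambda>t. exp (- (t\<^sup>2 / (4 * \<tau>\<^sup>2)))) (2 * sqrt pi * \<tau>)"
      using gauss_cos[of "sqrt 2 * \<tau>" 0] \<tau> by (simp add: power_mult_distrib real_sqrt_mult mult_ac)
    have hi: "has_bochner_integral lborel (indicator {- T1..T1} :: real \<Rightarrow> real) (2 * T1)"
      using has_bochner_integral_real_indicator[of "{- T1..T1}" lborel] T by simp
    have hW: "has_bochner_integral lborel W ((V + e) * (sqrt (2 * pi) * \<tau> * C 0) +
        Bs * N * (2 * T1 + exp (- (T2\<^sup>2 / (4 * \<tau>\<^sup>2))) * (2 * sqrt pi * \<tau>)))"
      unfolding W_def using hw[of 0]
      by (intro has_bochner_integral_add has_bochner_integral_mult_right hi g4) simp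
    have "(\<Sum>n<M. b n * (sqrt (2 * pi) * \<tau> * C (ln (real n)))) \<le> (V + e) * (sqrt (2 * pi) * \<tau> * C 0) +
        Bs * N * (2 * T1 + exp (- (T2\<^sup>2 / (4 * \<tau>\<^sup>2))) * (2 * sqrt pi * \<tau>))"
      using integral_mono[OF integrable.intros[OF hD] integrable.intros[OF hW] DW]
      unfolding has_bochner_integral_integral_eq[OF hD] has_bochner_integral_integral_eq[OF hW] .
    also have "\<dots> \<le> (V + e) * (sqrt (2 * pi) * \<tau> * 6) + sqrt (2 * pi) * \<tau> * Er"
    proof (intro add_mono mult_left_mono C1)
      have s2: "sqrt (2 * pi) \<ge> 2" using pi_ge_two by (intro real_le_rsqrt) simp
      have h1: "2 * T1 \<le> sqrt (2 * pi) * T1" using s2 T by (intro mult_right_mono)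
      have "2 * sqrt pi \<le> sqrt (2 * pi) * 2"
      proof -
        have "sqrt pi \<le> sqrt (2 * pi)" by simp
        then show ?thesis by linarith
      qed
      then have h2: "exp (- (T2\<^sup>2 / (4 * \<tau>\<^sup>2))) * (2 * sqrt pi * \<tau>) \<le> exp (- (T2\<^sup>2 / (4 * \<tau>\<^sup>2))) * (sqrt (2 * pi) * 2 * \<tau>)"
        using \<tau> by (intro mult_left_mono mult_right_mono) auto
      have "2 * T1 + exp (- (T2\<^sup>2 / (4 * \<tau>\<^sup>2))) * (2 * sqrt pi * \<tau>) \<le>
          sqrt (2 * pi) * \<tau> * (T1 / \<tau> + 2 * exp (- (T2\<^sup>2 / (4 * \<tau>\<^sup>2))))"
        using add_mono[OF h1 h2] \<tau> by (simp add: distrib_left mult_ac)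
      from mult_left_mono[OF this mult_nonneg_nonneg[OF Bs N]]
      show "Bs * N * (2 * T1 + exp (- (T2\<^sup>2 / (4 * \<tau>\<^sup>2))) * (2 * sqrt pi * \<tau>)) \<le> sqrt (2 * pi) * \<tau> * Er"
        unfolding Er_def by (simp add: mult_ac)
    qed (use V e \<tau> in auto)
    also have "\<dots> = sqrt (2 * pi) * \<tau> * (6 * (V + e) + Er)" by (simp add: algebra_simps)
    also have "(\<Sum>n<M. b n * (sqrt (2 * pi) * \<tau> * C (ln (real n)))) = sqrt (2 * pi) * \<tau> * (\<Sum>n<M. b n * C (ln (real n)))"
      by (simp add: sum_distrib_left mult_ac)
    finally have "(\<Sum>n<M. b n * C (ln (real n))) \<le> 6 * (V + e) + Er"
      using \<tau> by (subst (asm) mult_le_cancel_left_pos) auto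
    \<comment> \<open>Nonnegativity of all terms allows everything outside \<open>F\<close> to be
      dropped.\<close>
    moreover have "(\<Sum>n\<in>F. b n * C (ln (real n))) \<le> (\<Sum>n<M. b n * C (ln (real n)))"
      by (intro sum_mono2 FM) (auto intro!: mult_nonneg_nonneg b C0)
    ultimately show ?thesis by linarith
  qed
  have "(\<Sum>n\<in>F. b n * C (ln (real n))) \<le> 6 * V + Er"
  proof (rule field_le_epsilon)
    fix e :: real assume "e > 0"
    then show "(\<Sum>n\<in>F. b n * C (ln (real n))) \<le> 6 * V + Er + e" using main[of "e / 6"] by simp
  qed
  then show ?thesis by (simp add: C_def Er_def Bs_def)
qed

section \<open>Primes and the choice of the groups\<close>

lemma Lcm_upto_pos: "Lcm {1..n::nat} > 0"
proof -
  have "Lcm {1..n} \<noteq> 0" by (subst Lcm_0_iff) auto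
  then show ?thesis by (simp only: neq0_conv)
qed

text \<open>The entries \<open>1 / (k * (n choose k))\<close> of the Leibniz harmonic triangle are integer
  combinations of \<open>1, 1/2, \<dots>, 1/n\<close>.\<close>

lemma leibniz_triangle_dvd:
  assumes "Suc m \<le> n"
  shows "Suc m * (n choose Suc m) dvd Lcm {1..n}"
  using assms
proof (induction m arbitrary: n)
  case 0
  then show ?case by (auto intro!: dvd_Lcm)
next
  case (Suc m)
  define d where "d = Lcm {1..n}"
  obtain n' where n: "n = Suc n'" using Suc.prems by (cases n) auto
  define x y where "x = n' choose m" and "y = n' choose Suc m"
  have 1: "Suc m * (n choose Suc m) dvd d" unfolding d_def using Suc.prems by (intro Suc.IH) auto
  have "Suc m * y dvd Lcm {1..n'}" unfolding y_def using Suc.prems n by (intro Suc.IH) auto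
  also have "Lcm {1..n'} dvd d" unfolding d_def n by (intro Lcm_subset) auto
  finally have 2: "Suc m * y dvd d" .
  have c1: "Suc m * (n choose Suc m) = n * x"
    using times_binomial_minus1_eq[of "Suc m" n] by (simp add: n x_def)
  have c2: "Suc (Suc m) * (n choose Suc (Suc m)) = n * y"
    using times_binomial_minus1_eq[of "Suc (Suc m)" n] by (simp add: n y_def)
  have c3: "Suc m * y = (n' - m) * x"
    using times_binomial_minus1_eq[of "Suc m" n'] binomial_absorb_comp[of n' m] by (simp add: x_def y_def)
  obtain a where a: "d = n * x * a" using 1 unfolding c1 by (auto elim: dvdE)
  obtain b where b: "d = Suc m * y * b" using 2 by (auto elim: dvdE)
  have "int (Suc m) * (int n * int y * (int b - int a)) = int n * int (Suc m * y * b) - int (Suc m * y) * int n * int a"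
    by (simp add: algebra_simps)
  also have "\<dots> = int n * int d - int (n' - m) * int (n * x * a)"
    unfolding b[symmetric] unfolding c3 by (simp only: of_nat_mult mult_ac)
  also have "\<dots> = (int n - int (n' - m)) * int d"
    unfolding a[symmetric] by (simp add: algebra_simps)
  also have "int n - int (n' - m) = int (Suc m)" using Suc.prems n by (simp add: of_nat_diff)
  finally have "int n * int y * (int b - int a) = int d" by (subst (asm) mult_left_cancel) auto
  then have "int (n * y) dvd int d" by (metis dvd_triv_left of_nat_mult)
  then have "n * y dvd d" by (subst (asm) int_dvd_int_iff)
  then show ?case unfolding c2 d_def .
qed

text \<open>The largest power of a prime \<open>p\<close> dividing one of the numbers up to
  \<open>n\<close> is itself at most \<open>n\<close>, so each prime contributes a factor of at most
  \<open>n\<close>.\<close>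

lemma Lcm_upto_le: "Lcm {1..n::nat} \<le> n ^ card {p. prime p \<and> p \<le> n}"
proof (cases "n = 0")
  case False
  define P where "P = {p. prime p \<and> p \<le> n}"
  define e where "e p = (GREATEST k. p ^ k \<le> n)" for p
  have e: "p ^ e p \<le> n" "\<And>k. p ^ k \<le> n \<Longrightarrow> k \<le> e p" if p: "p \<in> P" for p
  proof -
    have b: "k \<le> n" if "p ^ k \<le> n" for k
    proof -
      have "k < 2 ^ k" by (rule less_exp)
      also have "2 ^ k \<le> p ^ k" using p prime_ge_2_nat by (intro power_mono) (auto simp: P_def)
      finally show ?thesis using that by linarith
    qed
    show "p ^ e p \<le> n" unfolding e_def
      by (rule GreatestI_nat[where k = 0 and b = n]) (use False b in auto)
    show "k \<le> e p" if "p ^ k \<le> n" for k unfolding e_def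
      by (rule Greatest_le_nat[where b = n]) (use that b in auto)
  qed
  have fin: "finite P" unfolding P_def by (rule finite_subset[of _ "{..n}"]) auto
  have "Lcm {1..n} dvd (\<Prod>p\<in>P. p ^ e p)"
  proof (rule Lcm_least)
    fix m assume m: "m \<in> {1..n}"
    then have "m = (\<Prod>p\<in>prime_factors m. p ^ multiplicity p m)"
      using prod_prime_factors[of m] by simp
    also have "\<dots> dvd (\<Prod>p\<in>P. p ^ e p)"
    proof (rule prod_dvd_prod_subset2[OF fin])
      show "prime_factors m \<subseteq> P"
        using m by (auto simp: P_def in_prime_factors_iff dest!: dvd_imp_le)
      fix p assume p: "p \<in> prime_factors m"
      have "p ^ multiplicity p m \<le> m" using m by (intro dvd_imp_le multiplicity_dvd) auto
      then have "multiplicity p m \<le> e p"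
        using m p \<open>prime_factors m \<subseteq> P\<close> by (intro e(2)) auto
      then show "p ^ multiplicity p m dvd p ^ e p" by (rule le_imp_power_dvd)
    qed
    finally show "m dvd (\<Prod>p\<in>P. p ^ e p)" .
  qed
  moreover have "(\<Prod>p\<in>P. p ^ e p) > 0" by (intro prod_pos) (auto simp: P_def prime_gt_0_nat)
  ultimately have "Lcm {1..n} \<le> (\<Prod>p\<in>P. p ^ e p)" by (rule dvd_imp_le)
  also have "\<dots> \<le> (\<Prod>p\<in>P. n)" by (intro prod_mono) (use e in auto)
  finally show ?thesis by (simp add: P_def)
next
  case True
  then have "{p. prime p \<and> p \<le> n} = {}" by auto
  then have "n ^ card {p. prime p \<and> p \<le> n} = 1" by simp
  moreover have "Lcm {1..n} = 1" using True by simp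
  ultimately show ?thesis by linarith
qed

text \<open>The number \<open>m * (2 * m choose m)\<close>, of size at least
  \<open>4 ^ m / 2\<close>, divides the least common multiple of the numbers up to
  \<open>2 * m\<close>, which is at most a power of \<open>2 * m\<close> with the number of primes
  as exponent. The 8 comes from \<open>m \<ge> x / 4\<close> and
  \<open>ln 2 \<ge> 1/2\<close>.\<close>

lemma chebyshev_lower:
  fixes x :: real
  assumes x: "x \<ge> 2"
  shows "real (card {p::nat. prime p \<and> real p \<le> x}) \<ge> x / (8 * ln x)"
proof -
  define m where "m = nat \<lfloor>x / 2\<rfloor>"
  have m1: "m \<ge> 1" using x by (simp add: m_def le_nat_iff)
  have "x / 2 < real m + 1" "real m \<le> x / 2" using x unfolding m_def by linarith+
  then have m2: "real (2 * m) \<le> x" "real m \<ge> x / 4" using m1 by auto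
  define c where "c = card {p::nat. prime p \<and> p \<le> 2 * m}"
  have "4 ^ m / 2 \<le> real m * real ((2 * m) choose m)"
    using central_binomial_lower_bound[of m] m1 by (simp add: field_simps)
  also have "\<dots> \<le> real (Lcm {1..2 * m})"
  proof -
    have "m * ((2 * m) choose m) dvd Lcm {1..2 * m}"
      using leibniz_triangle_dvd[of "m - 1" "2 * m"] m1 by simp
    then have "m * ((2 * m) choose m) \<le> Lcm {1..2 * m}" by (rule dvd_imp_le) (rule Lcm_upto_pos)
    then show ?thesis by (metis of_nat_le_iff of_nat_mult)
  qed
  also have "\<dots> \<le> real ((2 * m) ^ c)" unfolding c_def using Lcm_upto_le[of "2 * m"] by (subst of_nat_le_iff)
  also have "\<dots> \<le> x ^ c" unfolding of_nat_power using m2 by (intro power_mono) auto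
  finally have "ln (4 ^ m / 2) \<le> ln (x ^ c)" using x by (subst ln_le_cancel_iff) auto
  then have 1: "real m * ln 4 - ln 2 \<le> real c * ln x" using x by (simp add: ln_div ln_realpow)
  have ln4: "ln (4::real) = 2 * ln 2" using ln_realpow[of 2 2] by simp
  have ln2: "ln (2::real) \<ge> 1/2" using ln2_ge_two_thirds by linarith
  have "x / 8 \<le> real m * (1/2)" using m2 by simp
  also have "\<dots> \<le> real m * ln 2" using ln2 by (intro mult_left_mono) auto
  also have "\<dots> \<le> real m * ln 2 + (real m - 1) * ln 2" using m1 ln2 by (intro le_add_same_cancel1[THEN iffD2] mult_nonneg_nonneg) auto
  also have "\<dots> = real m * ln 4 - ln 2" by (simp add: ln4 algebra_simps)
  also note 1
  also have "real c \<le> real (card {p::nat. prime p \<and> real p \<le> x})"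
    unfolding c_def of_nat_le_iff
  proof (rule card_mono)
    show "finite {p::nat. prime p \<and> real p \<le> x}"
      by (rule finite_subset[of _ "{..nat \<lfloor>x\<rfloor>}"]) (auto simp: le_nat_floor)
  qed (use m2 in \<open>auto dest!: of_nat_mono[where ?'a = real]\<close>)
  finally show ?thesis using x by (simp add: field_simps mult_right_mono)
qed

lemma infinite_primes_gt: "infinite {p::nat. prime p \<and> p > Y}"
proof -
  have "infinite ({p::nat. prime p} - {..Y})" using primes_infinite by (intro Diff_infinite_finite) auto
  also have "{p::nat. prime p} - {..Y} = {p::nat. prime p \<and> p > Y}" by auto
  finally show ?thesis .
qed

text \<open>If the prime of index \<open>m\<close> above \<open>Y\<close> (indices start at 0)
  exceeded \<open>x\<close>, all primes up to \<open>x\<close> would be among the numbers up to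
  \<open>Y\<close> and the \<open>m\<close> earlier primes.\<close>

lemma enumerate_primes_le:
  fixes x :: real
  defines "S Y \<equiv> {p::nat. prime p \<and> p > Y}"
  assumes c: "real (card {p::nat. prime p \<and> real p \<le> x}) > real (m + Y)"
  shows "real (enumerate (S Y) m) \<le> x"
proof (rule ccontr)
  assume n: "\<not> real (enumerate (S Y) m) \<le> x"
  have inf: "infinite (S Y)" unfolding S_def by (rule infinite_primes_gt)
  have "{p::nat. prime p \<and> real p \<le> x} \<subseteq> {1..Y} \<union> enumerate (S Y) ` {..<m}"
  proof
    fix p :: nat assume p: "p \<in> {p. prime p \<and> real p \<le> x}"
    show "p \<in> {1..Y} \<union> enumerate (S Y) ` {..<m}"
    proof (cases "p \<le> Y")
      case True
      then show ?thesis using p prime_ge_1_nat by auto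
    next
      case False
      then have "p \<in> range (enumerate (S Y))" using p unfolding range_enumerate[OF inf] by (simp add: S_def)
      then obtain i where i: "p = enumerate (S Y) i" by auto
      have "enumerate (S Y) i < enumerate (S Y) m" using n p i by auto
      then have "i < m" using strict_mono_enumerate[OF inf] by (simp add: strict_mono_less)
      then show ?thesis using i by auto
    qed
  qed
  then have "card {p::nat. prime p \<and> real p \<le> x} \<le> card ({1..Y} \<union> enumerate (S Y) ` {..<m})"
    by (intro card_mono) auto
  also have "\<dots> \<le> card {1..Y} + card (enumerate (S Y) ` {..<m})" by (rule card_Un_le)
  also have "\<dots> \<le> Y + m" using card_image_le[of "{..<m}" "enumerate (S Y)"] by simp
  finally show False using c by linarith
qed

section \<open>Harmonic sums and the groups of primes\<close>

lemma harm_le_ln: "n > 0 \<Longrightarrow> harm n \<le> 1 + ln (real n)"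
  using decseqD[OF decseq_harm_diff_ln, of 0 "n - 1"] by (simp add: harm_expand)

lemma sum_inverse_squares_le: "(\<Sum>k=1..n. 1 / (real k)\<^sup>2) \<le> 2 - 1 / real n"
proof (induction n)
  case (Suc n)
  show ?case
  proof (cases "n = 0")
    case False
    have "1 / (real (Suc n))\<^sup>2 \<le> 1 / (real n * real (Suc n))"
      using False by (intro divide_left_mono) (auto simp: power2_eq_square)
    also have "\<dots> = 1 / real n - 1 / real (Suc n)" using False by (simp add: field_simps)
    finally show ?thesis using Suc.IH by simp
  qed auto
qed auto

text \<open>The modulus of \<open>n powr - s\<close> on the line \<open>Re s = 1/2 + 1/H\<close>,
  times the Gaussian which the sine in the kernel leaves around \<open>ln n = H\<close>. For large
  \<open>H\<close> and \<open>\<bar>ln n - H\<bar> \<le> 2 * sqrt H\<close> this is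
  \<open>n powr - (1/2)\<close> up to a constant factor.\<close>

definition smooth_weight :: "real \<Rightarrow> nat \<Rightarrow> real" where
  "smooth_weight H n = real n powr - (1/2 + 1/H) * exp (- ((ln (real n) - H)\<^sup>2 / (2 * H)))"

text \<open>Block \<open>k\<close> consists of primes of size about \<open>2 ^ k * Y * ln Y\<close>, split into about
  \<open>Y / (k\<^sup>2 * ln (ln Y))\<close> groups of \<open>k\<^sup>2 * ln (ln Y) * 2 ^ k\<close> primes. Each block contributes about
  \<open>sqrt (Y / (ln Y * ln (ln Y))) / k\<close> to the sum, and the logarithm of the number of choices of at
  most one prime per group is \<open>O(Y)\<close>.\<close>

lemma prime_groups_fixed:
  fixes \<kappa> Y :: real
  defines "H \<equiv> ln Y"
  assumes \<kappa>: "0 < \<kappa>" "\<kappa> \<le> 1" and Y: "Y \<ge> 1" and H4: "H \<ge> 4" and lnH: "ln H \<ge> 1"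
    and F2: "ln 100 + ln H \<le> sqrt H" and F3: "H * (ln H + 1) \<le> \<kappa> / 10 * Y"
  shows "\<exists>(I::(nat \<times> nat) set) G. finite I \<and> disjoint_family_on G I \<and>
      (\<forall>i\<in>I. finite (G i) \<and> G i \<noteq> {} \<and> (\<forall>p\<in>G i. prime p)) \<and>
      real (\<Prod>i\<in>I. card (G i) + 1) \<le> exp (\<kappa> * Y) \<and>
      (\<Sum>i\<in>I. \<Sum>p\<in>G i. smooth_weight H p / sqrt (real (card (G i)))) \<ge>
        \<kappa> / 10 * exp (- 4) / 80 * sqrt (Y * ln H / H)"
proof -
  \<comment> \<open>The logarithm of the number of choices comes out as
    \<open>c * Y * (8 + 2)\<close>, which is to be \<open>\<kappa> * Y\<close>.\<close>
  define c where "c = \<kappa> / 10"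
  \<comment> \<open>The number of dyadic blocks that fit into one standard deviation of the
    Gaussian.\<close>
  define K where "K = nat \<lfloor>sqrt H\<rfloor>"
  define l where "l = nat \<lceil>ln H\<rceil>"
  define Y0 where "Y0 = nat \<lceil>Y\<rceil>"
  define E where "E k = nat \<lfloor>c * Y / (real k ^ 2 * real l)\<rfloor>" for k
  define g where "g k = k\<^sup>2 * l * 2 ^ k" for k :: nat
  \<comment> \<open>Only primes above \<open>Y0 \<ge> Y\<close> are taken, so that
    \<open>ln p \<ge> H\<close> throughout.\<close>
  define S where "S = {p::nat. prime p \<and> p > Y0}"
  define q where "q = enumerate S"
  \<comment> \<open>Groups are intervals of indices in the enumeration of \<open>S\<close>. Block
    \<open>k\<close> stays within the indices from \<open>2 ^ k * Y0\<close> to below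
    \<open>2 ^ Suc k * Y0\<close>, which reduces disjointness to arithmetic.\<close>
  define B where "B = (\<lambda>(k, i). (\<lambda>j. 2 ^ k * Y0 + i * g k + j) ` {..<g k})"
  define G where "G = (\<lambda>x. q ` B x)"
  define I where "I = Sigma {1..K} (\<lambda>k. {..<E k})"
  have c: "0 < c" "c \<le> 1" using \<kappa> by (auto simp: c_def)
  have sH: "sqrt H \<ge> 2" using H4 real_le_rsqrt[of 2 H] by simp
  have K: "real K \<le> sqrt H" "sqrt H < real K + 1" "K \<ge> 1"
    using sH unfolding K_def by linarith+
  have l: "ln H \<le> real l" "real l \<le> ln H + 1" "l \<ge> 1" "real l \<le> 2 * ln H"
    using lnH unfolding l_def by linarith+
  have Y0: "Y \<le> real Y0" "real Y0 \<le> 2 * Y" "Y0 \<ge> 1" using Y unfolding Y0_def by linarith+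
  have infS: "infinite S" unfolding S_def by (rule infinite_primes_gt)
  have qS: "q n \<in> S" for n unfolding q_def by (rule enumerate_in_set[OF infS])
  have qinj: "inj q" unfolding q_def using strict_mono_enumerate[OF infS] by (rule strict_mono_imp_inj_on)
  have gpos: "g k > 0" if "k \<ge> 1" for k using that l by (simp add: g_def)
  have kH: "real k ^ 2 \<le> H" if "k \<in> {1..K}" for k
  proof -
    have "real k ^ 2 \<le> sqrt H ^ 2" using that K by (intro power_mono) auto
    then show ?thesis using H4 by simp
  qed
  have Eup: "real (E k) \<le> c * Y / (real k ^ 2 * real l)" for k
    unfolding E_def using c Y by (intro of_nat_floor) (auto intro!: divide_nonneg_nonneg)
  \<comment> \<open>\<open>F3\<close> makes the argument of the floor at least 1, so that rounding
    loses at most a factor 2.\<close>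
  have Elow: "real (E k) \<ge> c * Y / (2 * (real k ^ 2 * real l))" if "k \<in> {1..K}" for k
  proof -
    define u where "u = c * Y / (real k ^ 2 * real l)"
    have "real k ^ 2 * real l \<le> H * (ln H + 1)" using kH[OF that] l lnH H4 by (intro mult_mono) auto
    also have "\<dots> \<le> c * Y" using F3 by (simp add: c_def)
    finally have "u \<ge> 1" using that l by (simp add: u_def)
    then have "\<lfloor>u\<rfloor> \<ge> 1" by (simp add: le_floor_iff)
    then have "real (nat \<lfloor>u\<rfloor>) \<ge> 1" "real (nat \<lfloor>u\<rfloor>) > u - 1" by linarith+
    then have "real (nat \<lfloor>u\<rfloor>) \<ge> u / 2" by linarith
    then have "real (E k) \<ge> u / 2" unfolding E_def u_def[symmetric] .
    then show ?thesis by (simp add: u_def)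
  qed
  have Eg: "E k * g k \<le> 2 ^ k * Y0" if "k \<ge> 1" for k
  proof -
    have "real (E k * g k) \<le> c * Y / (real k ^ 2 * real l) * real (g k)"
      unfolding of_nat_mult by (intro mult_right_mono Eup) auto
    also have "\<dots> = c * Y * 2 ^ k" using that l by (simp add: g_def)
    also have "\<dots> \<le> 1 * real Y0 * 2 ^ k" using c Y Y0 by (intro mult_right_mono mult_mono) auto
    finally have "real (E k * g k) \<le> real (2 ^ k * Y0)" by (simp add: mult.commute)
    then show ?thesis by (subst (asm) of_nat_le_iff)
  qed
  have Bbound: "2 ^ k * Y0 \<le> n \<and> n < 2 ^ Suc k * Y0" if kiI: "(k, i) \<in> I" and nB: "n \<in> B (k, i)" for k i n
  proof -
    obtain j where j: "j < g k" "n = 2 ^ k * Y0 + i * g k + j" using nB by (auto simp: B_def)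
    have ki: "k \<ge> 1" "i < E k" using kiI by (auto simp: I_def)
    have "i * g k + j < Suc i * g k" using j by simp
    also have "\<dots> \<le> E k * g k" using ki by (intro mult_right_mono) auto
    also have "\<dots> \<le> 2 ^ k * Y0" using Eg ki by auto
    finally show ?thesis using j by (simp add: mult.commute)
  qed
  have Bdisj: "x = y" if x: "x \<in> I" "n \<in> B x" and y: "y \<in> I" "n \<in> B y" for x y n
  proof -
    obtain k i k' i' where xy: "x = (k, i)" "y = (k', i')" by fastforce
    have 1: "2 ^ k * Y0 \<le> n" "n < 2 ^ Suc k * Y0" "2 ^ k' * Y0 \<le> n" "n < 2 ^ Suc k' * Y0"
      using Bbound x y xy by blast+
    have "k = k'"
    proof (rule ccontr)
      have *: False if "a < b" "n < 2 ^ Suc a * Y0" "2 ^ b * Y0 \<le> n" for a b :: nat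
      proof -
        have "(2::nat) ^ Suc a \<le> 2 ^ b" using that(1) by (intro power_increasing) auto
        then have "2 ^ Suc a * Y0 \<le> 2 ^ b * Y0" by (rule mult_right_mono) simp
        then show False using that by linarith
      qed
      assume "k \<noteq> k'"
      then consider "k < k'" | "k' < k" by linarith
      then show False by cases (use *[of k k'] *[of k' k] 1 in auto)
    qed
    have Bmem: "n \<in> B (k, i) \<longleftrightarrow> (\<exists>j<g k. n = 2 ^ k * Y0 + i * g k + j)" for k i
      by (auto simp: B_def)
    obtain j where j1: "j < g k" "n = 2 ^ k * Y0 + i * g k + j"
      using x(2) unfolding xy(1) Bmem by blast
    obtain j' where j2: "j' < g k" "n = 2 ^ k * Y0 + i' * g k + j'"
      using y(2) unfolding xy(2) Bmem \<open>k = k'\<close> by blast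
    have "i * g k + j = i' * g k + j'" using j1(2) j2(2) by linarith
    then have "(i * g k + j) div g k = (i' * g k + j') div g k" by simp
    then have "i = i'" using j1(1) j2(1) by simp
    then show ?thesis using xy \<open>k = k'\<close> by simp
  qed
  have cardG: "card (G (k, i)) = g k" for k i
  proof -
    have "card (G (k, i)) = card (B (k, i))" unfolding G_def
      by (rule card_image) (use qinj in \<open>auto intro: inj_on_subset\<close>)
    also have "\<dots> = card {..<g k}" unfolding B_def by (simp add: card_image inj_on_def)
    finally show ?thesis by simp
  qed
  have finI: "finite I" by (simp add: I_def)
  have 1: "disjoint_family_on G I"
    unfolding disjoint_family_on_def
  proof (intro ballI impI)
    fix x y assume xy: "x \<in> I" "y \<in> I" "x \<noteq> y"
    show "G x \<inter> G y = {}"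
    proof (rule ccontr)
      assume "G x \<inter> G y \<noteq> {}"
      then obtain n m where "n \<in> B x" "m \<in> B y" "q n = q m" by (auto simp: G_def)
      then show False using qinj Bdisj xy by (metis injD)
    qed
  qed
  have 2: "finite (G x) \<and> G x \<noteq> {} \<and> (\<forall>p\<in>G x. prime p)" if "x \<in> I" for x
  proof -
    obtain k i where ki: "x = (k, i)" "k \<ge> 1" using \<open>x \<in> I\<close> by (auto simp: I_def)
    show ?thesis using gpos[OF ki(2)] qS by (auto simp: ki(1) G_def B_def S_def)
  qed
  have 3: "real (\<Prod>x\<in>I. card (G x) + 1) \<le> exp (\<kappa> * Y)"
  proof -
    have gexp: "real (g k + 1) \<le> exp (4 * real k + real l)" if "k \<ge> 1" for k
    proof -
      have e2: "(2::real) \<le> exp 1" using exp_ge_add_one_self[of 1] by simp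
      have "real (g k + 1) \<le> 2 * real (g k)" using gpos[OF that] by simp
      also have "\<dots> = 2 * (real k * real k) * real l * 2 ^ k" by (simp add: g_def power2_eq_square)
      also have "\<dots> \<le> exp (real k) * (exp (real k) * exp (real k)) * exp (real l) * exp (real k)"
      proof (intro mult_mono)
        have "exp 1 \<le> exp (real k)" using that by simp
        with e2 show "2 \<le> exp (real k)" by (rule order.trans)
        show "(2::real) ^ k \<le> exp (real k)"
          using power_mono[OF e2, of k] exp_of_nat_mult[of k "1::real"] by simp
        show "real k \<le> exp (real k)" "real k \<le> exp (real k)" "real l \<le> exp (real l)"
          using exp_ge_add_one_self[of "real k"] exp_ge_add_one_self[of "real l"] by linarith+
      qed auto
      also have "\<dots> = exp (4 * real k + real l)" by (simp add: exp_add[symmetric])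
      finally show ?thesis .
    qed
    have "real (\<Prod>x\<in>I. card (G x) + 1) = (\<Prod>(k, i)\<in>I. real (g k + 1))"
      unfolding of_nat_prod by (intro prod.cong) (auto simp: cardG split: prod.splits)
    also have "\<dots> \<le> (\<Prod>(k, i)\<in>I. exp (4 * real k + real l))"
      by (intro prod_mono) (use gexp in \<open>auto simp: I_def\<close>)
    also have "\<dots> = exp (\<Sum>(k, i)\<in>I. 4 * real k + real l)"
      unfolding exp_sum[OF finI] by (intro prod.cong) auto
    also have "(\<Sum>(k, i)\<in>I. 4 * real k + real l) = (\<Sum>k=1..K. real (E k) * (4 * real k + real l))"
      unfolding I_def by (subst sum.Sigma[symmetric]) auto
    \<comment> \<open>The reason for \<open>k\<^sup>2 * l\<close> in the group size: the part
      \<open>4 * k\<close> of the exponent sums to a harmonic number of order \<open>l\<close>,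
      which \<open>1 / l\<close> cancels, and the part \<open>l\<close> leaves the convergent sum of
      \<open>1 / k\<^sup>2\<close>.\<close>
    also have "\<dots> \<le> (\<Sum>k=1..K. c * Y * (4 / real l * inverse (real k) + 1 / (real k)\<^sup>2))"
    proof (rule sum_mono)
      fix k assume k: "k \<in> {1..K}"
      have "real (E k) * (4 * real k + real l) \<le> c * Y / (real k ^ 2 * real l) * (4 * real k + real l)"
        by (intro mult_right_mono Eup) auto
      also have "\<dots> = c * Y * (4 / real l * inverse (real k) + 1 / (real k)\<^sup>2)"
        using k l by (simp add: divide_simps power2_eq_square)
      finally show "real (E k) * (4 * real k + real l) \<le> c * Y * (4 / real l * inverse (real k) + 1 / (real k)\<^sup>2)" .
    qed
    also have "\<dots> = c * Y * (4 / real l * harm K + (\<Sum>k=1..K. 1 / (real k)\<^sup>2))"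
      by (simp only: harm_def sum_distrib_left distrib_left sum.distrib mult.assoc)
    also have "\<dots> \<le> c * Y * (8 + 2)"
    proof (intro mult_left_mono add_mono)
      have "harm K \<le> 1 + ln (real K)" using K by (intro harm_le_ln) auto
      also have "ln (real K) \<le> ln H"
      proof (subst ln_le_cancel_iff)
        have "sqrt H * 1 \<le> sqrt H * sqrt H" using sH H4 by (intro mult_left_mono) auto
        then show "real K \<le> H" using K H4 by simp
      qed (use K H4 in auto)
      finally have "harm K \<le> 2 * real l" using l by linarith
      then have "4 / real l * harm K \<le> 4 / real l * (2 * real l)" by (intro mult_left_mono) auto
      then show "4 / real l * harm K \<le> 8" using l by simp
      show "(\<Sum>k=1..K. 1 / (real k)\<^sup>2) \<le> 2" using sum_inverse_squares_le[of K] by (rule order.trans) simp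
    qed (use c Y in auto)
    also have "\<dots> = \<kappa> * Y" by (simp add: c_def)
    finally show ?thesis by simp
  qed
  have W: "smooth_weight H p \<ge> exp (- 4) / sqrt (100 * 2 ^ k * Y * H)" if kiI: "(k, i) \<in> I" and pG: "p \<in> G (k, i)" for k i p
  proof -
    \<comment> \<open>By Chebyshev there are more than \<open>5 * 2 ^ k * Y\<close> primes up to
      \<open>x\<close>, enough for the indices of block \<open>k\<close> together with the primes
      skipped up to \<open>Y0\<close>.\<close>
    define x where "x = 100 * 2 ^ k * Y * H"
    have k: "k \<in> {1..K}" using kiI by (auto simp: I_def)
    obtain n where n: "n \<in> B (k, i)" "p = q n" using pG by (auto simp: G_def)
    have lnx: "ln x \<le> H + 2 * sqrt H"
    proof -
      have "ln x = ln 100 + real k * ln 2 + H + ln H"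
      proof -
        have "Y > 0" "H > 0" using Y H4 by auto
        then show ?thesis unfolding x_def by (simp add: ln_mult ln_realpow H_def[symmetric])
      qed
      also have "real k * ln 2 \<le> sqrt H * 1" using k K H4 ln_2_less_1 by (intro mult_mono) auto
      finally show ?thesis using F2 by linarith
    qed
    have sHH: "2 * sqrt H \<le> H"
      using mult_right_mono[OF sH, of "sqrt H"] H4 by simp
    have x2: "x \<ge> 2"
    proof -
      have "100 * 1 * 1 * 1 \<le> x" unfolding x_def using Y H4 by (intro mult_mono) auto
      then show ?thesis by simp
    qed
    have "real p \<le> x" unfolding n q_def S_def
    proof (rule enumerate_primes_le)
      have "n + Y0 \<le> 2 ^ Suc k * Y0 + Y0" using Bbound[OF kiI n(1)] by simp
      then have "real (n + Y0) \<le> real (2 ^ Suc k * Y0 + Y0)" by (subst of_nat_le_iff)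
      also have "\<dots> = (2 * 2 ^ k + 1) * real Y0" by (simp add: algebra_simps)
      also have "\<dots> \<le> (5/2 * 2 ^ k) * (2 * Y)"
      proof (intro mult_mono)
        have "(2::real) ^ 1 \<le> 2 ^ k" using k by (intro power_increasing) auto
        then show "2 * 2 ^ k + 1 \<le> 5/2 * (2::real) ^ k" by simp
      qed (use Y0 Y in auto)
      also have "\<dots> = 5 * 2 ^ k * Y" by simp
      also have "\<dots> < 100 / 16 * 2 ^ k * Y" using Y by simp
      also have "\<dots> = x / (8 * (2 * H))" using H4 by (simp add: x_def field_simps)
      also have "\<dots> \<le> x / (8 * ln x)"
        using lnx sHH x2 H4 by (intro divide_left_mono mult_left_mono mult_pos_pos) auto
      also have "\<dots> \<le> real (card {p::nat. prime p \<and> real p \<le> x})" by (rule chebyshev_lower[OF x2])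
      finally show "real (n + Y0) < real (card {p::nat. prime p \<and> real p \<le> x})" .
    qed
    moreover have "real p \<ge> Y" "p > 0" using qS[of n] Y0 n by (auto simp: S_def)
    ultimately have lnp: "H \<le> ln (real p)" "ln (real p) \<le> ln x" using Y x2 by (auto simp: H_def)
    have "sqrt x = exp (ln x / 2)" using x2 by (simp add: ln_sqrt[symmetric])
    then have "exp (- 4) / sqrt x = exp (- 4 - ln x / 2)" by (simp add: exp_diff)
    \<comment> \<open>The 4 is 2 for the factor \<open>p powr - (1/H)\<close> plus 2 for the
      Gaussian at distance at most \<open>2 * sqrt H\<close> from its centre.\<close>
    also have "\<dots> \<le> exp (- (1/2 + 1/H) * ln (real p) + - ((ln (real p) - H)\<^sup>2 / (2 * H)))"
    proof -
      have "ln (real p) / H \<le> 2" using lnp lnx sHH H4 by (simp add: field_simps)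
      moreover have "(ln (real p) - H)\<^sup>2 / (2 * H) \<le> 2"
      proof -
        have "(ln (real p) - H)\<^sup>2 \<le> (2 * sqrt H)\<^sup>2" using lnp lnx by (intro power_mono) auto
        also have "\<dots> = 4 * H" using H4 by (simp add: power_mult_distrib)
        finally show ?thesis using H4 by (simp add: field_simps)
      qed
      ultimately show ?thesis using lnp by (simp add: algebra_simps)
    qed
    also have "\<dots> = smooth_weight H p"
      using \<open>p > 0\<close> by (simp add: smooth_weight_def powr_def exp_add[symmetric])
    finally show ?thesis by (simp add: x_def)
  qed
  have 4: "(\<Sum>x\<in>I. \<Sum>p\<in>G x. smooth_weight H p / sqrt (real (card (G x)))) \<ge>
        \<kappa> / 10 * exp (- 4) / 80 * sqrt (Y * ln H / H)"
  proof -
    \<comment> \<open>A group of \<open>g k\<close> primes yields \<open>sqrt (g k)\<close> times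
      the weight; the \<open>2 ^ k\<close> in \<open>g k\<close> cancels against the size of the
      primes, so no block is favoured exponentially.\<close>
    have blk: "(\<Sum>p\<in>G (k, i). smooth_weight H p / sqrt (real (card (G (k, i))))) \<ge>
        exp (- 4) * real k * sqrt (real l) / (10 * sqrt (Y * H))" if ki: "(k, i) \<in> I" for k i
    proof -
      have "k \<ge> 1" using ki by (auto simp: I_def)
      have "exp (- 4) * real k * sqrt (real l) / (10 * sqrt (Y * H)) =
          real (g k) * (exp (- 4) / sqrt (100 * 2 ^ k * Y * H) / sqrt (real (g k)))"
      proof -
        have "real (g k) / sqrt (real (g k)) = sqrt (real (g k))" by (simp add: real_div_sqrt)
        moreover have "sqrt (real (g k)) = real k * sqrt (real l) * sqrt (2 ^ k)"
          by (simp add: g_def real_sqrt_mult)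
        moreover have "sqrt (100 * 2 ^ k * Y * H) = 10 * sqrt (2 ^ k) * sqrt (Y * H)"
          by (simp add: real_sqrt_mult)
        moreover have "real (g k) * (exp (- 4) / sqrt (100 * 2 ^ k * Y * H) / sqrt (real (g k))) =
            real (g k) / sqrt (real (g k)) * exp (- 4) / sqrt (100 * 2 ^ k * Y * H)" by simp
        ultimately have "real (g k) * (exp (- 4) / sqrt (100 * 2 ^ k * Y * H) / sqrt (real (g k))) =
            real k * sqrt (real l) * sqrt (2 ^ k) * exp (- 4) / (10 * sqrt (2 ^ k) * sqrt (Y * H))"
          by (simp only:)
        also have "\<dots> = exp (- 4) * real k * sqrt (real l) / (10 * sqrt (Y * H))" by simp
        finally show ?thesis by (rule sym)
      qed
      also have "\<dots> = (\<Sum>p\<in>G (k, i). exp (- 4) / sqrt (100 * 2 ^ k * Y * H) / sqrt (real (g k)))"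
        by (simp add: cardG)
      also have "\<dots> \<le> (\<Sum>p\<in>G (k, i). smooth_weight H p / sqrt (real (card (G (k, i)))))"
        unfolding cardG by (intro sum_mono divide_right_mono W[OF ki]) auto
      finally show ?thesis .
    qed
    have "\<kappa> / 10 * exp (- 4) / 80 * sqrt (Y * ln H / H) =
       c * exp (- 4) / 20 * (sqrt Y / sqrt H) * (1 / (2 * sqrt (ln H))) * (ln H / 2)"
    proof -
      have "ln H / sqrt (ln H) = sqrt (ln H)" using lnH by (simp add: real_div_sqrt)
      then have a: "1 / (2 * sqrt (ln H)) * (ln H / 2) = sqrt (ln H) / 4" by simp
      have b: "sqrt (Y * ln H / H) = sqrt Y / sqrt H * sqrt (ln H)"
        by (simp add: real_sqrt_mult real_sqrt_divide)
      show ?thesis unfolding mult.assoc a b by (simp add: c_def)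
    qed
    also have "\<dots> \<le> c * exp (- 4) / 20 * (sqrt Y / sqrt H) * (1 / sqrt (real l)) * harm K"
    proof (intro mult_mono mult_left_mono)
      have "sqrt (real l) \<le> sqrt (2 * ln H)" using l by simp
      also have "\<dots> \<le> 2 * sqrt (ln H)"
        using lnH by (intro real_le_lsqrt) (auto simp: power_mult_distrib)
      finally show "1 / (2 * sqrt (ln H)) \<le> 1 / sqrt (real l)" using l by (intro divide_left_mono) auto
      \<comment> \<open>With \<open>K\<close> about \<open>sqrt H\<close> the harmonic sum supplies
        \<open>ln H / 2\<close>. Division by \<open>sqrt l\<close> reduces this to the order
        \<open>sqrt (ln H)\<close> of the claim.\<close>
      have "ln H / 2 = ln (sqrt H)" using H4 by (simp add: ln_sqrt)
      also have "\<dots> \<le> ln (real K + 1)" using K sH H4 by (subst ln_le_cancel_iff) auto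
      also have "\<dots> \<le> harm K" by (rule ln_le_harm)
      finally show "ln H / 2 \<le> harm K" .
    qed (use c Y H4 lnH in auto)
    also have "\<dots> = (\<Sum>k=1..K. c * exp (- 4) / 20 * (sqrt Y / sqrt H) * (1 / sqrt (real l)) * inverse (real k))"
      by (simp add: harm_def sum_distrib_left)
    also have "\<dots> \<le> (\<Sum>k=1..K. real (E k) * (exp (- 4) * real k * sqrt (real l) / (10 * sqrt (Y * H))))"
    proof (rule sum_mono)
      fix k assume k: "k \<in> {1..K}"
      have "c * exp (- 4) / 20 * (sqrt Y / sqrt H) * (1 / sqrt (real l)) * inverse (real k) =
          c * Y / (2 * (real k ^ 2 * real l)) * (exp (- 4) * real k * sqrt (real l) / (10 * sqrt (Y * H)))"
      proof -
        have "Y / sqrt Y = sqrt Y" "sqrt (real l) / real l = 1 / sqrt (real l)"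
          using Y l by (simp_all add: real_div_sqrt field_simps)
        moreover have "real k / real k ^ 2 = inverse (real k)" using k by (simp add: power2_eq_square field_simps)
        moreover have "c * Y / (2 * (real k ^ 2 * real l)) * (exp (- 4) * real k * sqrt (real l) / (10 * sqrt (Y * H)))
          = c * exp (- 4) / 20 * (Y / sqrt Y / sqrt H) * (sqrt (real l) / real l) * (real k / real k ^ 2)"
          by (simp add: real_sqrt_mult mult_ac)
        ultimately show ?thesis by simp
      qed
      also have "\<dots> \<le> real (E k) * (exp (- 4) * real k * sqrt (real l) / (10 * sqrt (Y * H)))"
        using Y H4 by (intro mult_right_mono Elow k) auto
      finally show "c * exp (- 4) / 20 * (sqrt Y / sqrt H) * (1 / sqrt (real l)) * inverse (real k) \<le>
          real (E k) * (exp (- 4) * real k * sqrt (real l) / (10 * sqrt (Y * H)))" .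
    qed
    also have "\<dots> = (\<Sum>(k, i)\<in>I. exp (- 4) * real k * sqrt (real l) / (10 * sqrt (Y * H)))"
      unfolding I_def by (subst sum.Sigma[symmetric]) auto
    also have "\<dots> \<le> (\<Sum>x\<in>I. \<Sum>p\<in>G x. smooth_weight H p / sqrt (real (card (G x))))"
      by (intro sum_mono) (use blk in auto)
    finally show ?thesis .
  qed
  show ?thesis using finI 1 2 3 4 by blast
qed

lemma prime_groups:
  fixes \<kappa> :: real
  assumes \<kappa>: "0 < \<kappa>" "\<kappa> \<le> 1"
  shows "\<exists>c>0. \<forall>\<^sub>F Y in at_top. \<exists>(I::(nat \<times> nat) set) G. finite I \<and> disjoint_family_on G I \<and>
      (\<forall>i\<in>I. finite (G i) \<and> G i \<noteq> {} \<and> (\<forall>p\<in>G i. prime p)) \<and>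
      real (\<Prod>i\<in>I. card (G i) + 1) \<le> exp (\<kappa> * Y) \<and>
      (\<Sum>i\<in>I. \<Sum>p\<in>G i. smooth_weight (ln Y) p / sqrt (real (card (G i)))) \<ge>
        c * sqrt (Y * ln (ln Y) / ln Y)"
proof (intro exI[of _ "\<kappa> / 10 * exp (- 4) / 80"] conjI)
  have "\<forall>\<^sub>F Y::real in at_top. Y \<ge> 1" by real_asymp
  moreover have "\<forall>\<^sub>F Y::real in at_top. ln Y \<ge> 4" by real_asymp
  moreover have "\<forall>\<^sub>F Y::real in at_top. ln (ln Y) \<ge> 1" by real_asymp
  moreover have "\<forall>\<^sub>F Y::real in at_top. ln 100 + ln (ln Y) \<le> sqrt (ln Y)" by real_asymp
  moreover have "\<forall>\<^sub>F Y::real in at_top. ln Y * (ln (ln Y) + 1) \<le> \<kappa> / 10 * Y" using \<kappa> by real_asymp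
  ultimately show "\<forall>\<^sub>F Y in at_top. \<exists>(I::(nat \<times> nat) set) G. finite I \<and> disjoint_family_on G I \<and>
      (\<forall>i\<in>I. finite (G i) \<and> G i \<noteq> {} \<and> (\<forall>p\<in>G i. prime p)) \<and>
      real (\<Prod>i\<in>I. card (G i) + 1) \<le> exp (\<kappa> * Y) \<and>
      (\<Sum>i\<in>I. \<Sum>p\<in>G i. smooth_weight (ln Y) p / sqrt (real (card (G i)))) \<ge>
        \<kappa> / 10 * exp (- 4) / 80 * sqrt (Y * ln (ln Y) / ln Y)"
    by eventually_elim (rule prime_groups_fixed[OF \<kappa>])
qed (use \<kappa> in auto)

section \<open>The smoothed explicit formula\<close>

text \<open>With a primitive on the convex set, each vertical integral is a difference of end
  values, and the two integrals differ by the increments along the horizontal sides.\<close>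

lemma vertical_shift_bound:
  fixes f :: "complex \<Rightarrow> complex"
  assumes A: "convex A" "open A" and f: "f holomorphic_on A" and ab: "a \<le> b" and xy: "x \<le> y"
    and sub: "\<And>\<sigma> u. x \<le> \<sigma> \<Longrightarrow> \<sigma> \<le> y \<Longrightarrow> a \<le> u \<Longrightarrow> u \<le> b \<Longrightarrow> Complex \<sigma> (t + u) \<in> A"
    and E: "\<And>\<sigma> u. x \<le> \<sigma> \<Longrightarrow> \<sigma> \<le> y \<Longrightarrow> u = a \<or> u = b \<Longrightarrow> norm (f (Complex \<sigma> (t + u))) \<le> E"
  shows "norm ((\<integral>u. indicator {a..b} u *\<^sub>R f (Complex x (t + u)) \<partial>lborel) -
     (\<integral>u. indicator {a..b} u *\<^sub>R f (Complex y (t + u)) \<partial>lborel)) \<le> 2 * E * (y - x)"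
proof -
  obtain P where P0: "\<And>z. z \<in> A \<Longrightarrow> (P has_field_derivative f z) (at z within A)"
    using holomorphic_convex_primitive'[OF A f] by blast
  have P: "(P has_field_derivative f z) (at z)" if "z \<in> A" for z
    using P0[OF that] at_within_open[OF that A(2)] by simp
  have I: "(\<integral>u. indicator {a..b} u *\<^sub>R f (Complex \<sigma> (t + u)) \<partial>lborel) =
      - \<i> * P (Complex \<sigma> (t + b)) - - \<i> * P (Complex \<sigma> (t + a))" if \<sigma>: "x \<le> \<sigma>" "\<sigma> \<le> y" for \<sigma>
  proof (rule integral_FTC_atLeastAtMost[OF ab])
    have c: "((\<lambda>u. Complex \<sigma> (t + u)) has_vector_derivative \<i>) (at u)" for u
    proof -
      have "((\<lambda>u. of_real \<sigma> + \<i> * of_real (t + u)) has_vector_derivative \<i>) (at u)"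
        by (auto intro!: derivative_eq_intros)
      then show ?thesis unfolding Complex_eq .
    qed
    show "((\<lambda>u. - \<i> * P (Complex \<sigma> (t + u))) has_vector_derivative f (Complex \<sigma> (t + u))) (at u within {a..b})"
      if "a \<le> u" "u \<le> b" for u
    proof -
      have "((\<lambda>u. P (Complex \<sigma> (t + u))) has_vector_derivative (\<i> * f (Complex \<sigma> (t + u)))) (at u)"
        using field_vector_diff_chain_at[OF c P[OF sub[OF \<sigma> that]]] by (simp add: o_def)
      from has_vector_derivative_mult_right[OF this, of "- \<i>"]
      have "((\<lambda>u. - \<i> * P (Complex \<sigma> (t + u))) has_vector_derivative f (Complex \<sigma> (t + u))) (at u)" by simp
      then show ?thesis by (rule has_vector_derivative_at_within)
    qed
    have "continuous_on {a..b} (\<lambda>u. Complex \<sigma> (t + u))"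
      by (intro continuous_on_Complex continuous_intros)
    then show "continuous_on {a..b} (\<lambda>u. f (Complex \<sigma> (t + u)))"
      by (rule continuous_on_compose2[OF holomorphic_on_imp_continuous_on[OF f]]) (use sub \<sigma> in auto)
  qed
  have h: "norm (P (Complex x (t + u)) - P (Complex y (t + u))) \<le> E * (y - x)" if u: "u = a \<or> u = b" for u
  proof -
    let ?S = "closed_segment (Complex x (t + u)) (Complex y (t + u))"
    have S: "\<exists>\<sigma>. z = Complex \<sigma> (t + u) \<and> x \<le> \<sigma> \<and> \<sigma> \<le> y" if "z \<in> ?S" for z
    proof -
      obtain v where v: "0 \<le> v" "v \<le> 1" "z = (1 - v) *\<^sub>R Complex x (t + u) + v *\<^sub>R Complex y (t + u)"
        using \<open>z \<in> ?S\<close> by (auto simp: in_segment)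
      have "z = Complex (x + v * (y - x)) (t + u)" unfolding v(3) by (simp add: complex_eq_iff algebra_simps)
      moreover have "0 \<le> v * (y - x)" "v * (y - x) \<le> 1 * (y - x)" using v xy mult_right_mono[OF v(2), of "y - x"] by auto
      ultimately show ?thesis by (intro exI[of _ "x + v * (y - x)"]) auto
    qed
    have "norm (P (Complex x (t + u)) - P (Complex y (t + u))) \<le> E * norm (Complex x (t + u) - Complex y (t + u))"
    proof (rule field_differentiable_bound[of ?S])
      fix z assume "z \<in> ?S"
      then obtain \<sigma> where \<sigma>: "z = Complex \<sigma> (t + u)" "x \<le> \<sigma>" "\<sigma> \<le> y" using S by blast
      have "z \<in> A" using sub[OF \<sigma>(2,3), of u] u ab \<sigma>(1) by auto
      then show "(P has_field_derivative f z) (at z within ?S)" using P by (blast intro: has_field_derivative_at_within)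
      show "norm (f z) \<le> E" using E[OF \<sigma>(2,3) u] \<sigma>(1) by simp
    qed auto
    also have "norm (Complex x (t + u) - Complex y (t + u)) = y - x"
      using xy by (simp add: complex_diff cmod_eq_Re)
    finally show ?thesis .
  qed
  have "norm (- \<i> * (P (Complex x (t + b)) - P (Complex y (t + b))) + \<i> * (P (Complex x (t + a)) - P (Complex y (t + a))))
     \<le> norm (- \<i> * (P (Complex x (t + b)) - P (Complex y (t + b)))) + norm (\<i> * (P (Complex x (t + a)) - P (Complex y (t + a))))"
    by (rule norm_triangle_ineq)
  also have "\<dots> \<le> E * (y - x) + E * (y - x)"
    unfolding norm_mult using h[of a] h[of b] by simp
  finally have "norm (- \<i> * (P (Complex x (t + b)) - P (Complex y (t + b))) + \<i> * (P (Complex x (t + a)) - P (Complex y (t + a))))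
     \<le> 2 * E * (y - x)" by simp
  moreover have "(- \<i> * P (Complex x (t + b)) - - \<i> * P (Complex x (t + a))) -
      (- \<i> * P (Complex y (t + b)) - - \<i> * P (Complex y (t + a))) =
      - \<i> * (P (Complex x (t + b)) - P (Complex y (t + b))) + \<i> * (P (Complex x (t + a)) - P (Complex y (t + a)))"
    by (simp add: algebra_simps)
  ultimately show ?thesis unfolding I[OF order.refl xy] I[OF xy order.refl] by (simp only:)
qed

section \<open>The kernel and its Fourier transform\<close>

definition kern :: "real \<Rightarrow> real \<Rightarrow> complex \<Rightarrow> complex" where
  "kern H \<eta> z = exp (- (of_real H * z\<^sup>2 / 2)) * (1 - of_real \<eta> * sin (of_real H * z))"

lemma kern_of_real: "kern H \<eta> (of_real u) = of_real (exp (- (H * u\<^sup>2 / 2)) * (1 - \<eta> * sin (H * u)))"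
proof -
  have "of_real H * of_real u = complex_of_real (H * u)" by simp
  moreover have "- (of_real H * (of_real u)\<^sup>2 / 2) = complex_of_real (- (H * u\<^sup>2 / 2))" by simp
  ultimately show ?thesis unfolding kern_def by (simp only: sin_of_real exp_of_real) simp
qed

lemma norm_sin_le: "norm (sin z :: complex) \<le> exp \<bar>Im z\<bar>"
proof -
  have "norm (sin z) = norm (exp (\<i> * z) - exp (- (\<i> * z))) / 2"
    by (simp add: sin_exp_eq norm_divide norm_mult)
  also have "\<dots> \<le> (norm (exp (\<i> * z)) + norm (exp (- (\<i> * z)))) / 2"
    by (intro divide_right_mono norm_triangle_ineq4) auto
  also have "\<dots> = (exp (- Im z) + exp (Im z)) / 2" by simp
  also have "\<dots> \<le> (exp \<bar>Im z\<bar> + exp \<bar>Im z\<bar>) / 2"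
    by (intro divide_right_mono add_mono) auto
  finally show ?thesis by simp
qed

text \<open>\<open>3/2\<close> covers the shift from \<open>1/2 + 1/H\<close> to 2. The Gaussian
  grows at most by \<open>exp (9/8 * H)\<close> and the other factor is at most
  \<open>2 * exp (3/2 * H)\<close>.\<close>

lemma norm_kern_le:
  assumes H: "H > 0" and \<eta>: "\<bar>\<eta>\<bar> = 1" and z: "\<bar>Im z\<bar> \<le> 3/2"
  shows "norm (kern H \<eta> z) \<le> 2 * exp (3 * H) * exp (- (H * (Re z)\<^sup>2 / 2))"
proof -
  have "norm (exp (- (of_real H * z\<^sup>2 / 2))) = exp (- (H * (Re z)\<^sup>2 / 2) + H * (Im z)\<^sup>2 / 2)"
    by (simp add: power2_eq_square field_simps)
  also have "\<dots> \<le> exp (- (H * (Re z)\<^sup>2 / 2) + H * (9/8))"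
  proof -
    have "\<bar>Im z\<bar>\<^sup>2 \<le> (3/2)\<^sup>2" using z by (intro power_mono) auto
    then have "H * (Im z)\<^sup>2 \<le> H * (9/4)" using H by (intro mult_left_mono) (auto simp: power2_eq_square)
    then show ?thesis by simp
  qed
  finally have 1: "norm (exp (- (of_real H * z\<^sup>2 / 2))) \<le> exp (- (H * (Re z)\<^sup>2 / 2) + H * (9/8))" .
  have "norm (1 - of_real \<eta> * sin (of_real H * z)) \<le> norm (1::complex) + norm (of_real \<eta> * sin (of_real H * z))"
    by (rule norm_triangle_ineq4)
  also have "\<dots> \<le> exp (H * (3/2)) + exp (H * (3/2))"
  proof (intro add_mono)
    have "norm (of_real \<eta> * sin (of_real H * z)) \<le> exp \<bar>H * Im z\<bar>"
      using norm_sin_le[of "of_real H * z"] \<eta> by (simp add: norm_mult)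
    also have "\<dots> \<le> exp (H * (3/2))" using z H by (simp add: abs_mult)
    finally show "norm (of_real \<eta> * sin (of_real H * z)) \<le> exp (H * (3/2))" .
  qed (use H in auto)
  finally have 2: "norm (1 - of_real \<eta> * sin (of_real H * z)) \<le> 2 * exp (H * (3/2))" by simp
  have "norm (kern H \<eta> z) \<le> exp (- (H * (Re z)\<^sup>2 / 2) + H * (9/8)) * (2 * exp (H * (3/2)))"
    unfolding kern_def norm_mult by (intro mult_mono 1 2) auto
  also have "\<dots> = 2 * exp (H * (21/8)) * exp (- (H * (Re z)\<^sup>2 / 2))" by (simp add: exp_add[symmetric] field_simps)
  also have "\<dots> \<le> 2 * exp (3 * H) * exp (- (H * (Re z)\<^sup>2 / 2))" using H by (intro mult_right_mono) auto
  finally show ?thesis .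
qed

lemma gauss_real: "H > 0 \<Longrightarrow> has_bochner_integral lborel (\<lambda>u. exp (- (H * u\<^sup>2 / 2))) (sqrt (2 * pi / H))"
  using has_bochner_integral_Re[OF gauss_fourier[of H 0]] by simp

text \<open>The Fourier transform of the kernel without the factor \<open>sqrt (2 * pi / H)\<close>:
  a Gaussian at 0 from the constant part and, from the two exponentials in the sine, Gaussians at
  \<open>H\<close> and \<open>- H\<close>. At \<open>v = ln n\<close> the one at \<open>H\<close>
  carries the main term.\<close>

definition kern_hat :: "real \<Rightarrow> real \<Rightarrow> real \<Rightarrow> complex" where
  "kern_hat H \<eta> v = of_real (exp (- (v\<^sup>2 / (2 * H)))) - of_real \<eta> / (2 * \<i>) *
     (of_real (exp (- ((H - v)\<^sup>2 / (2 * H)))) - of_real (exp (- ((H + v)\<^sup>2 / (2 * H)))))"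

lemma kern_fourier:
  assumes H: "H > 0"
  shows "has_bochner_integral lborel
    (\<lambda>u. exp (- (\<i> * of_real v * (of_real u - \<i> * of_real y))) * kern H \<eta> (of_real u - \<i> * of_real y))
    (of_real (sqrt (2 * pi / H)) * kern_hat H \<eta> v)"
proof -
  define g where "g \<mu> u = exp (- (of_real H * (of_real u - \<i> * of_real y)\<^sup>2 / 2) + \<i> * of_real \<mu> * (of_real u - \<i> * of_real y))" for \<mu> u :: real
  have g: "has_bochner_integral lborel (g \<mu>) (of_real (sqrt (2 * pi / H) * exp (- (\<mu>\<^sup>2 / (2 * H)))))" for \<mu>
    unfolding g_def by (rule gauss_shift[OF H])
  have "exp (- (\<i> * of_real v * (of_real u - \<i> * of_real y))) * kern H \<eta> (of_real u - \<i> * of_real y) =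
      g (- v) u - of_real \<eta> / (2 * \<i>) * (g (H - v) u - g (- (H + v)) u)" for u
  proof -
    define z where "z = of_real u - \<i> * of_real y"
    have keq: "kern H \<eta> z = exp (- (of_real H * z\<^sup>2 / 2)) -
       of_real \<eta> / (2 * \<i>) * (exp (- (of_real H * z\<^sup>2 / 2)) * exp (\<i> * (of_real H * z)) - exp (- (of_real H * z\<^sup>2 / 2)) * exp (- (\<i> * (of_real H * z))))"
    proof -
      have "E * (1 - c * ((a - b) / (2 * \<i>))) = E - c / (2 * \<i>) * (E * a - E * b)" for E a b c :: complex
        by (simp add: diff_divide_distrib algebra_simps)
      then show ?thesis unfolding kern_def sin_exp_eq .
    qed
    have "exp (- (\<i> * of_real v * z)) * kern H \<eta> z =
       exp (- (of_real H * z\<^sup>2 / 2)) * exp (- (\<i> * of_real v * z)) -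
       of_real \<eta> / (2 * \<i>) * (exp (- (of_real H * z\<^sup>2 / 2)) * exp (\<i> * (of_real H * z)) * exp (- (\<i> * of_real v * z)) -
          exp (- (of_real H * z\<^sup>2 / 2)) * exp (- (\<i> * (of_real H * z))) * exp (- (\<i> * of_real v * z)))"
      unfolding keq by (simp only: right_diff_distrib mult_ac)
    also have "exp (- (of_real H * z\<^sup>2 / 2)) * exp (- (\<i> * of_real v * z)) = g (- v) u"
      by (simp add: g_def z_def exp_add[symmetric])
    also have "exp (- (of_real H * z\<^sup>2 / 2)) * exp (\<i> * (of_real H * z)) * exp (- (\<i> * of_real v * z)) = g (H - v) u"
      unfolding g_def z_def[symmetric] exp_add[symmetric] by (rule arg_cong[where f = exp]) (simp add: algebra_simps)
    also have "exp (- (of_real H * z\<^sup>2 / 2)) * exp (- (\<i> * (of_real H * z))) * exp (- (\<i> * of_real v * z)) = g (- (H + v)) u"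
      unfolding g_def z_def[symmetric] exp_add[symmetric] by (rule arg_cong[where f = exp]) (simp add: algebra_simps)
    finally show ?thesis by (simp only: z_def)
  qed
  moreover have "has_bochner_integral lborel (\<lambda>u. g (- v) u - of_real \<eta> / (2 * \<i>) * (g (H - v) u - g (- (H + v)) u))
     (of_real (sqrt (2 * pi / H) * exp (- ((- v)\<^sup>2 / (2 * H)))) - of_real \<eta> / (2 * \<i>) *
        (of_real (sqrt (2 * pi / H) * exp (- ((H - v)\<^sup>2 / (2 * H)))) - of_real (sqrt (2 * pi / H) * exp (- ((- (H + v))\<^sup>2 / (2 * H))))))"
    by (intro has_bochner_integral_diff has_bochner_integral_mult_right g)
  moreover have "of_real (sqrt (2 * pi / H) * exp (- ((- v)\<^sup>2 / (2 * H)))) - of_real \<eta> / (2 * \<i>) *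
        (of_real (sqrt (2 * pi / H) * exp (- ((H - v)\<^sup>2 / (2 * H)))) - of_real (sqrt (2 * pi / H) * exp (- ((- (H + v))\<^sup>2 / (2 * H)))))
       = of_real (sqrt (2 * pi / H)) * kern_hat H \<eta> v"
    unfolding kern_hat_def power2_minus of_real_mult by (simp only: right_diff_distrib mult_ac)
  ultimately show ?thesis by (simp only:)
qed

section \<open>Size of the smoothed Dirichlet series\<close>

lemma smooth_weight_nonneg: "smooth_weight H n \<ge> 0" by (simp add: smooth_weight_def)

text \<open>The parabola \<open>(v - H)\<^sup>2 / (2 * H)\<close> lies above its tangent
  \<open>v - 3 * H / 2\<close> of slope 1, so a full power of \<open>n\<close> is gained at the cost
  of \<open>exp (3 * H / 2)\<close>.\<close>

lemma smooth_weight_le: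
  assumes H: "H > 0"
  shows "smooth_weight H n \<le> exp (3 * H / 2) * real n powr (- 3/2)"
proof (cases "n = 0")
  case False
  define v where "v = ln (real n)"
  have v: "v \<ge> 0" using False by (simp add: v_def)
  have "(v - H) - H / 2 \<le> (v - H)\<^sup>2 / (2 * H)"
    using sum_squares_bound[of "v - H" H] H by (simp add: field_simps power2_eq_square)
  moreover have "- (1/2 + 1/H) * v \<le> - (1/2) * v" using v H by (intro mult_right_mono) auto
  ultimately have "- (1/2 + 1/H) * v + - ((v - H)\<^sup>2 / (2 * H)) \<le> 3 * H / 2 + (- 3/2) * v" by simp
  then have "exp (- (1/2 + 1/H) * v + - ((v - H)\<^sup>2 / (2 * H))) \<le> exp (3 * H / 2 + (- 3/2) * v)" by simp
  then show ?thesis using False by (simp only: smooth_weight_def powr_def exp_add v_def of_nat_eq_0_iff if_False)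
qed (simp add: smooth_weight_def)

lemma summable_smooth:
  assumes "H > 0"
  shows "summable (\<lambda>n. log_coeff n * smooth_weight H n)"
    and "(\<Sum>n. log_coeff n * smooth_weight H n) \<le> exp (3 * H / 2) * (\<Sum>n. real n powr (- 3/2))"
proof -
  have s: "summable (\<lambda>n. exp (3 * H / 2) * real n powr (- 3/2))"
    by (intro summable_mult) (subst summable_real_powr_iff, auto)
  have le: "log_coeff n * smooth_weight H n \<le> exp (3 * H / 2) * real n powr (- 3/2)" for n
  proof -
    have "log_coeff n * smooth_weight H n \<le> 1 * smooth_weight H n"
      by (intro mult_right_mono log_coeff_le_1 smooth_weight_nonneg)
    then show ?thesis using smooth_weight_le[OF assms, of n] by simp
  qed
  show *: "summable (\<lambda>n. log_coeff n * smooth_weight H n)"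
    by (rule summable_comparison_test'[OF s])
       (use le log_coeff_nonneg smooth_weight_nonneg in \<open>auto simp: abs_mult\<close>)
  have "(\<Sum>n. log_coeff n * smooth_weight H n) \<le> (\<Sum>n. exp (3 * H / 2) * real n powr (- 3/2))"
    by (rule suminf_le[OF le * s])
  also have "\<dots> = exp (3 * H / 2) * (\<Sum>n. real n powr (- 3/2))"
    by (rule suminf_mult) (subst summable_real_powr_iff, auto)
  finally show "(\<Sum>n. log_coeff n * smooth_weight H n) \<le> exp (3 * H / 2) * (\<Sum>n. real n powr (- 3/2))" .
qed

lemma of_nat_powr_exp: "n > 0 \<Longrightarrow> (of_nat n :: complex) powr s = exp (s * of_real (ln (real n)))"
  by (simp add: powr_def Ln_of_nat)

text \<open>The Gaussian at \<open>H\<close> enters \<open>kern_hat\<close> with the factor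
  \<open>\<i> * \<eta> / 2\<close>, which turns the imaginary part into a cosine and, with the outer
  \<open>\<eta>\<close>, makes the sign disappear. The Gaussians at 0 and \<open>- H\<close> go into
  the error.\<close>

lemma main_term_le:
  assumes H: "H \<ge> 1" and \<eta>: "\<eta> = 1 \<or> \<eta> = -1"
  shows "log_coeff n * smooth_weight H n * cos (t * ln (real n)) / 2 \<le>
    \<eta> * Im (of_real (log_coeff n) * of_nat n powr - Complex (1/2 + 1/H) t * kern_hat H \<eta> (ln (real n)))
    + 3/2 * exp (H / 4) * real n powr (- 11/10)"
proof (cases "n = 0")
  case False
  define v where "v = ln (real n)"
  have v: "v \<ge> 0" using False by (simp add: v_def)
  define a where "a = log_coeff n"
  have a: "0 \<le> a" "a \<le> 1" using log_coeff_nonneg log_coeff_le_1 by (auto simp: a_def)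
  define w where "w = exp (- (1/2 + 1/H) * v)"
  define e0 e1 e2 where "e0 = exp (- (v\<^sup>2 / (2 * H)))" and "e1 = exp (- ((H - v)\<^sup>2 / (2 * H)))"
    and "e2 = exp (- ((H + v)\<^sup>2 / (2 * H)))"
  have nw: "(of_nat n powr - Complex (1/2 + 1/H) t :: complex) = of_real w * cis (- (t * v))"
  proof -
    have "- Complex (1/2 + 1/H) t * of_real v = of_real (- (1/2 + 1/H) * v) + \<i> * of_real (- (t * v))"
      by (simp add: complex_eq_iff algebra_simps)
    then show ?thesis using False unfolding v_def w_def
      by (simp only: of_nat_powr_exp exp_add cis_conv_exp exp_of_real)
  qed
  have kh: "kern_hat H \<eta> v = of_real e0 + \<i> * of_real (\<eta> / 2 * (e1 - e2))"
  proof -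
    have "of_real \<eta> / (2 * \<i>) = - \<i> * of_real (\<eta> / 2)" by (simp add: complex_eq_iff Re_divide Im_divide)
    then show ?thesis unfolding kern_hat_def e0_def[symmetric] e1_def[symmetric] e2_def[symmetric]
      by (simp add: algebra_simps)
  qed
  have sw: "smooth_weight H n = w * e1"
    using False by (simp add: smooth_weight_def powr_def w_def v_def e1_def power2_commute)
  have \<eta>2: "\<eta> * \<eta> = 1" using \<eta> by auto
  have "\<eta> * Im (of_real a * (of_real w * cis (- (t * v))) * (of_real e0 + \<i> * of_real (\<eta> / 2 * (e1 - e2)))) =
     a * w * (\<eta> * \<eta> * cos (t * v) / 2 * (e1 - e2) - \<eta> * sin (t * v) * e0)"
    by (simp add: algebra_simps)
  also have "\<dots> = a * (w * e1) * cos (t * v) / 2 - a * w * (cos (t * v) / 2 * e2 + \<eta> * sin (t * v) * e0)"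
    unfolding \<eta>2 by (simp add: field_simps)
  finally have eq: "a * (w * e1) * cos (t * v) / 2 =
      \<eta> * Im (of_real a * (of_real w * cis (- (t * v))) * (of_real e0 + \<i> * of_real (\<eta> / 2 * (e1 - e2)))) +
      a * w * (cos (t * v) / 2 * e2 + \<eta> * sin (t * v) * e0)" by simp
  have "cos (t * v) / 2 * e2 + \<eta> * sin (t * v) * e0 \<le> 1 / 2 * e0 + 1 * e0"
  proof (intro add_mono mult_mono)
    show "cos (t * v) / 2 \<le> 1 / 2" by simp
    have "v\<^sup>2 \<le> (H + v)\<^sup>2" using v H by (intro power_mono) auto
    then have "v\<^sup>2 / (2 * H) \<le> (H + v)\<^sup>2 / (2 * H)" using H by (intro divide_right_mono) auto
    then show "e2 \<le> e0" by (simp add: e0_def e2_def)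
    have "\<bar>\<eta> * sin (t * v)\<bar> \<le> 1" using \<eta> by auto
    then show "\<eta> * sin (t * v) \<le> 1" by linarith
  qed (auto simp: e0_def e2_def)
  then have "a * w * (cos (t * v) / 2 * e2 + \<eta> * sin (t * v) * e0) \<le> a * w * (3/2 * e0)"
    using a by (intro mult_left_mono) (auto simp: w_def)
  also have "\<dots> \<le> 1 * w * (3/2 * e0)" using a by (intro mult_right_mono) (auto simp: w_def e0_def)
  also have "\<dots> = 3/2 * exp (- (1/2 + 1/H) * v + - (v\<^sup>2 / (2 * H)))" unfolding w_def e0_def exp_add by simp
  also have "\<dots> \<le> 3/2 * exp (H / 4 + (- 11/10) * v)"
  proof -
    \<comment> \<open>The tangent of slope \<open>3/5\<close>: with the \<open>1/2\<close> from the
      line it gives the exponent \<open>- 11/10\<close>, just summable, and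
      \<open>9/50 \<le> 1/4\<close> leaves \<open>exp (H / 4)\<close>.\<close>
    have "(3/5) * v - (9/50) * H \<le> v\<^sup>2 / (2 * H)"
    proof -
      have "0 \<le> (v - (3/5) * H)\<^sup>2" by simp
      then have "2 * H * ((3/5) * v - (9/50) * H) \<le> v\<^sup>2" by (simp add: power2_eq_square algebra_simps)
      then show ?thesis using H by (simp add: field_simps)
    qed
    moreover have "- (1/2 + 1/H) * v \<le> - (1/2) * v" using v H by (intro mult_right_mono) auto
    ultimately have "- (1/2 + 1/H) * v + - (v\<^sup>2 / (2 * H)) \<le> H / 4 + (- 11/10) * v" using H by linarith
    then show ?thesis by simp
  qed
  also have "\<dots> = 3/2 * exp (H / 4) * real n powr (- 11/10)"
    using False unfolding exp_add powr_def v_def by simp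
  finally show ?thesis using eq unfolding nw kh[symmetric] sw a_def[symmetric] v_def[symmetric] by linarith
qed (simp add: smooth_weight_def)

text \<open>Near the critical line the one-sided bound and the positivity of the kernel control the
  integral from above; on \<open>Re s = 2\<close> it is computed term by term. The window
  \<open>\<bar>u\<bar> \<le> 10\<close> makes the Gaussian at its ends
  \<open>exp (- 50 * H)\<close>, small against all powers of \<open>exp H\<close> that
  arise.\<close>

lemma (in zeta_log) smoothed_upper_bound:
  obtains C where "C > 0"
    "\<And>H \<eta> t V. 4 \<le> H \<Longrightarrow> \<eta> = 1 \<or> \<eta> = -1 \<Longrightarrow> 20 \<le> t \<Longrightarrow> ln (t + 10) \<le> exp H \<Longrightarrow> 0 \<le> V \<Longrightarrow>
       \<forall>u. \<bar>u\<bar> \<le> 10 \<longrightarrow> \<eta> * Im (L (Complex (1/2 + 1/H) (t + u))) \<le> V \<Longrightarrow>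
       (\<Sum>n. log_coeff n * smooth_weight H n * cos (t * ln (real n))) \<le> 4 * V + C * exp (H / 4)"
proof -
  obtain C1 where C1: "C1 > 0" "\<And>s. Re s > 1/2 \<Longrightarrow> Re s \<le> 2 \<Longrightarrow> Im s \<ge> 4 \<Longrightarrow> norm (L s) \<le> C1 * ln (Im s) / (Re s - 1/2)"
    using L_bound by blast
  define K2 where "K2 = (\<Sum>n. real n powr - 2)"
  have sK2: "summable (\<lambda>n. real n powr - 2)" by (subst summable_real_powr_iff) auto
  have K2: "K2 \<ge> 0" unfolding K2_def by (intro suminf_nonneg sK2) auto
  define K1 where "K1 = (\<Sum>n. real n powr (- 11/10))"
  have sK1: "summable (\<lambda>n. real n powr (- 11/10))" by (subst summable_real_powr_iff) auto
  have K1: "K1 \<ge> 0" unfolding K1_def by (intro suminf_nonneg sK1) auto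
  define C where "C = 2 * (6 * C1 + 4 * K2) + 3 * K1"
  have main: "(\<Sum>n. log_coeff n * smooth_weight H n * cos (t * ln (real n))) \<le> 4 * V + C * exp (H / 4)"
    if H: "4 \<le> H" and \<eta>: "\<eta> = 1 \<or> \<eta> = -1" and t: "20 \<le> t" "ln (t + 10) \<le> exp H" and V: "0 \<le> V"
      and LV: "\<forall>u. \<bar>u\<bar> \<le> 10 \<longrightarrow> \<eta> * Im (L (Complex (1/2 + 1/H) (t + u))) \<le> V" for H \<eta> t V
  proof -
    define \<sigma>0 where "\<sigma>0 = 1/2 + 1/H"
    define y where "y = 2 - \<sigma>0"
    define Q where "Q = {s::complex. Re s > 1/2 \<and> Im s > 0}"
    define f where "f s = L s * kern H \<eta> ((s - Complex \<sigma>0 t) / \<i>)" for s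
    define c0 where "c0 = sqrt (2 * pi / H)"
    define ind where "ind u = (indicator {- 10..10} u :: real)" for u
    have H0: "H > 0" and \<eta>1: "\<bar>\<eta>\<bar> = 1" using H \<eta> by auto
    have \<sigma>0: "1/2 < \<sigma>0" "\<sigma>0 \<le> 2" using H by (auto simp: \<sigma>0_def field_simps)
    have y: "0 \<le> y" "y \<le> 3/2" using \<sigma>0 by (auto simp: y_def)
    have c0: "c0 > 0" using H0 by (simp add: c0_def)
    have zarg: "(Complex \<sigma> (t + u) - Complex \<sigma>0 t) / \<i> = of_real u - \<i> * of_real (\<sigma> - \<sigma>0)" for \<sigma> u
      by (simp add: complex_eq_iff Re_divide Im_divide)
    have exp_le: "exp (a * H) \<le> 1" if "a \<le> 0" for a :: real
      using that H0 by (simp add: mult_nonpos_nonneg)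
    \<comment> \<open>At the ends of the window \<open>L\<close> contributes
      \<open>exp (2 * H)\<close>, the kernel \<open>exp (3 * H)\<close> and the Gaussian
      \<open>exp (- 50 * H)\<close>; the exponent 40 leaves some room.\<close>
    define E where "E = 2 * C1 * exp (- 40 * H)"
    have shift: "norm ((\<integral>u. indicator {- 10..10} u *\<^sub>R f (Complex \<sigma>0 (t + u)) \<partial>lborel) -
       (\<integral>u. indicator {- 10..10} u *\<^sub>R f (Complex 2 (t + u)) \<partial>lborel)) \<le> 2 * E * (2 - \<sigma>0)"
    proof (rule vertical_shift_bound[of Q])
      show "convex Q" "open Q" unfolding Q_def by (rule convex_quarter, rule open_quarter)
      have "L holomorphic_on Q" by (rule holomorphic_on_subset[OF L_holomorphic]) (auto simp: Q_def log_domain_def)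
      then show "f holomorphic_on Q" unfolding f_def kern_def by (intro holomorphic_intros) auto
      show "Complex \<sigma> (t + u) \<in> Q" if "\<sigma>0 \<le> \<sigma>" "- 10 \<le> u" for \<sigma> u
        using that \<sigma>0(1) t unfolding Q_def by simp
      fix \<sigma> u :: real assume \<sigma>: "\<sigma>0 \<le> \<sigma>" "\<sigma> \<le> 2" and u: "u = - 10 \<or> u = 10"
      have "norm (L (Complex \<sigma> (t + u))) \<le> C1 * ln (t + u) / (\<sigma> - 1/2)"
        using C1(2)[of "Complex \<sigma> (t + u)"] \<sigma> \<sigma>0 u t by auto
      also have "\<dots> \<le> C1 * exp H / (1 / H)"
      proof (intro frac_le mult_left_mono mult_nonneg_nonneg)
        have "ln (t + u) \<le> ln (t + 10)" using t u by (subst ln_le_cancel_iff) auto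
        then show "ln (t + u) \<le> exp H" using t by linarith
        show "1 / H \<le> \<sigma> - 1/2" using \<sigma> by (simp add: \<sigma>0_def)
      qed (use C1 H0 in auto)
      also have "\<dots> = C1 * exp H * H" by simp
      also have "\<dots> \<le> C1 * exp H * exp H"
      proof (intro mult_left_mono)
        show "H \<le> exp H" using exp_ge_add_one_self[of H] by linarith
      qed (use C1 in auto)
      finally have 1: "norm (L (Complex \<sigma> (t + u))) \<le> C1 * exp H * exp H" .
      have "norm (kern H \<eta> (of_real u - \<i> * of_real (\<sigma> - \<sigma>0))) \<le>
          2 * exp (3 * H) * exp (- (H * (Re (of_real u - \<i> * of_real (\<sigma> - \<sigma>0)))\<^sup>2 / 2))"
        using \<sigma> \<sigma>0 by (intro norm_kern_le H0 \<eta>1) auto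
      also have "\<dots> = 2 * exp (3 * H) * exp (- (H * 50))" using u by auto
      finally have 2: "norm (kern H \<eta> (of_real u - \<i> * of_real (\<sigma> - \<sigma>0))) \<le> 2 * exp (3 * H) * exp (- (H * 50))" .
      have "norm (f (Complex \<sigma> (t + u))) \<le> (C1 * exp H * exp H) * (2 * exp (3 * H) * exp (- (H * 50)))"
        unfolding f_def norm_mult zarg using C1 by (intro mult_mono 1 2) auto
      also have "\<dots> = 2 * C1 * exp (- 45 * H)" by (simp add: exp_add[symmetric])
      also have "\<dots> \<le> E" unfolding E_def using C1 H0 by (intro mult_left_mono) auto
      finally show "norm (f (Complex \<sigma> (t + u))) \<le> E" .
    qed (use \<sigma>0 in auto)
    define S0 S2 where "S0 = (\<integral>u. indicator {- 10..10} u *\<^sub>R f (Complex \<sigma>0 (t + u)) \<partial>lborel)"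
      and "S2 = (\<integral>u. indicator {- 10..10} u *\<^sub>R f (Complex 2 (t + u)) \<partial>lborel)"
    have fcont: "continuous_on {- 10..10} (\<lambda>u. f (Complex \<sigma> (t + u)))" if "\<sigma> > 1/2" for \<sigma>
    proof -
      have "f holomorphic_on Q" unfolding f_def kern_def
        by (intro holomorphic_intros holomorphic_on_subset[OF L_holomorphic]) (auto simp: Q_def log_domain_def)
      from holomorphic_on_imp_continuous_on[OF this] show ?thesis
        by (rule continuous_on_compose2) (use that t in \<open>auto simp: Q_def intro!: continuous_on_Complex continuous_intros\<close>)
    qed
    have fint: "integrable lborel (\<lambda>u. indicator {- 10..10} u *\<^sub>R f (Complex \<sigma> (t + u)))" if "\<sigma> > 1/2" for \<sigma>
      using borel_integrable_atLeastAtMost'[OF fcont[OF that]] by (simp add: set_integrable_def)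
    \<comment> \<open>The kernel lies between 0 and twice the Gaussian. Positivity lets the upper
      bound \<open>V\<close> pass under the integral, and \<open>V \<ge> 0\<close> allows the
      extension to the whole line.\<close>
    have S0V: "\<eta> * Im S0 \<le> 2 * V * c0"
    proof -
      have "has_bochner_integral lborel (\<lambda>u. \<eta> * Im (indicator {- 10..10} u *\<^sub>R f (Complex \<sigma>0 (t + u)))) (\<eta> * Im S0)"
        unfolding S0_def by (intro has_bochner_integral_mult_right has_bochner_integral_Im has_bochner_integral_integrable fint \<sigma>0)
      moreover have "has_bochner_integral lborel (\<lambda>u. 2 * V * exp (- (H * u\<^sup>2 / 2))) (2 * V * c0)"
        unfolding c0_def by (intro has_bochner_integral_mult_right gauss_real H0)
      moreover have "\<eta> * Im (indicator {- 10..10} u *\<^sub>R f (Complex \<sigma>0 (t + u))) \<le> 2 * V * exp (- (H * u\<^sup>2 / 2))" for u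
      proof (cases "u \<in> {- 10..10}")
        case True
        define k where "k = exp (- (H * u\<^sup>2 / 2)) * (1 - \<eta> * sin (H * u))"
        have "\<bar>\<eta> * sin (H * u)\<bar> \<le> 1" using \<eta> by auto
        then have k: "0 \<le> k" "k \<le> exp (- (H * u\<^sup>2 / 2)) * 2"
          unfolding k_def by (auto intro!: mult_nonneg_nonneg mult_left_mono simp: abs_le_iff)
        have "f (Complex \<sigma>0 (t + u)) = L (Complex \<sigma>0 (t + u)) * of_real k"
          unfolding f_def zarg k_def using kern_of_real[of H \<eta> u] by simp
        then have "\<eta> * Im (f (Complex \<sigma>0 (t + u))) = \<eta> * Im (L (Complex \<sigma>0 (t + u))) * k" by simp
        also have "\<dots> \<le> V * k" using LV True k by (intro mult_right_mono) (auto simp: \<sigma>0_def)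
        also have "\<dots> \<le> V * (exp (- (H * u\<^sup>2 / 2)) * 2)" using k V by (intro mult_left_mono) auto
        finally show ?thesis using True by simp
      qed (use V in auto)
      ultimately show ?thesis
        using integral_mono[of lborel "\<lambda>u. \<eta> * Im (indicator {- 10..10} u *\<^sub>R f (Complex \<sigma>0 (t + u)))"
            "\<lambda>u. 2 * V * exp (- (H * u\<^sup>2 / 2))"]
        by (auto simp: has_bochner_integral_iff)
    qed
    have S2S0: "\<eta> * Im S2 \<le> 2 * V * c0 + 3 * E"
    proof -
      have "E \<ge> 0" using C1 by (simp add: E_def)
      have "\<bar>Im (S0 - S2)\<bar> \<le> norm (S0 - S2)" by (rule abs_Im_le_cmod)
      also have "\<dots> \<le> 2 * E * (2 - \<sigma>0)" using shift by (simp add: S0_def S2_def)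
      also have "\<dots> \<le> 2 * E * (3/2)" using \<sigma>0 \<open>E \<ge> 0\<close> by (intro mult_left_mono) auto
      finally show ?thesis using S0V \<eta> by auto
    qed
    \<comment> \<open>\<open>h n\<close> is the term of index \<open>n\<close> on the line
      \<open>Re s = 2\<close>; \<open>m n\<close> is its integral without the factor
      \<open>c0\<close>, expressed on the line \<open>Re s = \<sigma>0\<close>.\<close>
    define h where "h n u = of_real (log_coeff n) * of_nat n powr - Complex 2 (t + u) * kern H \<eta> (of_real u - \<i> * of_real y)" for n u
    define m where "m n = of_real (log_coeff n) * of_nat n powr - Complex \<sigma>0 t * kern_hat H \<eta> (ln (real n))" for n
    have hm: "has_bochner_integral lborel (h n) (of_real c0 * m n)" for n
    proof (cases "n = 0")
      case False
      define v where "v = ln (real n)"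
      have "h n = (\<lambda>u. of_real (log_coeff n) * of_nat n powr - Complex \<sigma>0 t *
          (exp (- (\<i> * of_real v * (of_real u - \<i> * of_real y))) * kern H \<eta> (of_real u - \<i> * of_real y)))"
      proof
        fix u
        have "- Complex 2 (t + u) * of_real v = - Complex \<sigma>0 t * of_real v + - (\<i> * of_real v * (of_real u - \<i> * of_real y))"
          by (simp add: complex_eq_iff y_def algebra_simps)
        then have "of_nat n powr - Complex 2 (t + u) = of_nat n powr - Complex \<sigma>0 t * exp (- (\<i> * of_real v * (of_real u - \<i> * of_real y)))"
          using False by (simp only: of_nat_powr_exp v_def[symmetric] exp_add neq0_conv)
        then show "h n u = of_real (log_coeff n) * of_nat n powr - Complex \<sigma>0 t *
          (exp (- (\<i> * of_real v * (of_real u - \<i> * of_real y))) * kern H \<eta> (of_real u - \<i> * of_real y))"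
          unfolding h_def by (simp only: mult.assoc)
      qed
      moreover have "has_bochner_integral lborel (\<lambda>u. of_real (log_coeff n) * of_nat n powr - Complex \<sigma>0 t *
          (exp (- (\<i> * of_real v * (of_real u - \<i> * of_real y))) * kern H \<eta> (of_real u - \<i> * of_real y)))
          (of_real (log_coeff n) * of_nat n powr - Complex \<sigma>0 t * (of_real c0 * kern_hat H \<eta> v))"
        unfolding c0_def by (intro has_bochner_integral_mult_right kern_fourier H0)
      moreover have "of_real (log_coeff n) * of_nat n powr - Complex \<sigma>0 t * (of_real c0 * kern_hat H \<eta> v) = of_real c0 * m n"
        unfolding m_def v_def by (simp only: mult_ac)
      ultimately show ?thesis by (simp only:)
    next
      case True
      then have "h n = (\<lambda>u. 0)" "m n = 0" by (auto simp: h_def m_def fun_eq_iff)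
      then show ?thesis by (simp add: has_bochner_integral_iff)
    qed
    have kb: "norm (kern H \<eta> (of_real u - \<i> * of_real y)) \<le> 2 * exp (3 * H) * exp (- (H * u\<^sup>2 / 2))" for u
      using norm_kern_le[OF H0 \<eta>1, of "of_real u - \<i> * of_real y"] y by simp
    have powb: "norm (of_real (log_coeff n) * of_nat n powr - Complex 2 (t + u) :: complex) \<le> real n powr - 2" for n u
      unfolding norm_mult norm_of_nat_powr using log_coeff_nonneg[of n] log_coeff_le_1[of n]
      by (simp add: mult_left_le_one_le)
    \<comment> \<open>Finite sums are integrated exactly over the whole line. Inside the window the
      error is the tail of the series, small by the choice of \<open>M\<close>; outside it is
      \<open>K2\<close> times the tail of the kernel.\<close>
    have partial: "c0 * (\<eta> * Im (\<Sum>n<M. m n)) \<le> \<eta> * Im S2 + c0 * (2 * e * exp (3 * H) + 4 * K2)"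
      if e: "e > 0" and M: "norm (\<Sum>n. real (n + M) powr - 2) < e" for e M
    proof -
      define LM where "LM u = (\<Sum>n<M. of_real (log_coeff n) * of_nat n powr - Complex 2 (t + u) :: complex)" for u
      define g where "g u = 2 * exp (3 * H) * e * exp (- (H * u\<^sup>2 / 2)) + K2 * (2 * exp (- 22 * H)) * exp (- (H / 2 * u\<^sup>2 / 2))" for u
      have hs: "has_bochner_integral lborel (\<lambda>u. \<Sum>n<M. h n u) (\<Sum>n<M. of_real c0 * m n)"
        by (intro has_bochner_integral_sum hm)
      have hLM: "(\<Sum>n<M. h n u) = LM u * kern H \<eta> (of_real u - \<i> * of_real y)" for u
        by (simp add: h_def LM_def sum_distrib_right)
      have f2: "f (Complex 2 (t + u)) = log_series (Complex 2 (t + u)) * kern H \<eta> (of_real u - \<i> * of_real y)" for u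
        unfolding f_def zarg y_def by (simp add: L_eq_series)
      have LMK: "norm (LM u) \<le> K2" for u
      proof -
        have "norm (LM u) \<le> (\<Sum>n<M. real n powr - 2)" unfolding LM_def by (intro sum_norm_le powb)
        also have "\<dots> \<le> K2" unfolding K2_def by (intro sum_le_suminf sK2) auto
        finally show ?thesis .
      qed
      have Le: "norm (log_series (Complex 2 (t + u)) - LM u) \<le> e" for u
      proof -
        let ?t = "\<lambda>n. of_real (log_coeff n) * of_nat n powr - Complex 2 (t + u) :: complex"
        have sm: "summable ?t" using log_series_abs_summable[of "Complex 2 (t + u)"] by (auto dest: summable_norm_cancel)
        have "log_series (Complex 2 (t + u)) - LM u = (\<Sum>n. ?t (n + M))"
          unfolding log_series_def LM_def using suminf_split_initial_segment[OF sm, of M] by simp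
        also have "norm \<dots> \<le> (\<Sum>n. real (n + M) powr - 2)"
        proof (rule norm_suminf_le)
          show "norm (?t (n + M)) \<le> real (n + M) powr - 2" for n by (rule powb)
          show "summable (\<lambda>n. real (n + M) powr - 2)" by (subst summable_iff_shift) (rule sK2)
        qed
        also have "\<dots> \<le> e" using M by simp
        finally show ?thesis .
      qed
      have bound: "norm ((\<Sum>n<M. h n u) - indicator {- 10..10} u *\<^sub>R f (Complex 2 (t + u))) \<le> g u" for u
      proof (cases "u \<in> {- 10..10}")
        case True
        have "norm ((\<Sum>n<M. h n u) - indicator {- 10..10} u *\<^sub>R f (Complex 2 (t + u))) =
            norm (log_series (Complex 2 (t + u)) - LM u) * norm (kern H \<eta> (of_real u - \<i> * of_real y))"
          using True unfolding hLM f2 norm_mult[symmetric] by (simp add: norm_minus_commute left_diff_distrib)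
        also have "\<dots> \<le> e * (2 * exp (3 * H) * exp (- (H * u\<^sup>2 / 2)))" using e by (intro mult_mono Le kb) auto
        also have "\<dots> \<le> g u" unfolding g_def using K2 by (simp add: mult_ac)
        finally show ?thesis .
      next
        case False
        then have "\<bar>u\<bar> \<ge> 10" by auto
        then have "\<bar>u\<bar>\<^sup>2 \<ge> 10\<^sup>2" by (intro power_mono) auto
        then have "H * 100 \<le> H * u\<^sup>2" using H0 by simp
        \<comment> \<open>Half of the exponent provides the constant \<open>- 25 * H\<close>, the
          other half stays integrable.\<close>
        then have "- (H * u\<^sup>2 / 2) \<le> - 25 * H + - (H / 2 * u\<^sup>2 / 2)" by simp
        then have "exp (- (H * u\<^sup>2 / 2)) \<le> exp (- 25 * H) * exp (- (H / 2 * u\<^sup>2 / 2))"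
          unfolding exp_add[symmetric] by simp
        then have "2 * exp (3 * H) * exp (- (H * u\<^sup>2 / 2)) \<le> 2 * exp (3 * H) * (exp (- 25 * H) * exp (- (H / 2 * u\<^sup>2 / 2)))"
          by (intro mult_left_mono) auto
        also have "\<dots> = 2 * exp (- 22 * H) * exp (- (H / 2 * u\<^sup>2 / 2))" by (simp add: exp_add[symmetric])
        finally have k2: "2 * exp (3 * H) * exp (- (H * u\<^sup>2 / 2)) \<le> 2 * exp (- 22 * H) * exp (- (H / 2 * u\<^sup>2 / 2))" .
        have "norm ((\<Sum>n<M. h n u) - indicator {- 10..10} u *\<^sub>R f (Complex 2 (t + u))) = norm (LM u) * norm (kern H \<eta> (of_real u - \<i> * of_real y))"
          using False unfolding hLM by (simp add: norm_mult)
        also have "\<dots> \<le> K2 * (2 * exp (- 22 * H) * exp (- (H / 2 * u\<^sup>2 / 2)))"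
          using K2 order.trans[OF kb k2] by (intro mult_mono LMK) auto
        also have "\<dots> \<le> g u" unfolding g_def using e by simp
        finally show ?thesis .
      qed
      have hg: "has_bochner_integral lborel g (2 * exp (3 * H) * e * c0 + K2 * (2 * exp (- 22 * H)) * sqrt (2 * pi / (H / 2)))"
        unfolding g_def c0_def using H0 by (intro has_bochner_integral_add has_bochner_integral_mult_right gauss_real) auto
      have "norm ((\<Sum>n<M. of_real c0 * m n) - S2) \<le> 2 * exp (3 * H) * e * c0 + K2 * (2 * exp (- 22 * H)) * sqrt (2 * pi / (H / 2))"
      proof -
        have hd: "has_bochner_integral lborel (\<lambda>u. (\<Sum>n<M. h n u) - indicator {- 10..10} u *\<^sub>R f (Complex 2 (t + u)))
            ((\<Sum>n<M. of_real c0 * m n) - S2)"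
          unfolding S2_def by (intro has_bochner_integral_diff hs has_bochner_integral_integrable fint) simp
        show ?thesis
          using Bochner_Integration.integral_norm_bound_integral[OF integrable.intros[OF hd] integrable.intros[OF hg] bound]
          unfolding has_bochner_integral_integral_eq[OF hd] has_bochner_integral_integral_eq[OF hg] .
      qed
      also have "sqrt (2 * pi / (H / 2)) = sqrt 2 * c0" by (simp add: c0_def real_sqrt_mult real_sqrt_divide)
      also have "2 * exp (3 * H) * e * c0 + K2 * (2 * exp (- 22 * H)) * (sqrt 2 * c0) =
          c0 * (2 * e * exp (3 * H) + K2 * (2 * exp (- 22 * H)) * sqrt 2)" by (simp add: algebra_simps)
      also have "\<dots> \<le> c0 * (2 * e * exp (3 * H) + K2 * (2 * 1) * 2)"
      proof (intro mult_left_mono add_left_mono mult_mono)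
        show "exp (- 22 * H) \<le> 1" using exp_le[of "- 22"] by simp
        show "sqrt 2 \<le> (2::real)" by (rule real_le_lsqrt) auto
      qed (use K2 c0 in auto)
      finally have "norm ((\<Sum>n<M. of_real c0 * m n) - S2) \<le> c0 * (2 * e * exp (3 * H) + 4 * K2)" by (simp add: mult_ac)
      then have "\<bar>Im ((\<Sum>n<M. of_real c0 * m n) - S2)\<bar> \<le> c0 * (2 * e * exp (3 * H) + 4 * K2)"
        using abs_Im_le_cmod order.trans by blast
      moreover have "(\<Sum>n<M. of_real c0 * m n) = of_real c0 * (\<Sum>n<M. m n)" by (simp add: sum_distrib_left)
      ultimately have "\<bar>c0 * Im (\<Sum>n<M. m n) - Im S2\<bar> \<le> c0 * (2 * e * exp (3 * H) + 4 * K2)" by simp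
      then show ?thesis using \<eta> by (auto simp: abs_le_iff)
    qed
    let ?b = "\<lambda>n. log_coeff n * smooth_weight H n * cos (t * ln (real n))"
    have sb: "summable ?b"
      by (rule summable_comparison_test'[OF summable_smooth(1)[OF H0]])
         (use log_coeff_nonneg smooth_weight_nonneg in \<open>auto simp: abs_mult mult_left_le\<close>)
    \<comment> \<open>The factor \<open>c0\<close> is divided out in the end; because
      \<open>c0 \<ge> 1 / H\<close>, the exponentially small \<open>E\<close> remains
      bounded.\<close>
    have c0E: "3 * E \<le> c0 * (6 * C1)"
    proof -
      have "1 \<le> c0 * exp (40 * H)"
      proof -
        have "1 / H \<le> c0"
        proof -
          have "1 / H \<le> sqrt (1 / H)" using H
            by (intro real_le_rsqrt) (auto simp: power2_eq_square field_simps)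
          also have "\<dots> \<le> c0" unfolding c0_def using H0 pi_ge_two by (intro real_sqrt_le_mono divide_right_mono) auto
          finally show ?thesis .
        qed
        moreover have "H \<le> exp (40 * H)" using exp_ge_add_one_self[of "40 * H"] H0 by linarith
        ultimately have "1 / H * H \<le> c0 * exp (40 * H)" using H0 c0 by (intro mult_mono) auto
        then show ?thesis using H0 by simp
      qed
      then have "exp (- 40 * H) * 1 \<le> exp (- 40 * H) * (c0 * exp (40 * H))" by (intro mult_left_mono) auto
      also have "\<dots> = c0" by (simp add: exp_minus)
      finally have "exp (- 40 * H) \<le> c0" by simp
      then show ?thesis unfolding E_def using C1 by simp
    qed
    have "suminf ?b \<le> 4 * V + C * exp (H / 4)"
    proof (rule field_le_epsilon)
      fix d :: real assume d: "d > 0"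
      define e where "e = d / (8 * exp (3 * H))"
      have e: "e > 0" using d by (simp add: e_def)
      obtain M0 where M0: "\<And>M. M \<ge> M0 \<Longrightarrow> norm (\<Sum>n. real (n + M) powr - 2) < e"
        using suminf_exist_split[OF e sK2] by auto
      obtain M1 where M1: "\<And>M. M \<ge> M1 \<Longrightarrow> norm (\<Sum>n. ?b (n + M)) < d / 2"
        using suminf_exist_split[OF _ sb, of "d / 2"] d by auto
      define M where "M = max M0 M1"
      have "c0 * (\<eta> * Im (\<Sum>n<M. m n)) \<le> \<eta> * Im S2 + c0 * (2 * e * exp (3 * H) + 4 * K2)"
        by (rule partial[OF e M0]) (simp add: M_def)
      also have "\<dots> \<le> c0 * (2 * V + 6 * C1 + 2 * e * exp (3 * H) + 4 * K2)"
        using S2S0 c0E by (simp add: algebra_simps)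
      finally have 1: "\<eta> * Im (\<Sum>n<M. m n) \<le> 2 * V + 6 * C1 + 2 * e * exp (3 * H) + 4 * K2"
        using c0 by (subst (asm) mult_le_cancel_left_pos) auto
      \<comment> \<open>The main term appears with the factor \<open>1/2\<close>, which turns
        \<open>2 * V\<close> into \<open>4 * V\<close>.\<close>
      have "(\<Sum>n<M. ?b n / 2) \<le> (\<Sum>n<M. \<eta> * Im (m n) + 3/2 * exp (H / 4) * real n powr (- 11/10))"
        unfolding m_def \<sigma>0_def using H by (intro sum_mono main_term_le \<eta>) auto
      also have "\<dots> = \<eta> * Im (\<Sum>n<M. m n) + 3/2 * exp (H / 4) * (\<Sum>n<M. real n powr (- 11/10))"
        by (simp add: sum.distrib sum_distrib_left)
      also have "(\<Sum>n<M. real n powr (- 11/10)) \<le> K1" unfolding K1_def by (intro sum_le_suminf sK1) auto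
      finally have "(\<Sum>n<M. ?b n / 2) \<le> 2 * V + 6 * C1 + 2 * e * exp (3 * H) + 4 * K2 + 3/2 * exp (H / 4) * K1"
        using 1 by simp
      moreover have "(\<Sum>n<M. ?b n / 2) = (\<Sum>n<M. ?b n) / 2" by (rule sum_divide_distrib[symmetric])
      moreover have "suminf ?b = (\<Sum>n. ?b (n + M)) + (\<Sum>n<M. ?b n)" by (rule suminf_split_initial_segment[OF sb])
      moreover have "(\<Sum>n. ?b (n + M)) < d / 2" using M1[of M] by (simp add: M_def abs_less_iff)
      moreover have "2 * e * exp (3 * H) = d / 4" by (simp add: e_def)
      ultimately have 2: "suminf ?b \<le> 4 * V + 2 * (6 * C1 + 4 * K2) + 3 * K1 * exp (H / 4) + d" by simp
      have "2 * (6 * C1 + 4 * K2) * 1 \<le> 2 * (6 * C1 + 4 * K2) * exp (H / 4)"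
        using C1 K2 H0 by (intro mult_left_mono) auto
      then show "suminf ?b \<le> 4 * V + C * exp (H / 4) + d" using 2 by (simp add: C_def algebra_simps)
    qed
    then show ?thesis .
  qed
  have "C > 0" using C1 K1 K2 by (simp add: C_def add_pos_nonneg)
  then show ?thesis by (rule that) (rule main)
qed

section \<open>Large values of the argument\<close>

text \<open>Here \<open>Y\<close> stands for \<open>ln T\<close>. An arbitrary nonnegative bound
  \<open>M\<close> replaces the supremum, which need not be known to be finite.\<close>

lemma (in zeta_log) zeta_S_large:
  fixes \<beta> :: real
  assumes \<beta>: "0 < \<beta>" "\<beta> < 1"
  shows "\<exists>c>0. \<forall>\<^sub>F Y in at_top. \<forall>\<eta> M. (\<eta> = 1 \<or> \<eta> = -1) \<longrightarrow> 0 \<le> M \<longrightarrow>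
     (\<forall>t\<in>{exp (\<beta> * Y)..exp Y}. \<eta> * zeta_S t \<le> M) \<longrightarrow> c * sqrt (Y * ln (ln Y) / ln Y) \<le> M"
proof -
  \<comment> \<open>The width \<open>\<tau>\<close> is away from both ends of the interval by the
    factor \<open>exp (2 * \<kappa> * Y)\<close>. With at most \<open>exp (\<kappa> * Y)\<close>
    bins the error from small \<open>t\<close> is still of order
    \<open>exp (- (\<kappa> * Y))\<close>.\<close>
  define \<kappa> where "\<kappa> = (1 - \<beta>) / 4"
  have \<kappa>: "0 < \<kappa>" "\<kappa> \<le> 1" using \<beta> by (auto simp: \<kappa>_def)
  obtain CA where CA: "CA > 0" and Lbound: "\<And>\<eta> A B M s. \<eta> = 1 \<or> \<eta> = -1 \<Longrightarrow> 4 \<le> A \<Longrightarrow> 4 \<le> B \<Longrightarrow> 0 \<le> M \<Longrightarrow>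
       \<forall>t\<in>{A..B}. \<eta> * zeta_S t \<le> M \<Longrightarrow> 1/2 < Re s \<Longrightarrow> Re s \<le> 3/2 \<Longrightarrow> A + 1 + ln B \<le> Im s \<Longrightarrow>
       Im s \<le> B - 1 - ln B \<Longrightarrow> \<eta> * Im (L s) \<le> pi * M + CA"
    by (rule Im_L_bound) (rule that, assumption, blast)
  obtain CB where CB: "CB > 0" and Dbound: "\<And>H \<eta> t V. 4 \<le> H \<Longrightarrow> \<eta> = 1 \<or> \<eta> = -1 \<Longrightarrow> 20 \<le> t \<Longrightarrow>
       ln (t + 10) \<le> exp H \<Longrightarrow> 0 \<le> V \<Longrightarrow> \<forall>u. \<bar>u\<bar> \<le> 10 \<longrightarrow> \<eta> * Im (L (Complex (1/2 + 1/H) (t + u))) \<le> V \<Longrightarrow>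
       (\<Sum>n. log_coeff n * smooth_weight H n * cos (t * ln (real n))) \<le> 4 * V + CB * exp (H / 4)"
    by (rule smoothed_upper_bound) (rule that, assumption, blast)
  obtain c3 where c3: "c3 > 0" and groups: "\<forall>\<^sub>F Y in at_top. \<exists>(I::(nat \<times> nat) set) G. finite I \<and> disjoint_family_on G I \<and>
      (\<forall>i\<in>I. finite (G i) \<and> G i \<noteq> {} \<and> (\<forall>p\<in>G i. prime p)) \<and>
      real (\<Prod>i\<in>I. card (G i) + 1) \<le> exp (\<kappa> * Y) \<and>
      (\<Sum>i\<in>I. \<Sum>p\<in>G i. smooth_weight (ln Y) p / sqrt (real (card (G i)))) \<ge>
        c3 * sqrt (Y * ln (ln Y) / ln Y)"
    using prime_groups[OF \<kappa>] by (elim exE conjE) (rule that)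
  define K where "K = (\<Sum>n. real n powr (- 3/2))"
  have K0: "K \<ge> 0" unfolding K_def by (intro suminf_nonneg) (auto intro: summable_real_powr_iff[THEN iffD2])
  define c4 where "c4 = exp (- 1 / 2) * c3 / 4"
  have c4: "c4 > 0" using c3 by (simp add: c4_def)
  have "\<forall>\<^sub>F Y::real in at_top. ln Y \<ge> 4" by real_asymp
  moreover have "\<forall>\<^sub>F Y::real in at_top. exp (\<beta> * Y) \<ge> Y + 20" using \<beta> by real_asymp
  moreover have "\<forall>\<^sub>F Y::real in at_top. exp Y / 2 \<ge> Y + 11" by real_asymp
  \<comment> \<open>The error of the resonance inequality: \<open>Y powr (3/2) * K\<close> bounds
    the sum of all coefficients, and the two exponentials belong to small and to large
    \<open>\<bar>t\<bar>\<close>.\<close>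
  moreover have "\<forall>\<^sub>F Y::real in at_top. Y powr (3/2) * K * (2 * exp (- (\<kappa> * Y)) + 2 * exp (\<kappa> * Y - exp (4 * \<kappa> * Y) / 16)) \<le> 1"
  proof -
    have "((\<lambda>Y::real. Y powr (3/2) * K * (2 * exp (- (\<kappa> * Y)) + 2 * exp (\<kappa> * Y - exp (4 * \<kappa> * Y) / 16))) \<longlongrightarrow> 0) at_top"
    proof -
      have "((\<lambda>Y::real. Y powr (3/2) * (2 * exp (- (\<kappa> * Y)) + 2 * exp (\<kappa> * Y - exp (4 * \<kappa> * Y) / 16))) \<longlongrightarrow> 0) at_top"
        using \<kappa> by real_asymp
      from tendsto_mult_left[OF this, of K] show ?thesis by (simp add: mult_ac)
    qed
    then have "\<forall>\<^sub>F Y in at_top. Y powr (3/2) * K * (2 * exp (- (\<kappa> * Y)) + 2 * exp (\<kappa> * Y - exp (4 * \<kappa> * Y) / 16)) < 1"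
      by (rule order_tendstoD) simp
    then show ?thesis by eventually_elim simp
  qed
  moreover have "\<forall>\<^sub>F Y::real in at_top. 24 * CA + 6 * CB * Y powr (1/4) + 1 \<le> c4 * sqrt (Y * ln (ln Y) / ln Y)"
    using CA CB c4 by real_asymp
  moreover have "\<forall>\<^sub>F Y::real in at_top. Y > 0" by real_asymp
  ultimately have "\<forall>\<^sub>F Y in at_top. \<forall>\<eta> M. (\<eta> = 1 \<or> \<eta> = -1) \<longrightarrow> 0 \<le> M \<longrightarrow>
     (\<forall>t\<in>{exp (\<beta> * Y)..exp Y}. \<eta> * zeta_S t \<le> M) \<longrightarrow> c4 / (24 * pi) * sqrt (Y * ln (ln Y) / ln Y) \<le> M"
    using groups
  proof eventually_elim
    case (elim Y)
    define H where "H = ln Y"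
    have H4: "4 \<le> H" using elim(1) by (simp add: H_def)
    have Y0: "Y > 0" by (rule elim(6))
    show ?case
    proof (intro allI impI)
      fix \<eta> M :: real
      assume \<eta>: "\<eta> = 1 \<or> \<eta> = -1" and M: "0 \<le> M" and S: "\<forall>t\<in>{exp (\<beta> * Y)..exp Y}. \<eta> * zeta_S t \<le> M"
      have eH: "exp H = Y" using Y0 by (simp add: H_def)
      \<comment> \<open>The factors 2 leave room for the window
        \<open>\<bar>u\<bar> \<le> 10\<close> and for the margin \<open>1 + ln (exp Y)\<close> that
        \<open>Lbound\<close> demands at the corners.\<close>
      define T1 where "T1 = 2 * exp (\<beta> * Y)"
      define T2 where "T2 = exp Y / 2"
      define \<tau> where "\<tau> = exp ((1 + \<beta>) / 2 * Y)"
      define V where "V = 4 * (pi * M + CA) + CB * exp (H / 4)"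
      define b where "b n = log_coeff n * smooth_weight H n" for n
      have V0: "V \<ge> 0" using M CA CB by (simp add: V_def)
      have D: "(\<Sum>n. b n * cos (t * ln (real n))) \<le> V" if t: "T1 \<le> t" "t \<le> T2" for t
        unfolding b_def V_def
      proof (rule Dbound[OF H4 \<eta>])
        show "20 \<le> t" using t elim(2) Y0 by (simp add: T1_def)
        have "t + 10 \<le> exp Y" using t elim(3) Y0 by (simp add: T2_def)
        moreover have "t + 10 > 0" using \<open>20 \<le> t\<close> by simp
        ultimately have "ln (t + 10) \<le> ln (exp Y)" by (subst ln_le_cancel_iff) auto
        then show "ln (t + 10) \<le> exp H" by (simp add: eH)
        show "0 \<le> pi * M + CA" using M CA by simp
        show "\<forall>u. \<bar>u\<bar> \<le> 10 \<longrightarrow> \<eta> * Im (L (Complex (1/2 + 1/H) (t + u))) \<le> pi * M + CA"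
        proof (intro allI impI)
          fix u :: real assume u: "\<bar>u\<bar> \<le> 10"
          show "\<eta> * Im (L (Complex (1/2 + 1/H) (t + u))) \<le> pi * M + CA"
          proof (rule Lbound[OF \<eta> _ _ M S])
            show "4 \<le> exp (\<beta> * Y)" using elim(2) Y0 by linarith
            show "4 \<le> exp Y" using elim(3) Y0 by linarith
            show "1/2 < Re (Complex (1/2 + 1/H) (t + u))" "Re (Complex (1/2 + 1/H) (t + u)) \<le> 3/2"
              using H4 by (auto simp: field_simps)
            show "exp (\<beta> * Y) + 1 + ln (exp Y) \<le> Im (Complex (1/2 + 1/H) (t + u))"
              using t u elim(2) by (simp add: T1_def abs_le_iff)
            show "Im (Complex (1/2 + 1/H) (t + u)) \<le> exp Y - 1 - ln (exp Y)"
              using t u elim(3) by (simp add: T2_def abs_le_iff)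
          qed
        qed
      qed
      obtain I :: "(nat \<times> nat) set" and G where I: "finite I" "disjoint_family_on G I"
        and G: "\<forall>i\<in>I. finite (G i) \<and> G i \<noteq> {} \<and> (\<forall>p\<in>G i. prime p)"
        and N: "real (\<Prod>i\<in>I. card (G i) + 1) \<le> exp (\<kappa> * Y)"
        and gain: "c3 * sqrt (Y * ln (ln Y) / ln Y) \<le> (\<Sum>i\<in>I. \<Sum>p\<in>G i. smooth_weight H p / sqrt (real (card (G i))))"
        using elim(7) unfolding H_def by blast
      have G': "\<And>i. i \<in> I \<Longrightarrow> finite (G i) \<and> G i \<noteq> {} \<and> (\<forall>p\<in>G i. p > 1)"
        using G prime_gt_1_nat by blast
      have "\<exists>(J::int set) r. finite J \<and> card J \<le> (\<Prod>i\<in>I. card (G i) + 1) \<and> (\<forall>j. r j \<ge> 0) \<and>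
        (\<Sum>j\<in>J. (r j)\<^sup>2) = 1 \<and>
        (\<forall>i\<in>I. \<forall>p\<in>G i. exp (- 1 / 2) / (2 * sqrt (real (card (G i)))) \<le>
           (\<Sum>j\<in>J. \<Sum>k\<in>J. r j * r k * exp (- (\<tau> * ln (real p) + of_int (j - k))\<^sup>2 / 2)))"
        using I(1) G' by (rule resonator_exists)
      then obtain J :: "int set" and r where J: "finite J" "card J \<le> (\<Prod>i\<in>I. card (G i) + 1)"
        and r: "\<forall>j. r j \<ge> 0" "(\<Sum>j\<in>J. (r j)\<^sup>2) = 1"
        and c: "\<forall>i\<in>I. \<forall>p\<in>G i. exp (- 1 / 2) / (2 * sqrt (real (card (G i)))) \<le>
           (\<Sum>j\<in>J. \<Sum>k\<in>J. r j * r k * exp (- (\<tau> * ln (real p) + of_int (j - k))\<^sup>2 / 2))"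
        by (elim exE conjE) (rule that)
      define C where "C n = (\<Sum>j\<in>J. \<Sum>k\<in>J. r j * r k * exp (- (\<tau> * ln (real n) + of_int (j - k))\<^sup>2 / 2))" for n :: nat
      define F where "F = (\<Union>i\<in>I. G i)"
      have H0: "H > 0" using H4 by simp
      have b0: "b n \<ge> 0" for n unfolding b_def using log_coeff_nonneg smooth_weight_nonneg by simp
      have "(\<Sum>n\<in>F. b n * C n) \<le> 6 * V + suminf b * exp (\<kappa> * Y) * (T1 / \<tau> + 2 * exp (- (T2\<^sup>2 / (4 * \<tau>\<^sup>2))))"
        unfolding C_def
      proof (rule resonance_inequality)
        have "real (card J) \<le> real (\<Prod>i\<in>I. card (G i) + 1)" using J(2) by (subst of_nat_le_iff)
        then show "real (card J) \<le> exp (\<kappa> * Y)" using N by simp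
        show "summable b" unfolding b_def by (rule summable_smooth(1)[OF H0])
        show "finite F" unfolding F_def using I G by auto
      qed (use J r V0 b0 D in \<open>auto simp: T1_def T2_def \<tau>_def\<close>)
      also have "suminf b * exp (\<kappa> * Y) * (T1 / \<tau> + 2 * exp (- (T2\<^sup>2 / (4 * \<tau>\<^sup>2)))) \<le> 1"
      proof -
        have "suminf b \<le> exp (3 * H / 2) * K" unfolding b_def K_def by (rule summable_smooth(2)[OF H0])
        also have "exp (3 * H / 2) = Y powr (3/2)" using Y0 by (simp add: powr_def H_def)
        finally have sb: "suminf b \<le> Y powr (3/2) * K" .
        have "exp (\<kappa> * Y) * (T1 / \<tau> + 2 * exp (- (T2\<^sup>2 / (4 * \<tau>\<^sup>2)))) =
            2 * exp (- (\<kappa> * Y)) + 2 * exp (\<kappa> * Y - exp (4 * \<kappa> * Y) / 16)"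
        proof -
          have "exp (\<kappa> * Y) * (T1 / \<tau>) = 2 * exp (\<kappa> * Y + \<beta> * Y - (1 + \<beta>) / 2 * Y)"
            by (simp add: T1_def \<tau>_def exp_add exp_diff)
          also have "\<kappa> * Y + \<beta> * Y - (1 + \<beta>) / 2 * Y = - (\<kappa> * Y)" by (simp add: \<kappa>_def field_simps)
          finally have 1: "exp (\<kappa> * Y) * (T1 / \<tau>) = 2 * exp (- (\<kappa> * Y))" .
          have "T2\<^sup>2 / (4 * \<tau>\<^sup>2) = exp (Y + Y - ((1 + \<beta>) / 2 * Y + (1 + \<beta>) / 2 * Y)) / 16"
            unfolding exp_diff exp_add by (simp add: T2_def \<tau>_def power2_eq_square)
          also have "Y + Y - ((1 + \<beta>) / 2 * Y + (1 + \<beta>) / 2 * Y) = 4 * \<kappa> * Y" by (simp add: \<kappa>_def field_simps)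
          finally have 2: "T2\<^sup>2 / (4 * \<tau>\<^sup>2) = exp (4 * \<kappa> * Y) / 16" .
          have "exp (\<kappa> * Y) * (2 * exp (- (exp (4 * \<kappa> * Y) / 16))) = 2 * exp (\<kappa> * Y - exp (4 * \<kappa> * Y) / 16)"
            by (simp add: exp_add[symmetric])
          then show ?thesis unfolding distrib_left 1 2 by simp
        qed
        then have "suminf b * exp (\<kappa> * Y) * (T1 / \<tau> + 2 * exp (- (T2\<^sup>2 / (4 * \<tau>\<^sup>2)))) =
            suminf b * (2 * exp (- (\<kappa> * Y)) + 2 * exp (\<kappa> * Y - exp (4 * \<kappa> * Y) / 16))" by (simp only: mult.assoc)
        also have "\<dots> \<le> Y powr (3/2) * K * (2 * exp (- (\<kappa> * Y)) + 2 * exp (\<kappa> * Y - exp (4 * \<kappa> * Y) / 16))"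
          by (intro mult_right_mono sb) auto
        also have "\<dots> \<le> 1" by (rule elim(4))
        finally show ?thesis .
      qed
      also have "(\<Sum>n\<in>F. b n * C n) = (\<Sum>i\<in>I. \<Sum>p\<in>G i. b p * C p)"
        unfolding F_def using I G by (intro sum.UNION_disjoint) (auto simp: disjoint_family_on_def)
      finally have upper: "(\<Sum>i\<in>I. \<Sum>p\<in>G i. b p * C p) \<le> 6 * V + 1" by simp
      have "2 * c4 * sqrt (Y * ln (ln Y) / ln Y) = exp (- 1 / 2) / 2 * (c3 * sqrt (Y * ln (ln Y) / ln Y))"
        by (simp add: c4_def)
      also have "\<dots> \<le> exp (- 1 / 2) / 2 * (\<Sum>i\<in>I. \<Sum>p\<in>G i. smooth_weight H p / sqrt (real (card (G i))))"
        using gain by (intro mult_left_mono) auto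
      also have "\<dots> = (\<Sum>i\<in>I. \<Sum>p\<in>G i. smooth_weight H p * (exp (- 1 / 2) / (2 * sqrt (real (card (G i))))))"
        by (simp add: sum_distrib_left mult_ac)
      also have "\<dots> \<le> (\<Sum>i\<in>I. \<Sum>p\<in>G i. b p * C p)"
      proof (intro sum_mono)
        fix i p assume ip: "i \<in> I" "p \<in> G i"
        then have "b p = smooth_weight H p" using G by (simp add: b_def log_coeff_prime)
        then show "smooth_weight H p * (exp (- 1 / 2) / (2 * sqrt (real (card (G i))))) \<le> b p * C p"
          unfolding C_def by (simp only:) (intro mult_left_mono c[rule_format] ip smooth_weight_nonneg)
      qed
      also note upper
      \<comment> \<open>\<open>exp (H / 4)\<close> is only \<open>Y powr (1/4)\<close>; half of the
        gain \<open>2 * c4\<close> absorbs it together with the constants.\<close>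
      also have "6 * V + 1 = 24 * pi * M + (24 * CA + 6 * CB * exp (H / 4) + 1)" by (simp add: V_def)
      also have "exp (H / 4) = Y powr (1/4)" using Y0 by (simp add: powr_def H_def)
      finally have "c4 * sqrt (Y * ln (ln Y) / ln Y) \<le> 24 * pi * M" using elim(5) by linarith
      then show "c4 / (24 * pi) * sqrt (Y * ln (ln Y) / ln Y) \<le> M" by (simp add: field_simps)
    qed
  qed
  then show ?thesis using c4 by (intro exI[of _ "c4 / (24 * pi)"]) auto
qed

text \<open>If the supremum were below \<open>B / 2\<close>, then \<open>M = B / 2\<close> would be
  an admissible bound and \<open>B \<le> B / 2\<close> would follow. The halving turns bounds for
  \<open>M\<close> into a statement about \<open>ereal\<close> suprema, infinite ones
  included.\<close>

lemma SUP_ereal_ge_half: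
  fixes f :: "real \<Rightarrow> real"
  assumes B: "B > 0" and f: "\<And>M. 0 \<le> M \<Longrightarrow> \<forall>t\<in>A. f t \<le> M \<Longrightarrow> B \<le> M"
  shows "(SUP t\<in>A. ereal (f t)) \<ge> ereal (B / 2)"
proof (rule ccontr)
  assume "\<not> ?thesis"
  then have lt: "(SUP t\<in>A. ereal (f t)) < ereal (B / 2)" by simp
  have "f t \<le> B / 2" if "t \<in> A" for t
  proof -
    have "ereal (f t) \<le> (SUP t\<in>A. ereal (f t))" using that by (rule SUP_upper)
    then have "ereal (f t) < ereal (B / 2)" using lt by (rule order.strict_trans1)
    then show ?thesis by simp
  qed
  then have "B \<le> B / 2" using B by (intro f) auto
  then show False using B by simp
qed

theorem theorem1:
  fixes \<beta> :: real
  assumes "riemann_hypothesis"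
    and "0 < \<beta>" and "\<beta> < 1"
  shows "\<exists>c::real. c > 0 \<and> (\<forall>\<^sub>F T::real in at_top.
           (SUP t\<in>{T powr \<beta>..T}. ereal (zeta_S t))
              \<ge> ereal (c * sqrt (ln T * ln (ln (ln T)) / ln (ln T))) \<and>
           (SUP t\<in>{T powr \<beta>..T}. ereal (- zeta_S t))
              \<ge> ereal (c * sqrt (ln T * ln (ln (ln T)) / ln (ln T))))"
proof -
  obtain L where "zeta_log L" using zeta_log_exists[OF assms(1)] .
  then interpret zeta_log L .
  obtain c where c: "c > 0" and ev: "\<forall>\<^sub>F Y in at_top. \<forall>\<eta> M. (\<eta> = 1 \<or> \<eta> = -1) \<longrightarrow> 0 \<le> M \<longrightarrow>
     (\<forall>t\<in>{exp (\<beta> * Y)..exp Y}. \<eta> * zeta_S t \<le> M) \<longrightarrow> c * sqrt (Y * ln (ln Y) / ln Y) \<le> M"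
    using zeta_S_large[OF assms(2,3)] by blast
  have "\<forall>\<^sub>F T in at_top. \<forall>\<eta> M. (\<eta> = 1 \<or> \<eta> = -1) \<longrightarrow> 0 \<le> M \<longrightarrow>
     (\<forall>t\<in>{exp (\<beta> * ln T)..exp (ln T)}. \<eta> * zeta_S t \<le> M) \<longrightarrow> c * sqrt (ln T * ln (ln (ln T)) / ln (ln T)) \<le> M"
    using ev ln_at_top by (rule eventually_compose_filterlim)
  moreover have "\<forall>\<^sub>F T::real in at_top. T > 0" by real_asymp
  moreover have "\<forall>\<^sub>F T::real in at_top. ln T * ln (ln (ln T)) / ln (ln T) > 0" by real_asymp
  ultimately have "\<forall>\<^sub>F T::real in at_top.
           (SUP t\<in>{T powr \<beta>..T}. ereal (zeta_S t))
              \<ge> ereal (c / 2 * sqrt (ln T * ln (ln (ln T)) / ln (ln T))) \<and>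
           (SUP t\<in>{T powr \<beta>..T}. ereal (- zeta_S t))
              \<ge> ereal (c / 2 * sqrt (ln T * ln (ln (ln T)) / ln (ln T)))"
  proof eventually_elim
    case (elim T)
    define B where "B = c * sqrt (ln T * ln (ln (ln T)) / ln (ln T))"
    have B: "B > 0" using c elim(3) by (simp add: B_def)
    have int: "{exp (\<beta> * ln T)..exp (ln T)} = {T powr \<beta>..T}" using elim(2) by (simp add: powr_def)
    have "B \<le> M" if "0 \<le> M" "\<forall>t\<in>{T powr \<beta>..T}. zeta_S t \<le> M" for M
      using elim(1)[rule_format, of 1 M] that unfolding int B_def by auto
    moreover have "B \<le> M" if "0 \<le> M" "\<forall>t\<in>{T powr \<beta>..T}. - zeta_S t \<le> M" for M
      using elim(1)[rule_format, of "-1" M] that unfolding int B_def by auto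
    ultimately show ?case using SUP_ereal_ge_half[OF B] by (simp add: B_def)
  qed
  then show ?thesis using c by (intro exI[of _ "c / 2"]) auto
qed

end
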